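(* The vector field $v(\phi;\mathbf{x})=(\varpi(x,y),\varrho(x,y))$ of a flow $\phi$ is a pair of homogeneous rational functions of degree $2$. Conversely, let $\varpi,\varrho\in\mathbb{R}(x,y)$ be $2$-homogeneous rational functions, not both zero. The pair $(\varpi,\varrho)$ is the vector field of a rational flow if and only if one of the following holds: 1. $y\varpi(x,y)-x\varrho(x,y)\equiv0$ (in which case the flow has level $0$); 2. $y\varpi_\star(x,y)-x\varrho_\star(x,y)\equiv0$, where the subscript $\star$ denotes the partial derivative with respect to $x$, or with respect to $y$ (in which case the flow has level $1$); 3. $$\frac{y\varpi_y(x,y)-x\varrho_y(x,y)}{y\varpi_x(x,y)-x\varrho_x(x,y)}=\frac{ax+by}{cx+dy}$$ for certain $a,b,c,d\in\mathbb{R}$ satisfying $a\ne d$ and $$\frac{(a+d)^2-4bc}{(a-d)^2}=N^2\quad\text{for a certain positive integer }N$$ (in which case $N$ is exactly the level of the flow).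
   Context: A flow is a pair $\phi=(u,v)$ of rational functions in $\mathbb{R}(x,y)$, $\phi\ne(x,y)$, satisfying, as identities of rational functions, $(1-z)\phi(\mathbf{x})=\phi\big(\phi(\mathbf{x}z)\frac{1-z}{z}\big)$ and $\lim_{z\to0}\phi(\mathbf{x}z)/z=\mathbf{x}$, where $\mathbf{x}=(x,y)$. Its vector field is $v(\phi;\mathbf{x})=(\varpi(x,y),\varrho(x,y))=\lim_{z\to0}\frac{z^{-1}\phi(\mathbf{x}z)-\mathbf{x}}{z}$. A function is $k$-homogeneous if it is homogeneous of degree $k$. A $1$-BIR is a birational plane transformation over $\mathbb{R}$ whose two coordinates are $1$-homogeneous rational functions. The level of a flow $\phi$ is the unique integer $N\ge 0$ such that $\phi=\ell^{-1}\circ\phi_N\circ\ell$ for some $1$-BIR $\ell$, where $\phi_N(x,y)=\big(x(y+1)^{N-1},\frac{y}{y+1}\big)$. *)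

theory Defs
  imports Complex_Main "HOL-Computational_Algebra.Computational_Algebra"
    "HOL-Computational_Algebra.Field_as_Ring"
begin

text \<open>
  \<open>rat2\<close> is the field \<open>\<real>(x,y)\<close> and \<open>rat3\<close> the field \<open>\<real>(x,y,z)\<close>. In iterated polynomials
  \<open>x\<close> is the innermost variable, followed by \<open>y\<close> and then \<open>z\<close>.
\<close>

type_synonym rat2 = "real poly poly fract"
type_synonym rat3 = "real poly poly poly fract"

definition const2 :: "real \<Rightarrow> rat2" where "const2 c = to_fract [:[:c:]:]"
definition X :: rat2 where "X = to_fract [:[:0, 1:]:]"
definition Y :: rat2 where "Y = to_fract [:0, 1:]"

definition const3 :: "real \<Rightarrow> rat3" where "const3 c = to_fract [:[:[:c:]:]:]"
definition X3 :: rat3 where "X3 = to_fract [:[:[:0, 1:]:]:]"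
definition Y3 :: rat3 where "Y3 = to_fract [:[:0, 1:]:]"
definition Z3 :: rat3 where "Z3 = to_fract [:0, 1:]"


subsection \<open>Substitution into rational functions\<close>

text \<open>
  In the following, \<open>h\<close> embeds the coefficient field \<open>\<real>\<close> into the field in which values are
  taken: \<open>h = id\<close> gives evaluation at a real point, \<open>h = const2\<close> and \<open>h = const3\<close> give
  substitution of rational functions. Fractions are evaluated in lowest terms, so that
  \<open>subst_ok\<close> holds as soon as some representation as a fraction has a denominator that does not
  vanish after the substitution. Where \<open>subst_ok\<close> fails, \<open>rsubst\<close> has no meaning.
\<close>

definition psubst :: "(real \<Rightarrow> 'f::field) \<Rightarrow> real poly poly \<Rightarrow> 'f \<Rightarrow> 'f \<Rightarrow> 'f" where
  "psubst h p s t = poly (map_poly (\<lambda>q. poly (map_poly h q) s) p) t"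

definition subst_ok :: "(real \<Rightarrow> 'f::field) \<Rightarrow> rat2 \<Rightarrow> 'f \<Rightarrow> 'f \<Rightarrow> bool" where
  "subst_ok h f s t \<longleftrightarrow> psubst h (snd (quot_of_fract f)) s t \<noteq> 0"

definition rsubst :: "(real \<Rightarrow> 'f::field) \<Rightarrow> rat2 \<Rightarrow> 'f \<Rightarrow> 'f \<Rightarrow> 'f" where
  "rsubst h f s t = psubst h (fst (quot_of_fract f)) s t / psubst h (snd (quot_of_fract f)) s t"

abbreviation value_at :: "rat2 \<Rightarrow> real \<Rightarrow> real \<Rightarrow> real" where
  "value_at \<equiv> rsubst id"

text \<open>Validity at all real points outside a proper algebraic subset of the plane.\<close>

definition generically :: "(real \<Rightarrow> real \<Rightarrow> bool) \<Rightarrow> bool" where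
  "generically P \<longleftrightarrow> (\<exists>d. d \<noteq> 0 \<and> (\<forall>a b. psubst id d a b \<noteq> 0 \<longrightarrow> P a b))"

definition homogeneous :: "int \<Rightarrow> rat2 \<Rightarrow> bool" where
  "homogeneous k f \<longleftrightarrow> rsubst const3 f (X3 * Z3) (Y3 * Z3) = Z3 powi k * rsubst const3 f X3 Y3"


subsection \<open>Partial derivatives\<close>

definition pdiff_x :: "real poly poly \<Rightarrow> real poly poly" where
  "pdiff_x = map_poly pderiv"

definition diff_x :: "rat2 \<Rightarrow> rat2" where
  "diff_x f = (case quot_of_fract f of (p, q) \<Rightarrow> Fract (pdiff_x p * q - p * pdiff_x q) (q\<^sup>2))"

definition diff_y :: "rat2 \<Rightarrow> rat2" where
  "diff_y f = (case quot_of_fract f of (p, q) \<Rightarrow> Fract (pderiv p * q - p * pderiv q) (q\<^sup>2))"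


subsection \<open>Rational maps of the plane\<close>

definition composable :: "rat2 \<times> rat2 \<Rightarrow> rat2 \<times> rat2 \<Rightarrow> bool" where
  "composable \<phi> \<psi> \<longleftrightarrow> subst_ok const2 (fst \<phi>) (fst \<psi>) (snd \<psi>)
                   \<and> subst_ok const2 (snd \<phi>) (fst \<psi>) (snd \<psi>)"

definition comp2 :: "rat2 \<times> rat2 \<Rightarrow> rat2 \<times> rat2 \<Rightarrow> rat2 \<times> rat2" where
  "comp2 \<phi> \<psi> = (rsubst const2 (fst \<phi>) (fst \<psi>) (snd \<psi>), rsubst const2 (snd \<phi>) (fst \<psi>) (snd \<psi>))"

definition birational_inverse :: "rat2 \<times> rat2 \<Rightarrow> rat2 \<times> rat2 \<Rightarrow> bool" where
  "birational_inverse l m \<longleftrightarrow>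
     composable l m \<and> comp2 l m = (X, Y) \<and> composable m l \<and> comp2 m l = (X, Y)"

definition one_BIR :: "rat2 \<times> rat2 \<Rightarrow> bool" where
  "one_BIR l \<longleftrightarrow>
     homogeneous 1 (fst l) \<and> homogeneous 1 (snd l) \<and> (\<exists>m. birational_inverse l m)"


subsection \<open>Flows, vector fields and levels\<close>

definition rational_flow :: "rat2 \<times> rat2 \<Rightarrow> bool" where
  "rational_flow \<phi> \<longleftrightarrow>
     \<phi> \<noteq> (X, Y) \<and>
     (let u = fst \<phi>; v = snd \<phi>;
          s = rsubst const3 u (X3 * Z3) (Y3 * Z3) * ((1 - Z3) / Z3);
          t = rsubst const3 v (X3 * Z3) (Y3 * Z3) * ((1 - Z3) / Z3)
      in subst_ok const3 u s t \<and> subst_ok const3 v s t \<and>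
         (1 - Z3) * rsubst const3 u X3 Y3 = rsubst const3 u s t \<and>
         (1 - Z3) * rsubst const3 v X3 Y3 = rsubst const3 v s t) \<and>
     generically (\<lambda>a b.
       ((\<lambda>z. value_at (fst \<phi>) (a * z) (b * z) / z) \<longlongrightarrow> a) (at 0) \<and>
       ((\<lambda>z. value_at (snd \<phi>) (a * z) (b * z) / z) \<longlongrightarrow> b) (at 0))"

definition has_vector_field :: "rat2 \<times> rat2 \<Rightarrow> rat2 \<times> rat2 \<Rightarrow> bool" where
  "has_vector_field \<phi> w \<longleftrightarrow>
     generically (\<lambda>a b.
       ((\<lambda>z. (value_at (fst \<phi>) (a * z) (b * z) / z - a) / z) \<longlongrightarrow> value_at (fst w) a b) (at 0) \<and>
       ((\<lambda>z. (value_at (snd \<phi>) (a * z) (b * z) / z - b) / z) \<longlongrightarrow> value_at (snd w) a b) (at 0))"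

definition canonical_flow :: "nat \<Rightarrow> rat2 \<times> rat2" where
  "canonical_flow N = (X * (Y + 1) powi (int N - 1), Y / (Y + 1))"

definition conjugate_to_canonical :: "rat2 \<times> rat2 \<Rightarrow> nat \<Rightarrow> bool" where
  "conjugate_to_canonical \<phi> N \<longleftrightarrow>
     (\<exists>l m. one_BIR l \<and> birational_inverse l m \<and>
            composable (canonical_flow N) l \<and>
            composable m (comp2 (canonical_flow N) l) \<and>
            \<phi> = comp2 m (comp2 (canonical_flow N) l))"

text \<open>The equivalence includes the uniqueness of the level.\<close>

definition has_level :: "rat2 \<times> rat2 \<Rightarrow> nat \<Rightarrow> bool" where
  "has_level \<phi> N \<longleftrightarrow> (\<forall>M. conjugate_to_canonical \<phi> M \<longleftrightarrow> M = N)"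


subsection \<open>The three conditions on a vector field\<close>

definition level0_condition :: "rat2 \<Rightarrow> rat2 \<Rightarrow> bool" where
  "level0_condition \<omega> \<rho> \<longleftrightarrow> Y * \<omega> - X * \<rho> = 0"

definition level1_condition :: "rat2 \<Rightarrow> rat2 \<Rightarrow> bool" where
  "level1_condition \<omega> \<rho> \<longleftrightarrow>
     Y * diff_x \<omega> - X * diff_x \<rho> = 0 \<or> Y * diff_y \<omega> - X * diff_y \<rho> = 0"

text \<open>Both sides of the ratio equation are required to be honest quotients, as \<open>t / 0 = 0\<close> here.\<close>

definition ratio_condition :: "rat2 \<Rightarrow> rat2 \<Rightarrow> nat \<Rightarrow> bool" where
  "ratio_condition \<omega> \<rho> N \<longleftrightarrow>
     (\<exists>a b c d :: real.
        Y * diff_x \<omega> - X * diff_x \<rho> \<noteq> 0 \<and>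
        const2 c * X + const2 d * Y \<noteq> 0 \<and>
        (Y * diff_y \<omega> - X * diff_y \<rho>) / (Y * diff_x \<omega> - X * diff_x \<rho>)
          = (const2 a * X + const2 b * Y) / (const2 c * X + const2 d * Y) \<and>
        a \<noteq> d \<and> ((a + d)\<^sup>2 - 4 * b * c) / (a - d)\<^sup>2 = (real N)\<^sup>2)"

end

theory Submission
  imports Defs
begin

text \<open>
  Put \<open>F\<^sup>t(x) = \<phi>(t x) / t\<close>. The translation equation says that \<open>F\<^sup>1 = F\<^sup>1\<^sup>-\<^sup>z \<circ> F\<^sup>z\<close>, and after rescaling it
  says that \<open>F\<close> is a one-parameter group. A flow is thus a vector field all of whose integral
  curves are rational in the time \<open>t\<close>, with the special feature that \<open>F\<^sup>t\<close> is conjugate to \<open>F\<^sup>1\<close> by a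
  homothety; this feature forces the field to be homogeneous of degree two
  (\<open>flow_vector_field_homogeneous\<close>). The lemma \<open>flow_curve\<close> makes the integral curves explicit.

  \<^bold>\<open>From the field to the flow.\<close> The canonical flow of level \<open>N\<close> has the field
  \<open>((N - 1) x y, - y\<^sup>2)\<close>. A \<open>1\<close>-homogeneous birational \<open>l = (l\<^sub>1, l\<^sub>2)\<close> carries \<open>(\<omega>, \<rho>)\<close> to it exactly if
  the derivatives of \<open>l\<^sub>1\<close> and \<open>l\<^sub>2\<close> along \<open>(\<omega>, \<rho>)\<close> are \<open>(N - 1) l\<^sub>1 l\<^sub>2\<close> and \<open>- l\<^sub>2\<^sup>2\<close>. Given such an \<open>l\<close>, the
  conjugate of the canonical flow is a flow with field \<open>(\<omega>, \<rho>)\<close> (\<open>conjugate_is_flow\<close>), and there is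
  no other one, since along an integral curve \<open>1 / l\<^sub>2\<close> grows linearly (\<open>flow_is_conjugate\<close>). Each of
  the three conditions provides an \<open>l\<close> whose coordinates are two linear forms times a common
  \<open>0\<close>-homogeneous factor (\<open>linearisation_level_0\<close>, \<open>linearisation_positive_level\<close>). In the second and
  third case, with \<open>G = y \<omega> - x \<rho>\<close>, the linear forms are the factors of the quadratic form
  \<open>c x\<^sup>2 + (a + d) x y + b y\<^sup>2\<close>; the discriminant condition says that they exist and that their
  determinant is \<open>N (a - d)\<close>. Second and third condition are treated together by clearing
  denominators (\<open>projective_ratio\<close>).

  \<^bold>\<open>From the flow to the field.\<close> Let \<open>y \<omega> - x \<rho>\<close> be different from \<open>0\<close>, as otherwise the first condition
  holds. Along an integral curve, the projective coordinate \<open>w = x / y\<close> is a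
  rational function of the time and satisfies an autonomous equation \<open>w'' = \<sigma>(w) w'\<^sup>2\<close>, where \<open>\<sigma>\<close> is
  the \<open>0\<close>-homogeneous function \<open>y (y \<omega>\<^sub>x - x \<rho>\<^sub>x) / (y \<omega> - x \<rho>)\<close> (\<open>ratio_along_flow\<close>). Take first
  \<open>w(\<infinity>) = \<infinity>\<close>. If \<open>w\<close> also had a finite pole, comparing leading terms at \<open>\<infinity>\<close> and at the pole would
  give two incompatible values for the leading coefficient of \<open>\<sigma>\<close> at \<open>\<infinity>\<close>. So \<open>w\<close> is a polynomial, and
  counting degrees gives \<open>\<sigma>(w) = (N - 1) / (N (w - c))\<close> with \<open>N\<close> the degree of \<open>w\<close>
  (\<open>totally_ramified_solution\<close>). If \<open>w(\<infinity>)\<close> is finite, a projective change of coordinate reduces to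
  this case. Since \<open>\<sigma>\<close> determines the quotient in the third condition, the condition follows
  (\<open>projective_ratio_of_flow\<close>).

  \<^bold>\<open>The level is unique.\<close> Along a ray, the canonical flow of level \<open>N\<close> moves the ratio of the
  coordinates along a polynomial of degree \<open>N\<close> in the time. Two conjugating transformations have
  ratios that are related by a univariate rational function, so that degrees force \<open>N\<close> and \<open>M\<close> to
  divide each other (\<open>level_dvd\<close>).

  All identities between rational functions are proved by evaluation at generic real points, where
  limits and derivatives are available. A rational function is determined by its generic values
  (\<open>rat2_eqI\<close>, \<open>rat3_eqI\<close>), evaluation commutes with substitution (\<open>eval_rsubst\<close>), and conversely a
  symbolic substitution is defined as soon as it is defined at a single real point. Genericity is
  transported along rays, cones and dominant maps by \<open>generically_line\<close>, \<open>generically_cone\<close> and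
  \<open>generically_pullback\<close>.
\<close>

section \<open>Evaluation of fractions along a ring homomorphism\<close>

locale unital_hom =
  fixes g :: "'a::comm_ring_1 \<Rightarrow> 'b::comm_ring_1"
  assumes hom_zero: "g 0 = 0" and hom_one: "g 1 = 1"
    and hom_add: "g (x + y) = g x + g y" and hom_mult: "g (x * y) = g x * g y"
begin

lemma hom_uminus: "g (- x) = - g x"
  using hom_add[of x "- x"] hom_zero by (simp add: eq_neg_iff_add_eq_0 add.commute)

lemma hom_diff: "g (x - y) = g x - g y"
  using hom_add[of x "- y"] hom_uminus by simp

lemma hom_power: "g (x ^ n) = g x ^ n"
  by (induction n) (simp_all add: hom_one hom_mult)

end

lemma unital_hom_id: "unital_hom (id :: 'a::comm_ring_1 \<Rightarrow> 'a)"
  by unfold_locales auto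

lemma poly_map_poly_pCons:
  assumes "g 0 = 0"
  shows "poly (map_poly g (pCons c q)) t = g c + t * poly (map_poly g q) t"
  using assms by (simp add: map_poly_pCons)

lemma unital_hom_poly_map_poly:
  assumes "unital_hom g"
  shows "unital_hom (\<lambda>p. poly (map_poly g p) t)"
proof -
  interpret unital_hom g by fact
  have add: "poly (map_poly g (p + q)) t = poly (map_poly g p) t + poly (map_poly g q) t" for p q
    by (induction p q rule: poly_induct2)
      (simp_all add: poly_map_poly_pCons hom_zero hom_add algebra_simps)
  have smult: "poly (map_poly g (smult c p)) t = g c * poly (map_poly g p) t" for c p
    by (induction p) (simp_all add: poly_map_poly_pCons hom_zero hom_mult algebra_simps)
  have mult: "poly (map_poly g (p * q)) t = poly (map_poly g p) t * poly (map_poly g q) t" for p q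
    by (induction p) (simp_all add: poly_map_poly_pCons hom_zero hom_mult add smult algebra_simps)
  show ?thesis
    by unfold_locales (simp_all add: add mult hom_one map_poly_1')
qed

lemma unital_hom_psubst:
  "unital_hom h \<Longrightarrow> unital_hom (\<lambda>p. psubst h p s t)"
  unfolding psubst_def by (intro unital_hom_poly_map_poly)

text \<open>
  A ring homomorphism from \<open>R\<close> into a field extends only partially to the fraction field of \<open>R\<close>. As
  in \<^const>\<open>rsubst\<close>, the extension is computed from the fraction in lowest terms.
\<close>

definition fval :: "('a::{factorial_ring_gcd,semiring_gcd_mult_normalize} \<Rightarrow> 'b::field) \<Rightarrow> 'a fract \<Rightarrow> 'b"
  where "fval e f = e (fst (quot_of_fract f)) / e (snd (quot_of_fract f))"

definition fok :: "('a::{factorial_ring_gcd,semiring_gcd_mult_normalize} \<Rightarrow> 'b::field) \<Rightarrow> 'a fract \<Rightarrow> bool"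
  where "fok e f \<longleftrightarrow> e (snd (quot_of_fract f)) \<noteq> 0"

lemma Fract_quot_of_fract:
  "Fract (fst (quot_of_fract f)) (snd (quot_of_fract f)) = f"
  using quot_to_fract_quot_of_fract[of f] by (simp add: quot_to_fract_def case_prod_unfold)

lemma snd_quot_of_fract_neq_0: "snd (quot_of_fract f) \<noteq> 0"
  using quot_of_fract_in_normalized_fracts[of f]
  by (metis not_normalized_fracts_0_denom prod.collapse)

lemma fok_cases:
  assumes "fok e f"
  obtains p q where "f = Fract p q" "q \<noteq> 0" "e q \<noteq> 0" "fval e f = e p / e q"
  using assms Fract_quot_of_fract[of f] snd_quot_of_fract_neq_0[of f] unfolding fok_def fval_def
  by metis

locale field_valued_hom = unital_hom e
  for e :: "'a::{factorial_ring_gcd,semiring_gcd_mult_normalize} \<Rightarrow> 'b::field"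
begin

text \<open>
  Any representation with a denominator that survives under \<open>e\<close> yields the value: the reduced
  denominator divides that denominator, so it survives as well.
\<close>

lemma eval_Fract:
  assumes "e q \<noteq> 0"
  shows "fok e (Fract p q)" and "fval e (Fract p q) = e p / e q"
proof -
  define a where "a = fst (quot_of_fract (Fract p q))"
  define b where "b = snd (quot_of_fract (Fract p q))"
  have q: "q \<noteq> 0" using assms hom_zero by auto
  have b: "b \<noteq> 0" unfolding b_def by (rule snd_quot_of_fract_neq_0)
  have "Fract a b = Fract p q" unfolding a_def b_def by (rule Fract_quot_of_fract)
  then have eq: "a * q = p * b" using q b by (simp add: eq_fract)
  have cop: "coprime a b"
    using quot_of_fract_in_normalized_fracts[of "Fract p q"]
    by (simp add: normalized_fracts_def a_def b_def case_prod_unfold)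
  have "b dvd a * q" using eq by simp
  then have "b dvd q" using cop by (simp add: coprime_commute coprime_dvd_mult_right_iff)
  then obtain k where "q = b * k" by (elim dvdE)
  then have eb: "e b \<noteq> 0" using assms hom_mult by auto
  then show "fok e (Fract p q)" by (simp add: fok_def b_def)
  have "e a * e q = e p * e b" using eq hom_mult by metis
  then show "fval e (Fract p q) = e p / e q"
    using eb assms by (simp add: fval_def a_def[symmetric] b_def[symmetric] field_simps)
qed

lemma eval_to_fract: "fok e (to_fract p)" "fval e (to_fract p) = e p"
  by (simp_all add: fok_def fval_def hom_one)

lemma eval_zero: "fok e 0" "fval e 0 = 0" and eval_one: "fok e 1" "fval e 1 = 1"
  using eval_to_fract[of 0] eval_to_fract[of 1] hom_zero hom_one by simp_all

lemma eval_add: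
  assumes "fok e f" "fok e g"
  shows "fok e (f + g)" "fval e (f + g) = fval e f + fval e g"
proof -
  obtain p q where 1: "f = Fract p q" "q \<noteq> 0" "e q \<noteq> 0" "fval e f = e p / e q"
    using fok_cases[OF assms(1)] by metis
  obtain r s where 2: "g = Fract r s" "s \<noteq> 0" "e s \<noteq> 0" "fval e g = e r / e s"
    using fok_cases[OF assms(2)] by metis
  have *: "f + g = Fract (p * s + r * q) (q * s)" using 1 2 by (simp add: mult.commute)
  show "fok e (f + g)" unfolding * using 1 2 by (intro eval_Fract) (simp add: hom_mult)
  show "fval e (f + g) = fval e f + fval e g" unfolding 1(4) 2(4) unfolding *
    by (subst eval_Fract) (use 1 2 in \<open>simp_all add: hom_mult hom_add field_simps\<close>)
qed

lemma eval_mult: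
  assumes "fok e f" "fok e g"
  shows "fok e (f * g)" "fval e (f * g) = fval e f * fval e g"
proof -
  obtain p q where 1: "f = Fract p q" "q \<noteq> 0" "e q \<noteq> 0" "fval e f = e p / e q"
    using fok_cases[OF assms(1)] by metis
  obtain r s where 2: "g = Fract r s" "s \<noteq> 0" "e s \<noteq> 0" "fval e g = e r / e s"
    using fok_cases[OF assms(2)] by metis
  have *: "f * g = Fract (p * r) (q * s)" using 1 2 by simp
  show "fok e (f * g)" unfolding * using 1 2 by (intro eval_Fract) (simp add: hom_mult)
  show "fval e (f * g) = fval e f * fval e g" unfolding 1(4) 2(4) unfolding *
    by (subst eval_Fract) (use 1 2 in \<open>simp_all add: hom_mult hom_add field_simps\<close>)
qed

lemma eval_uminus:
  assumes "fok e f"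
  shows "fok e (- f)" "fval e (- f) = - fval e f"
proof -
  have "fok e (to_fract (-1) * f)" "fval e (to_fract (-1) * f) = - fval e f"
    using eval_mult[OF eval_to_fract(1) assms, of "-1"]
    by (simp_all add: eval_to_fract hom_uminus hom_one del: to_fract_uminus)
  then show "fok e (- f)" "fval e (- f) = - fval e f" by simp_all
qed

lemma eval_diff:
  assumes "fok e f" "fok e g"
  shows "fok e (f - g)" "fval e (f - g) = fval e f - fval e g"
  using eval_add[OF assms(1) eval_uminus(1)[OF assms(2)]] eval_uminus(2)[OF assms(2)] by simp_all

lemma eval_inverse:
  assumes "fok e f" "fval e f \<noteq> 0"
  shows "fok e (inverse f)" "fval e (inverse f) = inverse (fval e f)"
proof -
  obtain p q where 1: "f = Fract p q" "q \<noteq> 0" "e q \<noteq> 0" "fval e f = e p / e q"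
    using fok_cases[OF assms(1)] by metis
  have p: "e p \<noteq> 0" using assms(2) 1(4) by auto
  have *: "inverse f = Fract q p" using 1 by simp
  show "fok e (inverse f)" unfolding * using p by (rule eval_Fract)
  show "fval e (inverse f) = inverse (fval e f)"
    unfolding 1(4) unfolding * using eval_Fract(2)[OF p] by simp
qed

lemma eval_divide:
  assumes "fok e f" "fok e g" "fval e g \<noteq> 0"
  shows "fok e (f / g)" "fval e (f / g) = fval e f / fval e g"
  using eval_mult[OF assms(1) eval_inverse(1)[OF assms(2,3)]] eval_inverse(2)[OF assms(2,3)]
  by (simp_all add: divide_inverse)

lemma eval_power:
  assumes "fok e f"
  shows "fok e (f ^ n)" "fval e (f ^ n) = fval e f ^ n"
proof -
  have "fok e (f ^ n) \<and> fval e (f ^ n) = fval e f ^ n"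
    by (induction n) (simp_all add: eval_one eval_mult assms)
  then show "fok e (f ^ n)" "fval e (f ^ n) = fval e f ^ n" by auto
qed

lemma eval_powi:
  assumes "fok e f" "fval e f \<noteq> 0"
  shows "fok e (f powi k)" "fval e (f powi k) = fval e f powi k"
  using assms by (simp_all add: power_int_def eval_power eval_inverse)

lemma eval_poly_map_poly:
  assumes "\<And>c. fok e (h' c) \<and> fval e (h' c) = h c" "h' 0 = 0" "h 0 = 0" "fok e s"
  shows "fok e (poly (map_poly h' q) s) \<and> fval e (poly (map_poly h' q) s) = poly (map_poly h q) (fval e s)"
  using assms
  by (induction q) (simp_all add: poly_map_poly_pCons eval_zero eval_add eval_mult)

lemma eval_psubst:
  assumes "\<And>c. fok e (h' c) \<and> fval e (h' c) = h c" "h' 0 = 0" "h 0 = 0" "fok e s" "fok e t"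
  shows "fok e (psubst h' p s t)" "fval e (psubst h' p s t) = psubst h p (fval e s) (fval e t)"
proof -
  have "fok e (psubst h' p s t) \<and> fval e (psubst h' p s t) = psubst h p (fval e s) (fval e t)"
    unfolding psubst_def
    by (rule eval_poly_map_poly) (use assms in \<open>simp_all add: eval_poly_map_poly\<close>)
  then show "fok e (psubst h' p s t)" "fval e (psubst h' p s t) = psubst h p (fval e s) (fval e t)"
    by auto
qed

text \<open>
  Besides computing values, this lemma transfers definedness in the useful direction: if \<open>f\<close> can be
  substituted at the values of \<open>s\<close> and \<open>t\<close> under one homomorphism, then the symbolic substitution of
  \<open>s\<close> and \<open>t\<close> into \<open>f\<close> is legitimate, because a denominator with a nonzero value is nonzero.
\<close>

lemma eval_rsubst:
  assumes h: "\<And>c. fok e (h' c) \<and> fval e (h' c) = h c" "h' 0 = 0" "h 0 = 0" "fok e s" "fok e t"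
    and ok: "subst_ok h f (fval e s) (fval e t)"
  shows "subst_ok h' f s t" "fok e (rsubst h' f s t)"
    "fval e (rsubst h' f s t) = rsubst h f (fval e s) (fval e t)"
proof -
  note ps = eval_psubst[where h = h and h' = h' and s = s and t = t, OF h]
  show "subst_ok h' f s t"
    unfolding subst_ok_def
  proof
    assume "psubst h' (snd (quot_of_fract f)) s t = 0"
    then show False using ps(2)[of "snd (quot_of_fract f)"] ok by (simp add: subst_ok_def eval_zero)
  qed
  show "fok e (rsubst h' f s t)"
    "fval e (rsubst h' f s t) = rsubst h f (fval e s) (fval e t)"
    using ok unfolding rsubst_def subst_ok_def
    by (simp_all add: ps eval_divide)
qed

end

lemma field_valued_hom_psubst:
  fixes h :: "real \<Rightarrow> 'f::field"
  shows "unital_hom h \<Longrightarrow> field_valued_hom (\<lambda>p. psubst h p s t)"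
  unfolding field_valued_hom_def by (rule unital_hom_psubst)

lemma subst_ok_iff_fok: "subst_ok h f s t \<longleftrightarrow> fok (\<lambda>p. psubst h p s t) f"
  and rsubst_eq_fval: "rsubst h f s t = fval (\<lambda>p. psubst h p s t) f"
  by (simp_all add: subst_ok_def rsubst_def fok_def fval_def)

lemma unital_hom_const2: "unital_hom const2"
  and unital_hom_const3: "unital_hom const3"
  by (unfold_locales; simp add: const2_def const3_def flip: to_fract_add to_fract_mult one_pCons)+

section \<open>Evaluation at real points\<close>

abbreviation ok_at :: "rat2 \<Rightarrow> real \<Rightarrow> real \<Rightarrow> bool" where
  "ok_at \<equiv> subst_ok id"

lemma psubst_simps [simp]:
  "psubst id 0 a b = 0" "psubst id 1 a b = 1"
  "psubst id (p + q) a b = psubst id p a b + psubst id q a b"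
  "psubst id (p - q) a b = psubst id p a b - psubst id q a b"
  "psubst id (- p) a b = - psubst id p a b"
  "psubst id (p * q) a b = psubst id p a b * psubst id q a b"
  "psubst id (p ^ n) a b = psubst id p a b ^ n"
proof -
  interpret unital_hom "\<lambda>p. psubst id p a b :: real" by (rule unital_hom_psubst[OF unital_hom_id])
  show "psubst id 0 a b = 0" "psubst id 1 a b = 1"
  "psubst id (p + q) a b = psubst id p a b + psubst id q a b"
  "psubst id (p - q) a b = psubst id p a b - psubst id q a b"
  "psubst id (- p) a b = - psubst id p a b"
  "psubst id (p * q) a b = psubst id p a b * psubst id q a b"
  "psubst id (p ^ n) a b = psubst id p a b ^ n"
    by (simp_all only: hom_zero hom_one hom_add hom_diff hom_uminus hom_mult hom_power)
qed

lemma psubst_pCons: "psubst id (pCons q p) a b = poly q a + b * psubst id p a b"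
  by (simp add: psubst_def poly_map_poly_pCons)

lemma field_valued_hom_at: "field_valued_hom (\<lambda>p. psubst id p a b :: real)"
  by (rule field_valued_hom_psubst[OF unital_hom_id])

context
  fixes a b :: real
begin

interpretation field_valued_hom "\<lambda>p. psubst id p a b :: real" by (rule field_valued_hom_at)

lemmas ok_intros =
  eval_to_fract(1)[folded subst_ok_iff_fok] eval_zero(1)[folded subst_ok_iff_fok]
  eval_one(1)[folded subst_ok_iff_fok]
  eval_add(1)[folded subst_ok_iff_fok] eval_diff(1)[folded subst_ok_iff_fok]
  eval_uminus(1)[folded subst_ok_iff_fok]
  eval_mult(1)[folded subst_ok_iff_fok] eval_power(1)[folded subst_ok_iff_fok]
  eval_inverse(1)[folded subst_ok_iff_fok rsubst_eq_fval]
  eval_divide(1)[folded subst_ok_iff_fok rsubst_eq_fval]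
  eval_powi(1)[folded subst_ok_iff_fok rsubst_eq_fval]

lemmas value_simps =
  eval_to_fract(2)[folded rsubst_eq_fval] eval_zero(2)[folded rsubst_eq_fval]
  eval_one(2)[folded rsubst_eq_fval]
  eval_add(2)[folded subst_ok_iff_fok rsubst_eq_fval]
  eval_diff(2)[folded subst_ok_iff_fok rsubst_eq_fval]
  eval_uminus(2)[folded subst_ok_iff_fok rsubst_eq_fval]
  eval_mult(2)[folded subst_ok_iff_fok rsubst_eq_fval]
  eval_power(2)[folded subst_ok_iff_fok rsubst_eq_fval]
  eval_inverse(2)[folded subst_ok_iff_fok rsubst_eq_fval]
  eval_divide(2)[folded subst_ok_iff_fok rsubst_eq_fval]
  eval_powi(2)[folded subst_ok_iff_fok rsubst_eq_fval]

lemmas value_Fract =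
  eval_Fract[folded subst_ok_iff_fok rsubst_eq_fval]

lemma ok_basic: "ok_at X a b" "ok_at Y a b" "ok_at (const2 c) a b"
  and value_basic: "value_at X a b = a" "value_at Y a b = b" "value_at (const2 c) a b = c"
  by (simp_all add: X_def Y_def const2_def ok_intros value_simps psubst_pCons)

lemma const2_zero: "const2 0 = 0" and const2_one: "const2 1 = 1"
  using unital_hom.hom_zero[OF unital_hom_const2] unital_hom.hom_one[OF unital_hom_const2]
  by auto

lemma ok_value_psubst:
  assumes "ok_at g1 a b" "ok_at g2 a b"
  shows "ok_at (psubst const2 p g1 g2) a b"
    "value_at (psubst const2 p g1 g2) a b = psubst id p (value_at g1 a b) (value_at g2 a b)"
  using eval_psubst[of const2 id g1 g2 p] assms ok_basic(3) value_basic(3)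
  by (simp_all add: subst_ok_iff_fok rsubst_eq_fval const2_zero)

lemma ok_value_rsubst:
  assumes "ok_at g1 a b" "ok_at g2 a b" "ok_at f (value_at g1 a b) (value_at g2 a b)"
  shows "subst_ok const2 f g1 g2" "ok_at (rsubst const2 f g1 g2) a b"
    "value_at (rsubst const2 f g1 g2) a b = value_at f (value_at g1 a b) (value_at g2 a b)"
proof -
  have *: "\<And>c. fok (\<lambda>p. psubst id p a b) (const2 c) \<and> fval (\<lambda>p. psubst id p a b) (const2 c) = id c"
    using ok_basic(3) value_basic(3) by (simp add: subst_ok_iff_fok rsubst_eq_fval)
  note R = eval_rsubst[where h' = const2 and h = id and s = g1 and t = g2 and f = f, OF * const2_zero]
  show "subst_ok const2 f g1 g2"
    by (rule R(1)) (use assms in \<open>simp_all add: subst_ok_iff_fok rsubst_eq_fval\<close>)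
  show "ok_at (rsubst const2 f g1 g2) a b"
    unfolding subst_ok_iff_fok
    by (rule R(2)) (use assms in \<open>simp_all add: subst_ok_iff_fok rsubst_eq_fval\<close>)
  have "fval (\<lambda>p. psubst id p a b) (rsubst const2 f g1 g2) =
     rsubst id f (fval (\<lambda>p. psubst id p a b) g1) (fval (\<lambda>p. psubst id p a b) g2)"
    by (rule R(3)) (use assms in \<open>simp_all add: subst_ok_iff_fok rsubst_eq_fval\<close>)
  then show "value_at (rsubst const2 f g1 g2) a b = value_at f (value_at g1 a b) (value_at g2 a b)"
    by (simp add: rsubst_eq_fval)
qed

end

lemma const3_zero [simp]: "const3 0 = 0"
  using unital_hom.hom_zero[OF unital_hom_const3] .

section \<open>Evaluation in three variables\<close>

definition eval3 :: "real poly poly poly \<Rightarrow> real \<Rightarrow> real \<Rightarrow> real \<Rightarrow> real" where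
  "eval3 p a b c = poly (map_poly (\<lambda>q. psubst id q a b) p) c"

definition ok3 :: "rat3 \<Rightarrow> real \<Rightarrow> real \<Rightarrow> real \<Rightarrow> bool" where
  "ok3 f a b c = fok (\<lambda>p. eval3 p a b c) f"

definition val3 :: "rat3 \<Rightarrow> real \<Rightarrow> real \<Rightarrow> real \<Rightarrow> real" where
  "val3 f a b c = fval (\<lambda>p. eval3 p a b c) f"

lemma eval3_pCons: "eval3 (pCons q p) a b c = psubst id q a b + c * eval3 p a b c"
  by (simp add: eval3_def poly_map_poly_pCons)

lemma eval3_0 [simp]: "eval3 0 a b c = 0"
  by (simp add: eval3_def)

lemma field_valued_hom_eval3: "field_valued_hom (\<lambda>p. eval3 p a b c)"
  unfolding eval3_def field_valued_hom_def
  by (intro unital_hom_poly_map_poly unital_hom_psubst unital_hom_id)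

context
  fixes a b c :: real
begin

interpretation field_valued_hom "\<lambda>p. eval3 p a b c" by (rule field_valued_hom_eval3)

lemmas ok3_intros =
  eval_zero(1)[folded ok3_def] eval_one(1)[folded ok3_def]
  eval_add(1)[folded ok3_def] eval_diff(1)[folded ok3_def]
  eval_mult(1)[folded ok3_def] 
  eval_divide(1)[folded ok3_def val3_def]
  eval_powi(1)[folded ok3_def val3_def]

lemmas val3_simps =
  eval_zero(2)[folded val3_def] eval_one(2)[folded val3_def]
  eval_add(2)[folded ok3_def val3_def]
  eval_diff(2)[folded ok3_def val3_def]
  eval_mult(2)[folded ok3_def val3_def]
  eval_divide(2)[folded ok3_def val3_def]
  eval_powi(2)[folded ok3_def val3_def]

lemma ok3_basic: "ok3 X3 a b c" "ok3 Y3 a b c" "ok3 Z3 a b c" "ok3 (const3 r) a b c"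
  and val3_basic: "val3 X3 a b c = a" "val3 Y3 a b c = b" "val3 Z3 a b c = c" "val3 (const3 r) a b c = r"
  by (simp_all add: X3_def Y3_def Z3_def const3_def ok3_def val3_def eval_to_fract eval3_pCons psubst_pCons)

lemma ok3_rsubst:
  assumes "ok3 g1 a b c" "ok3 g2 a b c" "ok_at f (val3 g1 a b c) (val3 g2 a b c)"
  shows "subst_ok const3 f g1 g2" "ok3 (rsubst const3 f g1 g2) a b c"
    "val3 (rsubst const3 f g1 g2) a b c = value_at f (val3 g1 a b c) (val3 g2 a b c)"
proof -
  have *: "\<And>r. fok (\<lambda>p. eval3 p a b c) (const3 r) \<and> fval (\<lambda>p. eval3 p a b c) (const3 r) = id r"
    using ok3_basic(4) val3_basic(4) by (simp add: ok3_def val3_def)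
  note R = eval_rsubst[where h' = const3 and h = id and s = g1 and t = g2 and f = f,
      OF *, folded ok3_def val3_def]
  show "subst_ok const3 f g1 g2" by (rule R(1)) (use assms in simp_all)
  show "ok3 (rsubst const3 f g1 g2) a b c" by (rule R(2)) (use assms in simp_all)
  show "val3 (rsubst const3 f g1 g2) a b c = value_at f (val3 g1 a b c) (val3 g2 a b c)"
    by (rule R(3)) (use assms in simp_all)
qed

end

section \<open>Limits\<close>

lemma tendsto_psubst:
  assumes "(x \<longlongrightarrow> a) F" "(y \<longlongrightarrow> b) F"
  shows "((\<lambda>z. psubst id p (x z) (y z)) \<longlongrightarrow> psubst id p a b) F"
proof (induction p)
  case (pCons q p)
  show ?case unfolding psubst_pCons by (intro tendsto_intros pCons.IH assms)
qed (simp only: psubst_simps tendsto_const)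

lemma tendsto_eval3:
  assumes "(x \<longlongrightarrow> a) F" "(y \<longlongrightarrow> b) F" "(w \<longlongrightarrow> c) F"
  shows "((\<lambda>z. eval3 p (x z) (y z) (w z)) \<longlongrightarrow> eval3 p a b c) F"
proof (induction p)
  case (pCons q p)
  show ?case unfolding eval3_pCons by (intro tendsto_intros tendsto_psubst pCons.IH assms)
qed simp

lemma eventually_ok_at:
  assumes "ok_at f a b" "(x \<longlongrightarrow> a) F" "(y \<longlongrightarrow> b) F"
  shows "eventually (\<lambda>z. ok_at f (x z) (y z)) F"
  using tendsto_imp_eventually_ne[OF tendsto_psubst[OF assms(2,3)]] assms(1)
  unfolding subst_ok_def by blast

lemma tendsto_value_at:
  assumes "ok_at f a b" "(x \<longlongrightarrow> a) F" "(y \<longlongrightarrow> b) F"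
  shows "((\<lambda>z. value_at f (x z) (y z)) \<longlongrightarrow> value_at f a b) F"
  using assms unfolding rsubst_def subst_ok_def
  by (intro tendsto_divide tendsto_psubst)

lemma eventually_neq_0: "eventually (\<lambda>z. z \<noteq> (0::real)) (at 0)"
  by (rule eventually_neq_at_within)

lemma eventually_poly_neq_0:
  fixes p :: "real poly"
  assumes "p \<noteq> 0"
  shows "eventually (\<lambda>z. poly p z \<noteq> 0) (at a)"
proof -
  have "eventually (\<lambda>z. \<forall>r\<in>{z. poly p z = 0}. z \<noteq> r) (at a)"
    using poly_roots_finite[OF assms]
    by (intro eventually_ball_finite) (auto intro: eventually_neq_at_within)
  then show ?thesis by eventually_elim auto
qed

section \<open>Generic points\<close>

lemma exists_poly_neq_0: "p \<noteq> 0 \<Longrightarrow> \<exists>z::real. poly p z \<noteq> 0"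
  using poly_all_0_iff_0 by blast

text \<open>
  A line \<open>x = a\<close> on which the leading coefficient in \<open>y\<close> does not vanish leaves a nonzero univariate
  polynomial.
\<close>

lemma exists_psubst_neq_0:
  assumes "d \<noteq> 0"
  shows "\<exists>a b. psubst id d a b \<noteq> 0"
proof -
  obtain a where a: "poly (lead_coeff d) a \<noteq> 0" using exists_poly_neq_0 assms by fastforce
  define e where "e = map_poly (\<lambda>q. poly q a) d"
  have "coeff e (degree d) \<noteq> 0" unfolding e_def using a by (subst coeff_map_poly) auto
  then have "e \<noteq> 0" by auto
  then obtain b where "poly e b \<noteq> 0" using exists_poly_neq_0 by blast
  then show ?thesis by (auto simp: e_def psubst_def)
qed

lemma generically_mono:
  "generically P \<Longrightarrow> (\<And>a b. P a b \<Longrightarrow> Q a b) \<Longrightarrow> generically Q"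
  unfolding generically_def by blast

lemma generically_conj:
  assumes "generically P" "generically Q"
  shows "generically (\<lambda>a b. P a b \<and> Q a b)"
proof -
  obtain c d where "c \<noteq> 0" "d \<noteq> 0" "\<And>a b. psubst id c a b \<noteq> 0 \<Longrightarrow> P a b"
    "\<And>a b. psubst id d a b \<noteq> 0 \<Longrightarrow> Q a b"
    using assms unfolding generically_def by blast
  then show ?thesis unfolding generically_def by (intro exI[of _ "c * d"]) auto
qed

lemma generically_ex: "generically P \<Longrightarrow> \<exists>a b. P a b"
  unfolding generically_def using exists_psubst_neq_0 by blast

lemma generically_psubst: "d \<noteq> 0 \<Longrightarrow> generically (\<lambda>a b. psubst id d a b \<noteq> 0)"
  unfolding generically_def by blast

lemma generically_ok: "generically (ok_at f)"
  unfolding subst_ok_def by (intro generically_psubst snd_quot_of_fract_neq_0)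

lemma generically_value_neq_0:
  assumes "f \<noteq> 0"
  shows "generically (\<lambda>a b. value_at f a b \<noteq> 0)"
proof -
  have "fst (quot_of_fract f) \<noteq> 0"
    using assms Fract_quot_of_fract[of f] by (metis fract_collapse(1))
  then have "generically (\<lambda>a b. psubst id (fst (quot_of_fract f)) a b \<noteq> 0 \<and> ok_at f a b)"
    by (intro generically_conj generically_psubst generically_ok)
  then show ?thesis
    by (rule generically_mono) (auto simp: rsubst_def subst_ok_def)
qed

lemma rat2_eqI:
  assumes "generically (\<lambda>a b. value_at f a b = value_at g a b)"
  shows "f = g"
proof (rule ccontr)
  assume "f \<noteq> g"
  then have "generically (\<lambda>a b. value_at (f - g) a b \<noteq> 0)"
    by (intro generically_value_neq_0) simp
  then have "generically (\<lambda>a b. ((value_at (f - g) a b \<noteq> 0 \<and> value_at f a b = value_at g a b)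
      \<and> ok_at f a b) \<and> ok_at g a b)"
    by (intro generically_conj generically_ok assms)
  then show False using generically_ex by (fastforce simp: value_simps)
qed

text \<open>
  Over a point of the plane where the leading coefficient in \<open>z\<close> does not vanish, a nonzero
  polynomial restricts to a nonzero polynomial in \<open>z\<close>. Its finitely many roots leave a punctured
  neighbourhood of \<open>0\<close> free.
\<close>

lemma eval3_neq_0:
  assumes "p \<noteq> 0"
  shows "generically (\<lambda>a b. eventually (\<lambda>z. eval3 p a b z \<noteq> 0) (at 0))"
proof -
  have "generically (\<lambda>a b. psubst id (lead_coeff p) a b \<noteq> 0)"
    using assms by (intro generically_psubst) simp
  then show ?thesis
  proof (rule generically_mono)
    fix a b assume ab: "psubst id (lead_coeff p) a b \<noteq> (0::real)"
    have "coeff (map_poly (\<lambda>q. psubst id q a b) p) (degree p) \<noteq> 0"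
      using ab by (subst coeff_map_poly) auto
    then have "map_poly (\<lambda>q. psubst id q a b) p \<noteq> 0" by auto
    then show "eventually (\<lambda>z. eval3 p a b z \<noteq> 0) (at 0)"
      unfolding eval3_def by (rule eventually_poly_neq_0)
  qed
qed

lemma rat3_eqI:
  assumes "generically (\<lambda>a b. eventually (\<lambda>z. ok3 f a b z \<and> ok3 g a b z \<and> val3 f a b z = val3 g a b z) (at 0))"
  shows "f = g"
proof (rule ccontr)
  assume "f \<noteq> g"
  then have "f - g \<noteq> 0" by simp
  then have "fst (quot_of_fract (f - g)) \<noteq> 0" using Fract_quot_of_fract[of "f - g"] by (metis fract_collapse(1))
  from generically_conj[OF eval3_neq_0[OF this] assms] obtain a b where
    "eventually (\<lambda>z. eval3 (fst (quot_of_fract (f - g))) a b z \<noteq> 0) (at 0)"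
    "eventually (\<lambda>z. ok3 f a b z \<and> ok3 g a b z \<and> val3 f a b z = val3 g a b z) (at 0)"
    using generically_ex by blast
  then have "eventually (\<lambda>z::real. False) (at 0)"
  proof eventually_elim
    case (elim z)
    then have "ok3 (f - g) a b z" "val3 (f - g) a b z = 0" by (simp_all add: val3_simps ok3_intros)
    then show ?case using elim by (simp add: ok3_def val3_def fok_def fval_def)
  qed
  then show False by simp
qed

text \<open>
  The complement of an algebraic set is open, and so a generic property persists near a generic
  point.
\<close>

lemma generically_nhds:
  assumes "generically P"
  shows "generically (\<lambda>a b. \<forall>x y (F :: real filter). (x \<longlongrightarrow> a) F \<longrightarrow> (y \<longlongrightarrow> b) F \<longrightarrow> eventually (\<lambda>z. P (x z) (y z)) F)"
proof -
  obtain d where d: "d \<noteq> 0" "\<And>a b. psubst id d a b \<noteq> 0 \<Longrightarrow> P a b"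
    using assms unfolding generically_def by blast
  show ?thesis
  proof (rule generically_mono[OF generically_psubst[OF d(1)]], intro allI impI)
    fix a b and x y :: "real \<Rightarrow> real" and F
    assume "psubst id d a b \<noteq> 0" "(x \<longlongrightarrow> a) F" "(y \<longlongrightarrow> b) F"
    then have "eventually (\<lambda>z. psubst id d (x z) (y z) \<noteq> 0) F"
      by (intro tendsto_imp_eventually_ne[OF tendsto_psubst])
    then show "eventually (\<lambda>z. P (x z) (y z)) F" by eventually_elim (rule d)
  qed
qed

text \<open>
  \<open>p(x z, y z)\<close> as a polynomial in \<open>z\<close>; its coefficients are the homogeneous parts of \<open>p\<close>.
\<close>

definition hexp :: "real poly poly \<Rightarrow> real poly poly poly" where
  "hexp p = poly (map_poly (\<lambda>q. poly (map_poly (\<lambda>c. [:[:[:c:]:]:]) q) [:0, [:[:0, 1:]:]:]) p) [:0, [:0, 1:]:]"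

lemma eval3_hexp: "eval3 (hexp p) a b z = psubst id p (a * z) (b * z)"
proof -
  interpret field_valued_hom "\<lambda>p. eval3 p a b z" by (rule field_valued_hom_eval3)
  have 1: "eval3 (poly (map_poly (\<lambda>c. [:[:[:c:]:]:]) q) [:0, [:[:0, 1:]:]:]) a b z = poly q (a * z)" for q
    by (induction q)
      (simp_all only: poly_map_poly_pCons pCons_0_0 hom_add hom_mult, simp_all add: hom_zero eval3_pCons psubst_pCons algebra_simps)
  have 2: "eval3 [:0, [:0, 1:]:] a b z = b * z" by (simp add: eval3_pCons psubst_pCons)
  show ?thesis unfolding hexp_def
  proof (induction p)
    case 0
    then show ?case by (simp only: map_poly_0 poly_0 hom_zero psubst_simps)
  next
    case (pCons q p)
    show ?case
      by (subst poly_map_poly_pCons) (simp_all only: map_poly_0 poly_0 hom_add hom_mult 1 2 pCons.IH psubst_pCons mult.assoc)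
  qed
qed

lemma hexp_eq_0_iff: "hexp p = 0 \<longleftrightarrow> p = 0"
proof
  assume *: "hexp p = 0"
  show "p = 0"
  proof (rule ccontr)
    assume "p \<noteq> 0"
    then obtain a b where "psubst id p a b \<noteq> (0::real)" using exists_psubst_neq_0 by blast
    then show False using * eval3_hexp[of p a b 1] by simp
  qed
qed (simp add: hexp_def)

text \<open>
  The exceptional curve may pass through the origin, but it does so only in finitely many
  directions, the zeros of the lowest homogeneous part. Points that approach the origin in any other
  direction stay off the curve. The perturbed directions \<open>(x z, y z)\<close> matter because a flow maps
  \<open>(a z, b z)\<close> to a point \<open>z (a + o(1), b + o(1))\<close>.
\<close>

lemma generically_cone:
  assumes "generically P"
  shows "generically (\<lambda>a b. \<forall>x y. (x \<longlongrightarrow> a) (at 0) \<longrightarrow> (y \<longlongrightarrow> b) (at 0) \<longrightarrow> eventually (\<lambda>z. P (x z * z) (y z * z)) (at 0))"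
proof -
  obtain d where d: "d \<noteq> 0" "\<And>a b. psubst id d a b \<noteq> 0 \<Longrightarrow> P a b"
    using assms unfolding generically_def by blast
  have "hexp d \<noteq> 0" using d(1) by (simp add: hexp_eq_0_iff)
  \<comment> \<open>\<open>coeff q 0\<close> is the lowest homogeneous part of \<open>d\<close>, of degree \<open>k\<close>\<close>
  from order_decomp[OF this, of 0] obtain k q where q: "hexp d = [:0, 1:] ^ k * q" "\<not> [:0, 1:] dvd q"
    by auto
  have "poly q 0 \<noteq> 0" using q(2) by (simp add: poly_eq_0_iff_dvd)
  then have c: "coeff q 0 \<noteq> 0" by (simp add: poly_0_coeff_0)
  show ?thesis
  proof (rule generically_mono[OF generically_psubst[OF c]], intro allI impI)
    fix a b and x y :: "real \<Rightarrow> real"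
    assume ab: "psubst id (coeff q 0) a b \<noteq> (0::real)" and x: "(x \<longlongrightarrow> a) (at 0)" and y: "(y \<longlongrightarrow> b) (at 0)"
    have e: "psubst id d (s * z) (t * z) = z ^ k * eval3 q s t z" for s t z
    proof -
      interpret field_valued_hom "\<lambda>p. eval3 p s t z" by (rule field_valued_hom_eval3)
      have "eval3 [:0, 1:] s t z = z" by (simp add: eval3_pCons)
      then show ?thesis unfolding eval3_hexp[symmetric] q(1) hom_mult hom_power by simp
    qed
    have "eval3 q a b 0 \<noteq> 0" using ab by (cases q) (simp add: eval3_pCons)
    then have "eventually (\<lambda>z. eval3 q (x z) (y z) z \<noteq> 0) (at 0)"
      using x y by (intro tendsto_imp_eventually_ne[OF tendsto_eval3[of x a _ y b "\<lambda>z. z" 0]]) auto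
    moreover note eventually_neq_0
    ultimately show "eventually (\<lambda>z. P (x z * z) (y z * z)) (at 0)"
      by eventually_elim (rule d, simp add: e)
  qed
qed

lemma generically_line:
  assumes "generically P"
  shows "generically (\<lambda>a b. eventually (\<lambda>z. P (a * z) (b * z)) (at 0))"
  by (rule generically_mono[OF generically_cone[OF assms]]) auto

text \<open>
  On a generic ray, a nonzero rational function has no zeros close to the origin. Agreement at some
  arbitrarily small \<open>z\<close> is therefore enough, in particular agreement for small positive \<open>z\<close>.
\<close>

lemma generically_lineD:
  assumes "generically (\<lambda>a b. frequently (\<lambda>z. value_at f (a * z) (b * z) = value_at g (a * z) (b * z)) (at 0))"
  shows "f = g"
proof (rule ccontr)
  assume "f \<noteq> g"
  then have "generically (\<lambda>a b. value_at (f - g) a b \<noteq> 0)"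
    by (intro generically_value_neq_0) simp
  then have "generically (\<lambda>a b. (value_at (f - g) a b \<noteq> 0 \<and> ok_at f a b) \<and> ok_at g a b)"
    by (intro generically_conj generically_ok)
  then have "generically (\<lambda>a b. value_at f a b \<noteq> value_at g a b)"
    by (rule generically_mono) (auto simp: value_simps)
  from generically_conj[OF generically_line[OF this] assms] obtain a b where
    "eventually (\<lambda>z. value_at f (a * z) (b * z) \<noteq> value_at g (a * z) (b * z)) (at 0)"
    "frequently (\<lambda>z. value_at f (a * z) (b * z) = value_at g (a * z) (b * z)) (at 0)"
    using generically_ex by blast
  then show False by (simp add: frequently_def)
qed

section \<open>Derivatives\<close>

lemma pdiff_x_pCons: "pdiff_x (pCons q p) = pCons (pderiv q) (pdiff_x p)"
  by (simp add: pdiff_x_def map_poly_pCons)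

lemma pdiff_x_0 [simp]: "pdiff_x 0 = 0"
  by (simp add: pdiff_x_def)

lemma DERIV_psubst:
  assumes "(x has_real_derivative x') (at t)" "(y has_real_derivative y') (at t)"
  shows "((\<lambda>t. psubst id p (x t) (y t)) has_real_derivative
     psubst id (pdiff_x p) (x t) (y t) * x' + psubst id (pderiv p) (x t) (y t) * y') (at t)"
proof (induction p)
  case 0
  then show ?case by (simp only: pdiff_x_def map_poly_0 pderiv_0 psubst_simps) simp
next
  case (pCons q p)
  have 1: "((\<lambda>t. poly q (x t)) has_real_derivative poly (pderiv q) (x t) * x') (at t)"
    using DERIV_chain2[OF poly_DERIV assms(1)] .
  have 2: "psubst id (pderiv (pCons q p)) (x t) (y t) = psubst id p (x t) (y t) + y t * psubst id (pderiv p) (x t) (y t)"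
    by (simp only: pderiv_pCons psubst_simps psubst_pCons poly_0)
  show ?case
    unfolding pdiff_x_pCons psubst_pCons 2
    by (rule derivative_eq_intros 1 assms pCons.IH refl)+ (simp only: algebra_simps)
qed

text \<open>
  The partial derivatives of fractions are given by the quotient rule for the reduced fraction. That
  the rule holds for every representation depends only on the Leibniz rule for polynomials, so both
  partial derivatives are treated at once.
\<close>

locale derivation =
  fixes d :: "'r::{factorial_ring_gcd,semiring_gcd_mult_normalize} \<Rightarrow> 'r"
    and D :: "'r fract \<Rightarrow> 'r fract"
  assumes d_add: "d (p + q) = d p + d q" and d_mult: "d (p * q) = d p * q + p * d q"
    and D_def: "D f = (case quot_of_fract f of (p, q) \<Rightarrow> Fract (d p * q - p * d q) (q\<^sup>2))"
begin

lemma D_Fract: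
  assumes "q \<noteq> 0"
  shows "D (Fract p q) = Fract (d p * q - p * d q) (q\<^sup>2)"
proof -
  define a where "a = fst (quot_of_fract (Fract p q))"
  define b where "b = snd (quot_of_fract (Fract p q))"
  have b: "b \<noteq> 0" unfolding b_def by (rule snd_quot_of_fract_neq_0)
  have "Fract a b = Fract p q" unfolding a_def b_def by (rule Fract_quot_of_fract)
  then have eq: "a * q = p * b" using assms b by (simp add: eq_fract)
  then have "d a * q + a * d q = d p * b + p * d b" by (metis d_mult)
  with eq have "(d a * b - a * d b) * q\<^sup>2 = (d p * q - p * d q) * b\<^sup>2"
    by algebra
  then have "Fract (d a * b - a * d b) (b\<^sup>2) = Fract (d p * q - p * d q) (q\<^sup>2)"
    using assms b by (simp add: eq_fract)
  then show ?thesis by (simp add: D_def a_def b_def case_prod_unfold)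
qed

lemma d_one: "d 1 = 0"
  using d_mult[of 1 1] by (metis add_cancel_right_right mult_1 mult_1_right)

lemma D_to_fract: "D (to_fract p) = to_fract (d p)"
  using D_Fract[of 1 p] by (simp add: to_fract_def d_one)

lemma D_add: "D (f + g) = D f + D g"
proof -
  obtain p q r s where "f = Fract p q" "q \<noteq> 0" "g = Fract r s" "s \<noteq> 0"
    using Fract_quot_of_fract snd_quot_of_fract_neq_0 by metis
  then show ?thesis
    by (simp add: D_Fract eq_fract d_add d_mult) (simp add: algebra_simps power2_eq_square)
qed

lemma D_mult: "D (f * g) = D f * g + f * D g"
proof -
  obtain p q r s where "f = Fract p q" "q \<noteq> 0" "g = Fract r s" "s \<noteq> 0"
    using Fract_quot_of_fract snd_quot_of_fract_neq_0 by metis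
  then show ?thesis
    by (simp add: D_Fract eq_fract d_add d_mult) (simp add: algebra_simps power2_eq_square)
qed

lemma D_zero: "D 0 = 0" using D_add[of 0 0] by (metis add_cancel_right_right)

lemma D_uminus: "D (- f) = - D f"
  using D_add[of f "- f"] D_zero by (simp add: eq_neg_iff_add_eq_0 add.commute)

lemma D_diff: "D (f - g) = D f - D g"
  using D_add[of f "- g"] D_uminus by simp

lemma D_divide: "g \<noteq> 0 \<Longrightarrow> D (f / g) = (D f * g - f * D g) / g\<^sup>2"
  using D_mult[of "f / g" g] by (simp add: field_simps power2_eq_square)

end

lemma derivation_x: "derivation pdiff_x diff_x"
proof (rule derivation.intro)
  have add: "pdiff_x (p + q) = pdiff_x p + pdiff_x q" for p q
    by (induction p q rule: poly_induct2) (simp_all add: pdiff_x_pCons pdiff_x_0 pderiv_add)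
  have sm: "pdiff_x (smult c p) = smult (pderiv c) p + smult c (pdiff_x p)" for c p
    by (induction p) (simp_all add: pdiff_x_pCons pderiv_mult)
  show "pdiff_x (p + q) = pdiff_x p + pdiff_x q" for p q by (rule add)
  show "pdiff_x (p * q) = pdiff_x p * q + p * pdiff_x q" for p q
    by (induction p) (simp_all add: pdiff_x_pCons add sm distrib_left distrib_right)
qed (rule diff_x_def)

lemma derivation_y: "derivation pderiv diff_y"
proof (rule derivation.intro)
  show "pderiv (p * q) = pderiv p * q + p * pderiv q" for p q :: "real poly poly"
    by (simp add: pderiv_mult)
qed (rule pderiv_add, rule diff_y_def)

interpretation dx: derivation pdiff_x diff_x by (rule derivation_x)
interpretation dy: derivation pderiv diff_y by (rule derivation_y)

lemma diff_basic [simp]: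
  "diff_x X = 1" "diff_x Y = 0" "diff_y X = 0" "diff_y Y = 1"
  "diff_x (const2 c) = 0" "diff_y (const2 c) = 0"
  unfolding X_def Y_def const2_def dx.D_to_fract dy.D_to_fract
  by (simp_all add: pdiff_x_pCons pderiv_pCons dx.d_one flip: one_pCons)

lemma
  assumes "ok_at f a b"
  shows ok_at_diff: "ok_at (diff_x f) a b" "ok_at (diff_y f) a b"
  using assms by (simp_all add: diff_x_def diff_y_def case_prod_unfold subst_ok_def[of _ f] value_Fract)

lemma DERIV_value_at:
  assumes "ok_at f (x t) (y t)" "(x has_real_derivative x') (at t)" "(y has_real_derivative y') (at t)"
  shows "((\<lambda>t. value_at f (x t) (y t)) has_real_derivative
     value_at (diff_x f) (x t) (y t) * x' + value_at (diff_y f) (x t) (y t) * y') (at t)"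
proof -
  define p q where "p = fst (quot_of_fract f)" and "q = snd (quot_of_fract f)"
  have q: "psubst id q (x t) (y t) \<noteq> 0" using assms(1) by (simp add: subst_ok_def q_def)
  have v: "value_at f s r = psubst id p s r / psubst id q s r" for s r by (simp add: rsubst_def p_def q_def)
  have dx: "value_at (diff_x f) (x t) (y t) =
     psubst id (pdiff_x p * q - p * pdiff_x q) (x t) (y t) / psubst id (q\<^sup>2) (x t) (y t)"
    using q by (simp add: diff_x_def case_prod_unfold flip: p_def q_def) (subst value_Fract, simp_all)
  have dy: "value_at (diff_y f) (x t) (y t) =
     psubst id (pderiv p * q - p * pderiv q) (x t) (y t) / psubst id (q\<^sup>2) (x t) (y t)"
    using q by (simp add: diff_y_def case_prod_unfold flip: p_def q_def) (subst value_Fract, simp_all)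
  have quot: "((A * x' + B * y') * Q - P * (C * x' + E * y')) / (Q * Q) =
     (A * Q - P * C) / Q\<^sup>2 * x' + (B * Q - P * E) / Q\<^sup>2 * y'" if "Q \<noteq> 0" for A B C E P Q :: real
    using that by (simp add: field_simps power2_eq_square)
  show ?thesis unfolding v dx dy
    by (rule DERIV_cong[OF DERIV_divide[OF DERIV_psubst[OF assms(2,3)] DERIV_psubst[OF assms(2,3)] q]])
      (simp only: psubst_simps quot[OF q])
qed

text \<open>
  A symbolic substitution is defined if its denominator is a nonzero rational function, and such a
  function has nonzero values at generic points.
\<close>

lemma generically_comp:
  assumes "subst_ok const2 f g1 g2"
  shows "generically (\<lambda>a b. ok_at g1 a b \<and> ok_at g2 a b \<and> ok_at f (value_at g1 a b) (value_at g2 a b) \<and>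
     value_at (rsubst const2 f g1 g2) a b = value_at f (value_at g1 a b) (value_at g2 a b))"
proof -
  have "generically (\<lambda>a b. (value_at (psubst const2 (snd (quot_of_fract f)) g1 g2) a b \<noteq> 0 \<and> ok_at g1 a b) \<and> ok_at g2 a b)"
    using assms unfolding subst_ok_def[of const2]
    by (intro generically_conj generically_value_neq_0 generically_ok)
  then show ?thesis
  proof (rule generically_mono, elim conjE)
    fix a b
    assume *: "value_at (psubst const2 (snd (quot_of_fract f)) g1 g2) a b \<noteq> 0" "ok_at g1 a b" "ok_at g2 a b"
    then have "ok_at f (value_at g1 a b) (value_at g2 a b)"
      by (simp add: ok_value_psubst subst_ok_def[of _ f])
    then show "ok_at g1 a b \<and> ok_at g2 a b \<and> ok_at f (value_at g1 a b) (value_at g2 a b) \<and>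
     value_at (rsubst const2 f g1 g2) a b = value_at f (value_at g1 a b) (value_at g2 a b)"
      using * by (intro conjI ok_value_rsubst(3))
  qed
qed

section \<open>Homogeneous rational functions\<close>

lemma exists_line_ok: "\<exists>a b z. z \<noteq> 0 \<and> ok_at f (a * z) (b * z)"
proof -
  obtain a b where "eventually (\<lambda>z. ok_at f (a * z) (b * z)) (at 0)"
    using generically_ex[OF generically_line[OF generically_ok]] by blast
  moreover note eventually_neq_0
  ultimately have "eventually (\<lambda>z. z \<noteq> 0 \<and> ok_at f (a * z) (b * z)) (at 0)" by eventually_elim auto
  then have "\<exists>z. z \<noteq> 0 \<and> ok_at f (a * z) (b * z)"
    by (rule eventually_happens'[OF at_neq_bot])
  then show ?thesis by blast
qed

text \<open>
  Substituting \<open>(x z, y z)\<close> or \<open>(x, y)\<close> with independent \<open>x, y, z\<close> is possible in every rational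
  function, as one real point with a nonzero denominator shows. Hence both sides of the definition of
  homogeneity are total homomorphisms on \<open>\<real>(x,y)\<close>.
\<close>

lemma scaled_dominant:
  "fok (\<lambda>p. psubst const3 p (X3 * Z3) (Y3 * Z3)) f"
  "fok (\<lambda>p. psubst const3 p X3 Y3) f"
proof -
  obtain a b z where *: "z \<noteq> 0" "ok_at f (a * z) (b * z)" using exists_line_ok by blast
  show "fok (\<lambda>p. psubst const3 p (X3 * Z3) (Y3 * Z3)) f"
    unfolding subst_ok_iff_fok[symmetric]
    by (rule ok3_rsubst(1)[where a = a and b = b and c = z])
      (use * in \<open>simp_all add: ok3_intros ok3_basic val3_simps val3_basic\<close>)
  show "fok (\<lambda>p. psubst const3 p X3 Y3) f"
    unfolding subst_ok_iff_fok[symmetric]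
    by (rule ok3_rsubst(1)[where a = "a * z" and b = "b * z" and c = z])
      (use * in \<open>simp_all add: ok3_intros ok3_basic val3_simps val3_basic\<close>)
qed

lemma Z3_neq_0 [simp]: "Z3 \<noteq> 0"
  by (simp add: Z3_def)

context
begin

interpretation scaled: field_valued_hom "\<lambda>p. psubst const3 p (X3 * Z3) (Y3 * Z3)"
  by (rule field_valued_hom_psubst[OF unital_hom_const3])
interpretation unscaled: field_valued_hom "\<lambda>p. psubst const3 p X3 Y3"
  by (rule field_valued_hom_psubst[OF unital_hom_const3])

lemma psubst_const3_basic:
  "psubst const3 [:[:0, 1:]:] s t = s" "psubst const3 [:0, 1:] s t = t" "psubst const3 [:[:c:]:] s t = const3 c"
proof -
  have [simp]: "const3 1 = 1" by (rule unital_hom.hom_one[OF unital_hom_const3])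
  show "psubst const3 [:[:0, 1:]:] s t = s" "psubst const3 [:0, 1:] s t = t" "psubst const3 [:[:c:]:] s t = const3 c"
    by (simp_all add: psubst_def map_poly_pCons)
qed

lemma homogeneous_basic: "homogeneous 1 X" "homogeneous 1 Y" "homogeneous 0 (const2 c)"
  by (simp_all add: homogeneous_def rsubst_eq_fval X_def Y_def const2_def scaled.eval_to_fract
      unscaled.eval_to_fract psubst_const3_basic)

lemma homogeneous_mult: "homogeneous k f \<Longrightarrow> homogeneous j g \<Longrightarrow> homogeneous (k + j) (f * g)"
  by (simp add: homogeneous_def rsubst_eq_fval scaled.eval_mult unscaled.eval_mult scaled_dominant power_int_add)

lemma homogeneous_add: "homogeneous k f \<Longrightarrow> homogeneous k g \<Longrightarrow> homogeneous k (f + g)"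
  by (simp add: homogeneous_def rsubst_eq_fval scaled.eval_add unscaled.eval_add scaled_dominant distrib_left)

lemma homogeneous_diff: "homogeneous k f \<Longrightarrow> homogeneous k g \<Longrightarrow> homogeneous k (f - g)"
  by (simp add: homogeneous_def rsubst_eq_fval scaled.eval_diff unscaled.eval_diff scaled_dominant right_diff_distrib)

lemma homogeneous_uminus: "homogeneous k f \<Longrightarrow> homogeneous k (- f)"
  by (simp add: homogeneous_def rsubst_eq_fval scaled.eval_uminus unscaled.eval_uminus scaled_dominant)

lemma homogeneous_inverse:
  assumes "homogeneous k f" "f \<noteq> 0"
  shows "homogeneous (- k) (inverse f)"
proof -
  let ?s = "fval (\<lambda>p. psubst const3 p (X3 * Z3) (Y3 * Z3))" and ?u = "fval (\<lambda>p. psubst const3 p X3 Y3)"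
  have "?s f * ?s (inverse f) = 1"
    using scaled.eval_mult(2)[OF scaled_dominant(1) scaled_dominant(1), of f "inverse f"] assms(2) scaled.eval_one by simp
  then have s: "?s (inverse f) = inverse (?s f)" by (rule inverse_unique[symmetric])
  have "?u f * ?u (inverse f) = 1"
    using unscaled.eval_mult(2)[OF scaled_dominant(2) scaled_dominant(2), of f "inverse f"] assms(2) unscaled.eval_one by simp
  then have u: "?u (inverse f) = inverse (?u f)" by (rule inverse_unique[symmetric])
  have "?s f = Z3 powi k * ?u f" using assms(1) by (simp add: homogeneous_def rsubst_eq_fval)
  then show ?thesis
    unfolding homogeneous_def rsubst_eq_fval s u by (simp only: inverse_mult_distrib power_int_minus)
qed

end

lemma homogeneous_divide:
  "homogeneous k f \<Longrightarrow> homogeneous j g \<Longrightarrow> g \<noteq> 0 \<Longrightarrow> homogeneous (k - j) (f / g)"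
  using homogeneous_mult[OF _ homogeneous_inverse, of k f j g] by (simp add: divide_inverse)

text \<open>
  Together with \<open>homogeneousI\<close> this translates homogeneity into a statement about values. For the
  converse direction, generic points and small scalars are enough, which is what limits provide.
\<close>

lemma homogeneous_value:
  assumes "homogeneous k f" "ok_at f a b" "ok_at f (a * s) (b * s)" "s \<noteq> 0"
  shows "value_at f (a * s) (b * s) = s powi k * value_at f a b"
proof -
  have eq: "rsubst const3 f (X3 * Z3) (Y3 * Z3) = Z3 powi k * rsubst const3 f X3 Y3"
    using assms(1) by (simp add: homogeneous_def)
  note ok = ok3_intros ok3_basic val3_simps val3_basic
  have 1: "val3 (rsubst const3 f (X3 * Z3) (Y3 * Z3)) a b s = value_at f (a * s) (b * s)"
    by (subst ok3_rsubst(3)) (use assms in \<open>simp_all add: ok\<close>)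
  have 2: "val3 (rsubst const3 f X3 Y3) a b s = value_at f a b" "ok3 (rsubst const3 f X3 Y3) a b s"
    using ok3_rsubst(2,3)[of X3 a b s Y3 f] assms by (simp_all add: ok)
  show ?thesis using assms(4) 2 unfolding 1[symmetric] eq by (simp add: ok)
qed

lemma homogeneousI:
  assumes "generically (\<lambda>a b. eventually (\<lambda>s. value_at f (a * s) (b * s) = s powi k * value_at f a b) (at 0))"
  shows "homogeneous k f"
  unfolding homogeneous_def
proof (rule rat3_eqI)
  note ok = ok3_intros ok3_basic val3_simps val3_basic
  show "generically (\<lambda>a b. \<forall>\<^sub>F z in at 0.
    ok3 (rsubst const3 f (X3 * Z3) (Y3 * Z3)) a b z \<and> ok3 (Z3 powi k * rsubst const3 f X3 Y3) a b z \<and>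
    val3 (rsubst const3 f (X3 * Z3) (Y3 * Z3)) a b z = val3 (Z3 powi k * rsubst const3 f X3 Y3) a b z)"
  proof (rule generically_mono[OF generically_conj[OF generically_conj[OF assms generically_ok[of f]]
          generically_line[OF generically_ok[of f]]]], elim conjE)
    fix a b assume 1: "eventually (\<lambda>s. value_at f (a * s) (b * s) = s powi k * value_at f a b) (at 0)"
      "ok_at f a b" "\<forall>\<^sub>F z in at 0. ok_at f (a * z) (b * z)"
    note eventually_neq_0
    with 1(1,3) show "\<forall>\<^sub>F z in at 0.
    ok3 (rsubst const3 f (X3 * Z3) (Y3 * Z3)) a b z \<and> ok3 (Z3 powi k * rsubst const3 f X3 Y3) a b z \<and>
    val3 (rsubst const3 f (X3 * Z3) (Y3 * Z3)) a b z = val3 (Z3 powi k * rsubst const3 f X3 Y3) a b z"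
    proof eventually_elim
      case (elim s)
      have "ok3 (rsubst const3 f (X3 * Z3) (Y3 * Z3)) a b s \<and> val3 (rsubst const3 f (X3 * Z3) (Y3 * Z3)) a b s = value_at f (a * s) (b * s)"
        using ok3_rsubst(2,3)[of "X3 * Z3" a b s "Y3 * Z3" f] elim by (simp add: ok)
      moreover have "val3 (rsubst const3 f X3 Y3) a b s = value_at f a b" "ok3 (rsubst const3 f X3 Y3) a b s"
        using ok3_rsubst(2,3)[of X3 a b s Y3 f] 1 by (simp_all add: ok)
      ultimately show ?case using elim by (simp add: ok)
    qed
  qed
qed

text \<open>
  Differentiate \<open>f(t s, b s) = s\<^sup>k f(t, b)\<close> with respect to \<open>t\<close>.
\<close>

lemma homogeneous_diff_x:
  assumes "homogeneous k f"
  shows "homogeneous (k - 1) (diff_x f)"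
proof (rule homogeneousI, rule generically_mono[OF generically_conj[OF generically_ok[of f]
          generically_line[OF generically_ok[of f]]]], elim conjE)
  fix a b assume ok: "ok_at f a b" "\<forall>\<^sub>F z in at 0. ok_at f (a * z) (b * z)"
  note eventually_neq_0
  with ok(2) show "\<forall>\<^sub>F s in at 0. value_at (diff_x f) (a * s) (b * s) = s powi (k - 1) * value_at (diff_x f) a b"
  proof eventually_elim
    case (elim s)
    have d: "((\<lambda>t. t * s) has_real_derivative s) (at a)" by (auto intro!: derivative_eq_intros)
    have 1: "((\<lambda>t. value_at f (t * s) (b * s)) has_real_derivative value_at (diff_x f) (a * s) (b * s) * s) (at a)"
      using DERIV_value_at[OF elim(1) d DERIV_const] by simp
    have 2: "((\<lambda>t. value_at f t b) has_real_derivative value_at (diff_x f) a b) (at a)"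
      using DERIV_value_at[OF ok(1) DERIV_ident DERIV_const] by simp
    have id: "((\<lambda>t. t) \<longlongrightarrow> a) (nhds a)" by (rule filterlim_ident)
    have "eventually (\<lambda>t. ok_at f t b) (nhds a)" "eventually (\<lambda>t. ok_at f (t * s) (b * s)) (nhds a)"
      by (rule eventually_ok_at[OF ok(1) id], rule tendsto_const)
       (rule eventually_ok_at[OF elim(1)]; intro tendsto_intros id)
    then have "eventually (\<lambda>t. value_at f (t * s) (b * s) = s powi k * value_at f t b) (nhds a)"
      by eventually_elim (rule homogeneous_value[OF assms], use elim in auto)
    from DERIV_cong_ev[OF refl this refl] 1 have "((\<lambda>t. s powi k * value_at f t b) has_real_derivative value_at (diff_x f) (a * s) (b * s) * s) (at a)"
      by (rule iffD1)
    moreover have "((\<lambda>t. s powi k * value_at f t b) has_real_derivative s powi k * value_at (diff_x f) a b) (at a)"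
      by (rule DERIV_cmult[OF 2])
    ultimately have "value_at (diff_x f) (a * s) (b * s) * s = s powi k * value_at (diff_x f) a b"
      using DERIV_unique by blast
    then show ?case using elim by (simp add: power_int_diff field_simps)
  qed
qed

lemma const2_of_nat: "const2 (of_nat n) = of_nat n"
  using unital_hom.hom_zero[OF unital_hom_const2] unital_hom.hom_one[OF unital_hom_const2]
    unital_hom.hom_add[OF unital_hom_const2]
  by (induction n) simp_all

lemma const2_numeral: "const2 (numeral n) = numeral n"
  using const2_of_nat[of "numeral n"] by simp

text \<open>
  Differentiate \<open>f(a t, b t) = t\<^sup>k f(a, b)\<close> at \<open>t = 1\<close>.
\<close>

lemma Euler_identity:
  assumes "homogeneous k f"
  shows "X * diff_x f + Y * diff_y f = const2 (of_int k) * f"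
proof (rule rat2_eqI, rule generically_mono[OF generically_ok[of f]])
  fix a b assume ok: "ok_at f a b"
  have id: "((\<lambda>t. t) \<longlongrightarrow> 1) (nhds (1::real))" by (rule filterlim_ident)
  have "((\<lambda>t. a * t) \<longlongrightarrow> a * 1) (nhds 1)" "((\<lambda>t. b * t) \<longlongrightarrow> b * 1) (nhds 1)"
    by (intro tendsto_intros id)+
  then have "eventually (\<lambda>t. ok_at f (a * t) (b * t)) (nhds 1)" using eventually_ok_at[OF ok] by simp
  moreover have "eventually (\<lambda>t. t \<noteq> (0::real)) (nhds 1)" by (rule tendsto_imp_eventually_ne[OF id]) simp
  ultimately have ev: "eventually (\<lambda>t. value_at f (a * t) (b * t) = t powi k * value_at f a b) (nhds 1)"
    by eventually_elim (rule homogeneous_value[OF assms ok])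
  have "((\<lambda>t. value_at f (a * t) (b * t)) has_real_derivative
      value_at (diff_x f) a b * a + value_at (diff_y f) a b * b) (at 1)"
    using DERIV_value_at[of f "\<lambda>t. a * t" 1 "\<lambda>t. b * t", OF _ DERIV_cmult_Id DERIV_cmult_Id] ok
    by simp
  with DERIV_cong_ev[OF refl ev refl] have "((\<lambda>t. t powi k * value_at f a b) has_real_derivative
      value_at (diff_x f) a b * a + value_at (diff_y f) a b * b) (at 1)"
    by (rule iffD1)
  moreover have "((\<lambda>t. t powi k * value_at f a b) has_real_derivative of_int k * value_at f a b) (at 1)"
    by (rule derivative_eq_intros DERIV_ident refl | simp)+
  ultimately have "value_at (diff_x f) a b * a + value_at (diff_y f) a b * b = of_int k * value_at f a b"
    using DERIV_unique by blast
  then show "value_at (X * diff_x f + Y * diff_y f) a b = value_at (const2 (of_int k) * f) a b"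
    using ok by (simp add: value_simps ok_intros ok_basic value_basic ok_at_diff mult.commute)
qed

section \<open>Vector fields\<close>

abbreviation ray :: "rat2 \<Rightarrow> real \<Rightarrow> real \<Rightarrow> real \<Rightarrow> real" where
  "ray f a b t \<equiv> value_at f (a * t) (b * t) / t"

lemma poly_factor_power:
  fixes p :: "real poly"
  assumes "((\<lambda>z. poly p z / z ^ k) \<longlongrightarrow> L) (at 0)"
  shows "\<exists>p'. p = [:0, 1:] ^ k * p' \<and> poly p' 0 = L"
  using assms
proof (induction k arbitrary: L)
  case 0
  have "((\<lambda>z. poly p z) \<longlongrightarrow> poly p 0) (at 0)" by (intro tendsto_intros)
  then have "poly p 0 = L" using tendsto_unique[OF at_neq_bot, of "\<lambda>z. poly p z"] 0 by simp
  then show ?case by simp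
next
  case (Suc k)
  note nz = eventually_neq_0
  have "((\<lambda>z. z * (poly p z / z ^ Suc k)) \<longlongrightarrow> 0 * L) (at 0)"
    by (intro tendsto_intros Suc.prems)
  then have "((\<lambda>z. z * (poly p z / z ^ Suc k)) \<longlongrightarrow> 0) (at 0)" by simp
  moreover have "eventually (\<lambda>z. z * (poly p z / z ^ Suc k) = poly p z / z ^ k) (at 0)"
    using nz by eventually_elim (simp add: field_simps)
  ultimately have "((\<lambda>z. poly p z / z ^ k) \<longlongrightarrow> 0) (at 0)" by (rule Lim_transform_eventually)
  from Suc.IH[OF this] obtain p' where p': "p = [:0, 1:] ^ k * p'" "poly p' 0 = 0" by blast
  then obtain p'' where p'': "p' = [:0, 1:] * p''" using poly_eq_0_iff_dvd[of p' 0] by (auto elim: dvdE)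
  have "eventually (\<lambda>z. poly p z / z ^ Suc k = poly p'' z) (at 0)"
    using nz by eventually_elim (simp add: p' p'' field_simps)
  with Suc.prems have "((\<lambda>z. poly p'' z) \<longlongrightarrow> L) (at 0)" by (rule Lim_transform_eventually)
  moreover have "((\<lambda>z. poly p'' z) \<longlongrightarrow> poly p'' 0) (at 0)" by (intro tendsto_intros)
  ultimately have "poly p'' 0 = L" using tendsto_unique[OF at_neq_bot] by blast
  then show ?case using p' p'' by (intro exI[of _ p'']) (simp add: mult_ac)
qed

text \<open>
  Let \<open>u = P / Q\<close> and expand \<open>P(a z, b z) = \<Sum> p\<^sub>k z\<^sup>k\<close> and \<open>Q(a z, b z) = z\<^sup>m (q\<^sub>0 + q\<^sub>1 z + \<dots>)\<close>. If
  \<open>u(a z, b z) / z\<close> tends to \<open>c\<close>, then \<open>P(a z, b z)\<close> starts with \<open>p\<^sub>m\<^sub>+\<^sub>1 = c q\<^sub>0\<close>, and the next coefficient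
  of the quotient is \<open>(p\<^sub>m\<^sub>+\<^sub>2 - c q\<^sub>1) / q\<^sub>0\<close>. This is a rational function of \<open>(a, b)\<close>. It is applied
  with \<open>C\<close> one of the coordinates.
\<close>

lemma vector_field_component:
  assumes C: "\<And>a b. ok_at C a b"
    and lim: "generically (\<lambda>a b. (ray u a b \<longlongrightarrow> value_at C a b) (at 0))"
  shows "\<exists>w. generically (\<lambda>a b. ((\<lambda>z. (ray u a b z - value_at C a b) / z) \<longlongrightarrow> value_at w a b) (at 0))"
proof -
  define P Q where "P = fst (quot_of_fract u)" and "Q = snd (quot_of_fract u)"
  have v: "value_at u s t = psubst id P s t / psubst id Q s t" for s t by (simp add: rsubst_def P_def Q_def)
  have "hexp Q \<noteq> 0" by (simp add: hexp_eq_0_iff Q_def snd_quot_of_fract_neq_0)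
  from order_decomp[OF this, of 0] obtain m q where q: "hexp Q = [:0, 1:] ^ m * q" "\<not> [:0, 1:] dvd q"
    by auto
  have "poly q 0 \<noteq> 0" using q(2) by (simp add: poly_eq_0_iff_dvd)
  then have q0: "coeff q 0 \<noteq> 0" by (simp add: poly_0_coeff_0)
  define w where "w = (to_fract (coeff (hexp P) (m + 2)) - C * to_fract (coeff q 1)) / to_fract (coeff q 0)"
  have "generically (\<lambda>a b. ((\<lambda>z. (ray u a b z - value_at C a b) / z) \<longlongrightarrow> value_at w a b) (at 0))"
  proof (rule generically_mono[OF generically_conj[OF lim generically_psubst[OF q0]]], elim conjE)
    fix a b
    assume l: "(ray u a b \<longlongrightarrow> value_at C a b) (at 0)"
      and ab: "psubst id (coeff q 0) a b \<noteq> (0::real)"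
    define c where "c = value_at C a b"
    interpret e: unital_hom "\<lambda>p. psubst id p a b :: real" by (rule unital_hom_psubst[OF unital_hom_id])
    define p1 where "p1 = map_poly (\<lambda>p. psubst id p a b) (hexp P)"
    define q1 where "q1 = map_poly (\<lambda>p. psubst id p a b) q"
    have cp1: "coeff p1 i = psubst id (coeff (hexp P) i) a b" for i unfolding p1_def by (rule coeff_map_poly) (rule e.hom_zero)
    have cq1: "coeff q1 i = psubst id (coeff q i) a b" for i unfolding q1_def by (rule coeff_map_poly) (rule e.hom_zero)
    have P: "psubst id P (a * z) (b * z) = poly p1 z" for z
      by (simp add: p1_def flip: eval3_hexp eval3_def)
    have Q: "psubst id Q (a * z) (b * z) = z ^ m * poly q1 z" for z
    proof -
      interpret field_valued_hom "\<lambda>p. eval3 p a b z" by (rule field_valued_hom_eval3)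
      have "eval3 [:0, 1:] a b z = z" by (simp add: eval3_pCons)
      then show ?thesis unfolding eval3_hexp[symmetric] q(1) hom_mult hom_power q1_def by (simp add: eval3_def)
    qed
    have q10: "poly q1 0 \<noteq> 0" using ab by (simp add: poly_0_coeff_0 cq1)
    note nz = eventually_neq_0
    have q1t: "((\<lambda>z. poly q1 z) \<longlongrightarrow> poly q1 0) (at 0)" by (intro tendsto_intros)
    have q1nz: "eventually (\<lambda>z. poly q1 z \<noteq> 0) (at 0)" by (rule tendsto_imp_eventually_ne[OF q1t q10])
    have "((\<lambda>z. ray u a b z * poly q1 z) \<longlongrightarrow> c * poly q1 0) (at 0)"
      unfolding c_def by (intro tendsto_mult l q1t)
    moreover have "eventually (\<lambda>z. ray u a b z * poly q1 z = poly p1 z / z ^ (m + 1)) (at 0)"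
      using nz q1nz by eventually_elim (simp add: v P Q)
    ultimately have "((\<lambda>z. poly p1 z / z ^ (m + 1)) \<longlongrightarrow> c * poly q1 0) (at 0)"
      by (rule Lim_transform_eventually)
    from poly_factor_power[OF this] obtain p2 where p2: "p1 = [:0, 1:] ^ (m + 1) * p2" "poly p2 0 = c * poly q1 0"
      by blast
    have p1m: "p1 = monom 1 (m + 1) * p2" unfolding p2(1) by (simp add: monom_altdef)
    have p2_1: "coeff p2 1 = coeff p1 (m + 2)" unfolding p1m by (simp add: coeff_monom_mult)
    have "((\<lambda>z. poly p2 z / poly q1 z) has_real_derivative
        (poly (pderiv p2) 0 * poly q1 0 - poly p2 0 * poly (pderiv q1) 0) / (poly q1 0 * poly q1 0)) (at 0)"
      by (intro DERIV_divide poly_DERIV q10)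
    then have "((\<lambda>h. (poly p2 (0 + h) / poly q1 (0 + h) - poly p2 0 / poly q1 0) / h) \<longlongrightarrow>
        (poly (pderiv p2) 0 * poly q1 0 - poly p2 0 * poly (pderiv q1) 0) / (poly q1 0 * poly q1 0)) (at 0)"
      by (simp only: DERIV_def)
    moreover have "eventually (\<lambda>h. (poly p2 (0 + h) / poly q1 (0 + h) - poly p2 0 / poly q1 0) / h =
       (ray u a b h - value_at C a b) / h) (at 0)"
      unfolding c_def[symmetric] using nz q1nz by eventually_elim (use q10 in \<open>simp add: v P Q p2(1), simp add: p2(2) field_simps\<close>)
    ultimately have "((\<lambda>h. (ray u a b h - value_at C a b) / h) \<longlongrightarrow>
        (poly (pderiv p2) 0 * poly q1 0 - poly p2 0 * poly (pderiv q1) 0) / (poly q1 0 * poly q1 0)) (at 0)"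
      by (rule Lim_transform_eventually)
    moreover have "(poly (pderiv p2) 0 * poly q1 0 - poly p2 0 * poly (pderiv q1) 0) / (poly q1 0 * poly q1 0) = value_at w a b"
    proof -
      have "value_at w a b = (coeff p2 1 - c * coeff q1 1) / coeff q1 0"
        unfolding w_def p2_1 cp1 cq1 c_def using ab C
        by (simp add: value_simps ok_intros)
      moreover have "poly (pderiv p2) 0 = coeff p2 1" "poly (pderiv q1) 0 = coeff q1 1" "poly q1 0 = coeff q1 0"
        by (simp_all add: poly_0_coeff_0 coeff_pderiv)
      moreover have "(A * q - c * q * B) / (q * q) = (A - c * B) / q" if "q \<noteq> 0" for A B q :: real
        using that by (simp add: field_simps)
      ultimately show ?thesis using p2(2) q10 by simp
    qed
    ultimately show "((\<lambda>z. (ray u a b z - value_at C a b) / z) \<longlongrightarrow> value_at w a b) (at 0)"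
      by simp
  qed
  then show ?thesis by blast
qed

text \<open>
  Replacing \<open>z\<close> by \<open>s z\<close> in the limit that defines the field at \<open>(a, b)\<close> gives the limit at
  \<open>(a s, b s)\<close> up to a factor \<open>s\<^sup>2\<close>.
\<close>

lemma vector_field_homogeneous:
  assumes C: "\<And>a b s. c (a * s) (b * s) = c a b * s"
    and lim: "generically (\<lambda>a b. ((\<lambda>z. (ray u a b z - c a b) / z) \<longlongrightarrow> value_at w a b) (at 0))"
  shows "homogeneous 2 w"
proof (rule homogeneousI, rule generically_mono[OF generically_conj[OF lim generically_line[OF lim]]], elim conjE)
  fix a b
  assume 1: "((\<lambda>z. (ray u a b z - c a b) / z) \<longlongrightarrow> value_at w a b) (at 0)"
    and 2: "\<forall>\<^sub>F s in at 0. ((\<lambda>z. (value_at u (a * s * z) (b * s * z) / z - c (a * s) (b * s)) / z) \<longlongrightarrow> value_at w (a * s) (b * s)) (at 0)"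
  note nz = eventually_neq_0
  from 2 nz show "\<forall>\<^sub>F s in at 0. value_at w (a * s) (b * s) = s powi 2 * value_at w a b"
  proof eventually_elim
    case (elim s)
    have "((\<lambda>z. s * z) \<longlongrightarrow> s * 0) (at 0)" by (intro tendsto_intros)
    then have "filterlim (\<lambda>z. s * z) (at 0) (at 0)"
      unfolding filterlim_at using nz elim(2) by (auto elim: eventually_mono)
    from filterlim_compose[OF 1 this]
    have "((\<lambda>z. (value_at u (a * (s * z)) (b * (s * z)) / (s * z) - c a b) / (s * z) * s\<^sup>2) \<longlongrightarrow> value_at w a b * s\<^sup>2) (at 0)"
      by (intro tendsto_intros)
    moreover have "eventually (\<lambda>z. (value_at u (a * (s * z)) (b * (s * z)) / (s * z) - c a b) / (s * z) * s\<^sup>2 =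
        (value_at u (a * s * z) (b * s * z) / z - c (a * s) (b * s)) / z) (at 0)"
      using nz by eventually_elim (use elim(2) in \<open>simp add: C field_simps power2_eq_square\<close>)
    ultimately have "((\<lambda>z. (value_at u (a * s * z) (b * s * z) / z - c (a * s) (b * s)) / z) \<longlongrightarrow> value_at w a b * s\<^sup>2) (at 0)"
      by (rule Lim_transform_eventually)
    from tendsto_unique[OF at_neq_bot elim(1) this] show ?case by (simp add: mult.commute)
  qed
qed

theorem flow_vector_field:
  assumes "rational_flow \<phi>"
  shows "\<exists>w. has_vector_field \<phi> w"
proof -
  have 1: "generically (\<lambda>a b. (ray (fst \<phi>) a b \<longlongrightarrow> value_at X a b) (at 0))"
    and 2: "generically (\<lambda>a b. (ray (snd \<phi>) a b \<longlongrightarrow> value_at Y a b) (at 0))"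
    using assms unfolding rational_flow_def by (auto simp: value_basic elim: generically_mono)
  obtain w1 where w1: "generically (\<lambda>a b. ((\<lambda>z. (ray (fst \<phi>) a b z - value_at X a b) / z) \<longlongrightarrow> value_at w1 a b) (at 0))"
    using vector_field_component[OF ok_basic(1) 1] by blast
  obtain w2 where w2: "generically (\<lambda>a b. ((\<lambda>z. (ray (snd \<phi>) a b z - value_at Y a b) / z) \<longlongrightarrow> value_at w2 a b) (at 0))"
    using vector_field_component[OF ok_basic(2) 2] by blast
  have "has_vector_field \<phi> (w1, w2)"
    using generically_conj[OF w1 w2] by (simp add: has_vector_field_def value_basic)
  then show ?thesis ..
qed

theorem flow_vector_field_homogeneous:
  assumes "has_vector_field \<phi> (\<omega>, \<rho>)"
  shows "homogeneous 2 \<omega>" "homogeneous 2 \<rho>"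
proof -
  show "homogeneous 2 \<omega>"
    by (rule vector_field_homogeneous[of "\<lambda>a b. a" "fst \<phi>"])
      (use assms in \<open>auto simp: has_vector_field_def elim: generically_mono\<close>)
  show "homogeneous 2 \<rho>"
    by (rule vector_field_homogeneous[of "\<lambda>a b. b" "snd \<phi>"])
      (use assms in \<open>auto simp: has_vector_field_def elim: generically_mono\<close>)
qed

section \<open>The differential equation of a flow\<close>

text \<open>
  A map that does not send its whole domain into the zero set of \<open>d\<close> makes the pullback of \<open>d\<close> a
  nonzero rational function; hence generic properties can be pulled back along dominant maps.
\<close>

lemma generically_pullback:
  assumes R: "generically R"
    and dom: "\<And>d. d \<noteq> 0 \<Longrightarrow> \<exists>a b. ok_at g1 a b \<and> ok_at g2 a b \<and> psubst id d (value_at g1 a b) (value_at g2 a b) \<noteq> 0"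
  shows "generically (\<lambda>a b. ok_at g1 a b \<and> ok_at g2 a b \<and> R (value_at g1 a b) (value_at g2 a b))"
proof -
  obtain d where d: "d \<noteq> 0" "\<And>a b. psubst id d a b \<noteq> 0 \<Longrightarrow> R a b"
    using R unfolding generically_def by blast
  obtain a b where ab: "ok_at g1 a b" "ok_at g2 a b" "psubst id d (value_at g1 a b) (value_at g2 a b) \<noteq> 0"
    using dom[OF d(1)] by blast
  have "psubst const2 d g1 g2 \<noteq> 0"
  proof
    assume "psubst const2 d g1 g2 = 0"
    then show False using ok_value_psubst(2)[OF ab(1,2), of d] ab(3) by (simp add: value_simps)
  qed
  then have "generically (\<lambda>a b. (value_at (psubst const2 d g1 g2) a b \<noteq> 0 \<and> ok_at g1 a b) \<and> ok_at g2 a b)"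
    by (intro generically_conj generically_value_neq_0 generically_ok)
  then show ?thesis
  proof (rule generically_mono, elim conjE)
    fix a b
    assume *: "value_at (psubst const2 d g1 g2) a b \<noteq> 0" "ok_at g1 a b" "ok_at g2 a b"
    then show "ok_at g1 a b \<and> ok_at g2 a b \<and> R (value_at g1 a b) (value_at g2 a b)"
      by (auto simp: ok_value_psubst intro: d(2))
  qed
qed

lemma rational_flow_limit:
  assumes "rational_flow (u, v)"
  shows "generically (\<lambda>a b. (ray u a b \<longlongrightarrow> a) (at 0) \<and>
       (ray v a b \<longlongrightarrow> b) (at 0))"
  using assms unfolding rational_flow_def by simp

text \<open>
  A flow is dominant: it moves \<open>(a z, b z)\<close> to a point in nearly the same direction, which for small
  \<open>z\<close> avoids a given curve by \<open>generically_cone\<close>.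
\<close>

lemma generically_flow:
  assumes lim: "generically (\<lambda>a b. (ray u a b \<longlongrightarrow> a) (at 0) \<and>
       (ray v a b \<longlongrightarrow> b) (at 0))" and R: "generically R"
  shows "generically (\<lambda>a b. ok_at u a b \<and> ok_at v a b \<and> R (value_at u a b) (value_at v a b))"
proof (rule generically_pullback[OF R])
  fix d :: "real poly poly" assume d: "d \<noteq> 0"
  have "generically (\<lambda>a b. ok_at u a b \<and> ok_at v a b)" by (intro generically_conj generically_ok)
  from generically_ex[OF generically_conj[OF generically_conj[OF lim generically_line[OF this]] generically_cone[OF generically_psubst[OF d]]]]
  obtain a b where l: "(ray u a b \<longlongrightarrow> a) (at 0)" "(ray v a b \<longlongrightarrow> b) (at 0)"
    and ok: "\<forall>\<^sub>F z in at 0. ok_at u (a * z) (b * z) \<and> ok_at v (a * z) (b * z)"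
    and cone: "\<forall>x y. (x \<longlongrightarrow> a) (at 0) \<longrightarrow> (y \<longlongrightarrow> b) (at 0) \<longrightarrow> (\<forall>\<^sub>F z in at 0. psubst id d (x z * z) (y z * z) \<noteq> 0)"
    by blast
  have "\<forall>\<^sub>F z in at 0. psubst id d (ray u a b z * z) (ray v a b z * z) \<noteq> 0"
    using cone l by blast
  moreover note nz = eventually_neq_0
  ultimately have "\<forall>\<^sub>F z in at 0. ok_at u (a * z) (b * z) \<and> ok_at v (a * z) (b * z) \<and>
      psubst id d (value_at u (a * z) (b * z)) (value_at v (a * z) (b * z)) \<noteq> 0"
    using ok by eventually_elim auto
  from eventually_happens'[OF at_neq_bot this]
  show "\<exists>a b. ok_at u a b \<and> ok_at v a b \<and> psubst id d (value_at u a b) (value_at v a b) \<noteq> 0"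
    by blast
qed

text \<open>
  One coordinate of the point \<open>\<phi>(x z) (1 - z) / z\<close> from the translation equation.
\<close>

abbreviation jump :: "rat2 \<Rightarrow> real \<Rightarrow> real \<Rightarrow> real \<Rightarrow> real" where
  "jump f a b z \<equiv> value_at f (a * z) (b * z) * ((1 - z) / z)"

lemma translation_equation_at:
  assumes flow: "rational_flow (u, v)" and z: "z \<noteq> 0"
    and ok: "ok_at u a b" "ok_at v a b" "ok_at u (a * z) (b * z)" "ok_at v (a * z) (b * z)"
    and ok': "ok_at u (jump u a b z) (jump v a b z)"
     "ok_at v (jump u a b z) (jump v a b z)"
  shows "(1 - z) * value_at u a b = value_at u (jump u a b z) (jump v a b z)"
    "(1 - z) * value_at v a b = value_at v (jump u a b z) (jump v a b z)"
proof -
  define s t where "s = rsubst const3 u (X3 * Z3) (Y3 * Z3) * ((1 - Z3) / Z3)"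
    and "t = rsubst const3 v (X3 * Z3) (Y3 * Z3) * ((1 - Z3) / Z3)"
  have eq: "(1 - Z3) * rsubst const3 u X3 Y3 = rsubst const3 u s t"
    "(1 - Z3) * rsubst const3 v X3 Y3 = rsubst const3 v s t"
    using flow by (simp_all add: rational_flow_def Let_def s_def t_def)
  note R = ok3_intros ok3_basic val3_simps val3_basic
  have 1: "ok3 (rsubst const3 u (X3 * Z3) (Y3 * Z3)) a b z" "val3 (rsubst const3 u (X3 * Z3) (Y3 * Z3)) a b z = value_at u (a * z) (b * z)"
    "ok3 (rsubst const3 v (X3 * Z3) (Y3 * Z3)) a b z" "val3 (rsubst const3 v (X3 * Z3) (Y3 * Z3)) a b z = value_at v (a * z) (b * z)"
    using ok3_rsubst(2,3)[of "X3 * Z3" a b z "Y3 * Z3"] ok by (simp_all add: R)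
  have st: "ok3 s a b z" "ok3 t a b z" "val3 s a b z = jump u a b z"
    "val3 t a b z = jump v a b z"
    using 1 z unfolding s_def t_def by (simp_all add: R)
  have 2: "ok3 (rsubst const3 u X3 Y3) a b z" "val3 (rsubst const3 u X3 Y3) a b z = value_at u a b"
     "ok3 (rsubst const3 v X3 Y3) a b z" "val3 (rsubst const3 v X3 Y3) a b z = value_at v a b"
    using ok3_rsubst(2,3)[of X3 a b z Y3] ok by (simp_all add: R)
  have "val3 ((1 - Z3) * rsubst const3 u X3 Y3) a b z = value_at u (val3 s a b z) (val3 t a b z)"
    unfolding eq by (rule ok3_rsubst(3)) (use st ok' in auto)
  then show "(1 - z) * value_at u a b = value_at u (jump u a b z) (jump v a b z)"
    using 2 by (simp add: R st)
  have "val3 ((1 - Z3) * rsubst const3 v X3 Y3) a b z = value_at v (val3 s a b z) (val3 t a b z)"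
    unfolding eq by (rule ok3_rsubst(3)) (use st ok' in auto)
  then show "(1 - z) * value_at v a b = value_at v (jump u a b z) (jump v a b z)"
    using 2 by (simp add: R st)
qed

text \<open>
  With \<open>z = 1 / (1 + r)\<close> and \<open>x\<close> replaced by \<open>(1 + r) x\<close>, the translation equation becomes
  \<open>F\<^sup>1\<^sup>+\<^sup>r(x) = F\<^sup>r(F\<^sup>1(x))\<close> for \<open>F\<^sup>t(x) = \<phi>(t x) / t\<close>. In this form the limit \<open>r \<rightarrow> 0\<close> can be taken.
\<close>

lemma translation_equation_at':
  assumes flow: "rational_flow (u, v)" and r: "r \<noteq> 0" "1 + r \<noteq> 0"
    and ok: "ok_at u a b" "ok_at v a b" "ok_at u (a * (1 + r)) (b * (1 + r))" "ok_at v (a * (1 + r)) (b * (1 + r))"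
    and ok': "ok_at u (value_at u a b * r) (value_at v a b * r)" "ok_at v (value_at u a b * r) (value_at v a b * r)"
  shows "value_at u (a * (1 + r)) (b * (1 + r)) / (1 + r) = value_at u (value_at u a b * r) (value_at v a b * r) / r"
    "value_at v (a * (1 + r)) (b * (1 + r)) / (1 + r) = value_at v (value_at u a b * r) (value_at v a b * r) / r"
proof -
  define z where "z = 1 / (1 + r)"
  have z: "z \<noteq> 0" "a * (1 + r) * z = a" "b * (1 + r) * z = b" "(1 - z) / z = r" "1 - z = r / (1 + r)"
    using r by (simp_all add: z_def field_simps)
  have "r / (1 + r) * value_at u (a * (1 + r)) (b * (1 + r)) = value_at u (value_at u a b * r) (value_at v a b * r)"
    "r / (1 + r) * value_at v (a * (1 + r)) (b * (1 + r)) = value_at v (value_at u a b * r) (value_at v a b * r)"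
    using translation_equation_at[OF flow z(1), of "a * (1 + r)" "b * (1 + r)", unfolded z(2-4), unfolded z(5)]
      ok ok' by blast+
  then show "value_at u (a * (1 + r)) (b * (1 + r)) / (1 + r) = value_at u (value_at u a b * r) (value_at v a b * r) / r"
    "value_at v (a * (1 + r)) (b * (1 + r)) / (1 + r) = value_at v (value_at u a b * r) (value_at v a b * r) / r"
    using r by (simp_all add: field_simps)
qed

lemma DERIV_ray:
  assumes "ok_at u (a * t) (b * t)" "t \<noteq> 0"
  shows "(ray u a b has_real_derivative
     value_at (X * diff_x u + Y * diff_y u - u) (a * t) (b * t) / t\<^sup>2) (at t)"
proof -
  have d: "((\<lambda>t. c * t) has_real_derivative c) (at t)" for c :: real by (rule DERIV_cmult_Id)
  show ?thesis
    by (rule DERIV_cong[OF DERIV_divide[OF DERIV_value_at[OF assms(1) d d] DERIV_ident assms(2)]])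
      (use assms in \<open>simp add: value_simps ok_intros ok_basic value_basic ok_at_diff algebra_simps power2_eq_square\<close>)
qed

text \<open>
  Differentiating \<open>F\<^sup>1\<^sup>+\<^sup>r(x) = F\<^sup>r(F\<^sup>1(x))\<close> at \<open>r = 0\<close> gives the derivative along the ray on the left and
  the vector field at \<open>\<phi>(x)\<close> on the right.
\<close>

lemma flow_equation:
  assumes flow: "rational_flow (u, v)" and vf: "has_vector_field (u, v) (\<omega>, \<rho>)"
  shows "generically (\<lambda>a b.
     value_at (X * diff_x u + Y * diff_y u - u) a b = value_at \<omega> (value_at u a b) (value_at v a b) \<and>
     value_at (X * diff_x v + Y * diff_y v - v) a b = value_at \<rho> (value_at u a b) (value_at v a b))"
proof -
  have ok: "generically (\<lambda>a b. ok_at u a b \<and> ok_at v a b)" by (intro generically_conj generically_ok)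
  from generically_conj[OF vf[unfolded has_vector_field_def fst_conv snd_conv] generically_line[OF ok]]
  have "generically (\<lambda>a b. ok_at u a b \<and> ok_at v a b \<and> ((((\<lambda>z. (value_at u (value_at u a b * z) (value_at v a b * z) / z - value_at u a b) / z) \<longlongrightarrow>
       value_at \<omega> (value_at u a b) (value_at v a b)) (at 0) \<and>
      ((\<lambda>z. (value_at v (value_at u a b * z) (value_at v a b * z) / z - value_at v a b) / z) \<longlongrightarrow>
       value_at \<rho> (value_at u a b) (value_at v a b)) (at 0)) \<and>
     (\<forall>\<^sub>F z in at 0. ok_at u (value_at u a b * z) (value_at v a b * z) \<and> ok_at v (value_at u a b * z) (value_at v a b * z))))"
    by (rule generically_flow[OF rational_flow_limit[OF flow]])
  then show ?thesis
  proof (rule generically_mono, elim conjE)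
    fix a b
    define p q where "p = value_at u a b" and "q = value_at v a b"
    assume ok: "ok_at u a b" "ok_at v a b"
      and lu: "((\<lambda>z. (value_at u (value_at u a b * z) (value_at v a b * z) / z - value_at u a b) / z) \<longlongrightarrow>
       value_at \<omega> (value_at u a b) (value_at v a b)) (at 0)"
      and lv: "((\<lambda>z. (value_at v (value_at u a b * z) (value_at v a b * z) / z - value_at v a b) / z) \<longlongrightarrow>
       value_at \<rho> (value_at u a b) (value_at v a b)) (at 0)"
      and ev: "\<forall>\<^sub>F z in at 0. ok_at u (value_at u a b * z) (value_at v a b * z) \<and> ok_at v (value_at u a b * z) (value_at v a b * z)"
    have 1: "((\<lambda>r. 1 + r) \<longlongrightarrow> 1 + 0) (at (0::real))" by (intro tendsto_intros)
    have "((\<lambda>r. a * (1 + r)) \<longlongrightarrow> a * (1 + 0)) (at 0)" "((\<lambda>r. b * (1 + r)) \<longlongrightarrow> b * (1 + 0)) (at 0)"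
      by (intro tendsto_intros)+
    then have ev2: "\<forall>\<^sub>F r in at 0. ok_at u (a * (1 + r)) (b * (1 + r))" "\<forall>\<^sub>F r in at 0. ok_at v (a * (1 + r)) (b * (1 + r))"
      using ok by (auto intro: eventually_ok_at)
    have ev3: "\<forall>\<^sub>F r in at 0. 1 + r \<noteq> (0::real)" by (rule tendsto_imp_eventually_ne[OF 1]) simp
    note nz = eventually_neq_0
    have ev4: "\<forall>\<^sub>F r in at 0.
        value_at u (a * (1 + r)) (b * (1 + r)) / (1 + r) = value_at u (p * r) (q * r) / r \<and>
        value_at v (a * (1 + r)) (b * (1 + r)) / (1 + r) = value_at v (p * r) (q * r) / r"
      using ev ev2 ev3 nz unfolding p_def q_def
      by eventually_elim (intro conjI translation_equation_at'[OF flow]; use ok in auto)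
    have "value_at (X * diff_x w + Y * diff_y w - w) a b = L"
      if w: "ok_at w a b" and lim: "((\<lambda>z. (value_at w (p * z) (q * z) / z - value_at w a b) / z) \<longlongrightarrow> L) (at 0)"
        and e: "\<forall>\<^sub>F r in at 0. value_at w (a * (1 + r)) (b * (1 + r)) / (1 + r) = value_at w (p * r) (q * r) / r" for w L
    proof -
      have "(ray w a b has_real_derivative
        value_at (X * diff_x w + Y * diff_y w - w) (a * 1) (b * 1) / 1\<^sup>2) (at 1)"
        using DERIV_ray[of w a 1 b] w by simp
      then have "((\<lambda>r. (value_at w (a * (1 + r)) (b * (1 + r)) / (1 + r) - value_at w a b) / r) \<longlongrightarrow>
         value_at (X * diff_x w + Y * diff_y w - w) a b) (at 0)"
        by (simp add: DERIV_def)
      moreover have "eventually (\<lambda>r. (value_at w (a * (1 + r)) (b * (1 + r)) / (1 + r) - value_at w a b) / r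
          = (value_at w (p * r) (q * r) / r - value_at w a b) / r) (at 0)"
        using e by eventually_elim simp
      ultimately have "((\<lambda>z. (value_at w (p * z) (q * z) / z - value_at w a b) / z) \<longlongrightarrow>
         value_at (X * diff_x w + Y * diff_y w - w) a b) (at 0)"
        by (rule Lim_transform_eventually)
      then show ?thesis using tendsto_unique[OF at_neq_bot _ lim] by blast
    qed
    note L = this[unfolded p_def q_def]
    from ev4 have "\<forall>\<^sub>F r in at 0. value_at u (a * (1 + r)) (b * (1 + r)) / (1 + r) = value_at u (value_at u a b * r) (value_at v a b * r) / r"
      unfolding p_def q_def by eventually_elim blast
    note 1 = L[OF ok(1) lu this]
    from ev4 have "\<forall>\<^sub>F r in at 0. value_at v (a * (1 + r)) (b * (1 + r)) / (1 + r) = value_at v (value_at u a b * r) (value_at v a b * r) / r"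
      unfolding p_def q_def by eventually_elim blast
    note 2 = L[OF ok(2) lv this]
    show "value_at (X * diff_x u + Y * diff_y u - u) a b = value_at \<omega> (value_at u a b) (value_at v a b) \<and>
     value_at (X * diff_x v + Y * diff_y v - v) a b = value_at \<rho> (value_at u a b) (value_at v a b)"
      using 1 2 by blast
  qed
qed

abbreviation integral_curve_at ::
  "rat2 \<Rightarrow> rat2 \<Rightarrow> rat2 \<Rightarrow> rat2 \<Rightarrow> real \<Rightarrow> real \<Rightarrow> real \<Rightarrow> bool" where
  "integral_curve_at u v \<omega> \<rho> a b t \<equiv>
     t \<noteq> 0 \<and> ok_at u (a * t) (b * t) \<and> ok_at v (a * t) (b * t) \<and>
     (ray u a b has_real_derivative value_at \<omega> (ray u a b t) (ray v a b t)) (at t) \<and>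
     (ray v a b has_real_derivative value_at \<rho> (ray u a b t) (ray v a b t)) (at t)"

text \<open>
  The previous equation at the point \<open>(a t, b t)\<close>, divided by \<open>t\<^sup>2\<close>: as the field is homogeneous of
  degree two, the factor moves inside and \<open>t \<mapsto> \<phi>(a t, b t) / t\<close> is an integral curve.
\<close>

lemma flow_curve:
  assumes flow: "rational_flow (u, v)" and vf: "has_vector_field (u, v) (\<omega>, \<rho>)"
  shows "generically (\<lambda>a b. \<forall>\<^sub>F t in at 0. integral_curve_at u v \<omega> \<rho> a b t)"
proof -
  have hom: "homogeneous 2 \<omega>" "homogeneous 2 \<rho>" using flow_vector_field_homogeneous[OF vf] by blast+
  have ok2: "generically (\<lambda>a b. ok_at \<omega> a b \<and> ok_at \<rho> a b)" by (intro generically_conj generically_ok)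
  note lim = rational_flow_limit[OF flow]
  note G = generically_conj[OF generically_conj[OF lim ok2]
    generically_line[OF generically_conj[OF generically_flow[OF lim ok2] flow_equation[OF flow vf]]]]
  show ?thesis
  proof (rule generically_mono[OF G], elim conjE)
    fix a b
    assume l: "(ray u a b \<longlongrightarrow> a) (at 0)" "(ray v a b \<longlongrightarrow> b) (at 0)"
      and ok: "ok_at \<omega> a b" "ok_at \<rho> a b"
      and ev: "\<forall>\<^sub>F z in at 0. (ok_at u (a * z) (b * z) \<and> ok_at v (a * z) (b * z) \<and>
          ok_at \<omega> (value_at u (a * z) (b * z)) (value_at v (a * z) (b * z)) \<and>
          ok_at \<rho> (value_at u (a * z) (b * z)) (value_at v (a * z) (b * z))) \<and>
        value_at (X * diff_x u + Y * diff_y u - u) (a * z) (b * z) = value_at \<omega> (value_at u (a * z) (b * z)) (value_at v (a * z) (b * z)) \<and>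
        value_at (X * diff_x v + Y * diff_y v - v) (a * z) (b * z) = value_at \<rho> (value_at u (a * z) (b * z)) (value_at v (a * z) (b * z))"
    note nz = eventually_neq_0
    from nz ev eventually_ok_at[OF ok(1) l] eventually_ok_at[OF ok(2) l]
    show "\<forall>\<^sub>F t in at 0. integral_curve_at u v \<omega> \<rho> a b t"
    proof eventually_elim
      case (elim t)
      define p q where "p = value_at u (a * t) (b * t)" and "q = value_at v (a * t) (b * t)"
      have h: "value_at w (p / t) (q / t) = value_at w p q / t\<^sup>2"
        if "homogeneous 2 w" "ok_at w p q" "ok_at w (p / t) (q / t)" for w
        using homogeneous_value[OF that(1), of p q "1 / t"] that elim(1)
        by (simp add: power_divide)
      have "value_at (X * diff_x u + Y * diff_y u - u) (a * t) (b * t) / t\<^sup>2 = value_at \<omega> (p / t) (q / t)"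
        "value_at (X * diff_x v + Y * diff_y v - v) (a * t) (b * t) / t\<^sup>2 = value_at \<rho> (p / t) (q / t)"
        using elim h[OF hom(1)] h[OF hom(2)] by (simp_all add: p_def q_def)
      then show ?case using elim DERIV_ray[of u a t b] DERIV_ray[of v a t b]
        unfolding p_def q_def by simp
    qed
  qed
qed

section \<open>Birational transformations\<close>

lemma homogeneous_comp:
  assumes m: "homogeneous 1 m1" "homogeneous 1 m2" and f: "homogeneous k f" and ok: "subst_ok const2 f m1 m2"
  shows "homogeneous k (rsubst const2 f m1 m2)"
proof (rule homogeneousI, rule generically_mono[OF generically_conj[OF generically_comp[OF ok] generically_line[OF generically_comp[OF ok]]]], elim conjE)
  fix a b
  assume 1: "ok_at m1 a b" "ok_at m2 a b" "ok_at f (value_at m1 a b) (value_at m2 a b)"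
    "value_at (rsubst const2 f m1 m2) a b = value_at f (value_at m1 a b) (value_at m2 a b)"
    and 2: "\<forall>\<^sub>F z in at 0. ok_at m1 (a * z) (b * z) \<and> ok_at m2 (a * z) (b * z) \<and>
       ok_at f (value_at m1 (a * z) (b * z)) (value_at m2 (a * z) (b * z)) \<and>
       value_at (rsubst const2 f m1 m2) (a * z) (b * z) = value_at f (value_at m1 (a * z) (b * z)) (value_at m2 (a * z) (b * z))"
  note nz = eventually_neq_0
  from 2 nz show "\<forall>\<^sub>F s in at 0. value_at (rsubst const2 f m1 m2) (a * s) (b * s) = s powi k * value_at (rsubst const2 f m1 m2) a b"
  proof eventually_elim
    case (elim s)
    have "value_at m1 (a * s) (b * s) = value_at m1 a b * s" "value_at m2 (a * s) (b * s) = value_at m2 a b * s"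
      using homogeneous_value[OF m(1)] homogeneous_value[OF m(2)] elim 1 by (simp_all add: mult.commute)
    then show ?case using homogeneous_value[OF f 1(3)] elim 1 by simp
  qed
qed

abbreviation right_inverse_at :: "rat2 \<Rightarrow> rat2 \<Rightarrow> rat2 \<Rightarrow> rat2 \<Rightarrow> real \<Rightarrow> real \<Rightarrow> bool" where
  "right_inverse_at f1 f2 g1 g2 a b \<equiv> ok_at g1 a b \<and> ok_at g2 a b \<and>
     ok_at f1 (value_at g1 a b) (value_at g2 a b) \<and> ok_at f2 (value_at g1 a b) (value_at g2 a b) \<and>
     value_at f1 (value_at g1 a b) (value_at g2 a b) = a \<and>
     value_at f2 (value_at g1 a b) (value_at g2 a b) = b"

locale birational_pair =
  fixes l1 l2 m1 m2 :: rat2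
  assumes hom_l: "homogeneous 1 l1" "homogeneous 1 l2"
    and inv: "birational_inverse (l1, l2) (m1, m2)"
begin

lemma l_m: "generically (\<lambda>a b. right_inverse_at l1 l2 m1 m2 a b)"
proof -
  have c: "subst_ok const2 l1 m1 m2" "subst_ok const2 l2 m1 m2" "rsubst const2 l1 m1 m2 = X" "rsubst const2 l2 m1 m2 = Y"
    using inv by (auto simp: birational_inverse_def composable_def comp2_def)
  from generically_conj[OF generically_comp[OF c(1)] generically_comp[OF c(2)]]
  show ?thesis by (rule generically_mono) (simp add: c value_basic)
qed

lemma m_l: "generically (\<lambda>a b. right_inverse_at m1 m2 l1 l2 a b)"
proof -
  have c: "subst_ok const2 m1 l1 l2" "subst_ok const2 m2 l1 l2" "rsubst const2 m1 l1 l2 = X" "rsubst const2 m2 l1 l2 = Y"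
    using inv by (auto simp: birational_inverse_def composable_def comp2_def)
  from generically_conj[OF generically_comp[OF c(1)] generically_comp[OF c(2)]]
  show ?thesis by (rule generically_mono) (simp add: c value_basic)
qed

lemma pull_l:
  assumes "generically R"
  shows "generically (\<lambda>a b. ok_at l1 a b \<and> ok_at l2 a b \<and> R (value_at l1 a b) (value_at l2 a b))"
proof (rule generically_pullback[OF assms])
  fix d :: "real poly poly" assume "d \<noteq> 0"
  from generically_ex[OF generically_conj[OF generically_psubst[OF this] l_m]]
  show "\<exists>a b. ok_at l1 a b \<and> ok_at l2 a b \<and> psubst id d (value_at l1 a b) (value_at l2 a b) \<noteq> 0"
    by metis
qed

lemma pull_m:
  assumes "generically R"
  shows "generically (\<lambda>a b. ok_at m1 a b \<and> ok_at m2 a b \<and> R (value_at m1 a b) (value_at m2 a b))"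
proof (rule generically_pullback[OF assms])
  fix d :: "real poly poly" assume "d \<noteq> 0"
  from generically_ex[OF generically_conj[OF generically_psubst[OF this] m_l]]
  show "\<exists>a b. ok_at m1 a b \<and> ok_at m2 a b \<and> psubst id d (value_at m1 a b) (value_at m2 a b) \<noteq> 0"
    by metis
qed

lemma hom_m: "homogeneous 1 m1" "homogeneous 1 m2"
proof -
  \<comment> \<open>the identity \<open>m (a s, b s) = s m (a, b)\<close> is read off at \<open>(a s, b s) = l (s m (a, b))\<close>\<close>
  note G = generically_conj[OF l_m pull_m[OF generically_line[OF m_l]]]
  have *: "value_at m1 (a * s) (b * s) = value_at m1 a b * s \<and> value_at m2 (a * s) (b * s) = value_at m2 a b * s"
    if 1: "ok_at l1 (value_at m1 a b) (value_at m2 a b)" "ok_at l2 (value_at m1 a b) (value_at m2 a b)"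
       "value_at l1 (value_at m1 a b) (value_at m2 a b) = a" "value_at l2 (value_at m1 a b) (value_at m2 a b) = b"
      and s: "s \<noteq> 0" and 2: "ok_at l1 (value_at m1 a b * s) (value_at m2 a b * s)" "ok_at l2 (value_at m1 a b * s) (value_at m2 a b * s)"
       "value_at m1 (value_at l1 (value_at m1 a b * s) (value_at m2 a b * s)) (value_at l2 (value_at m1 a b * s) (value_at m2 a b * s)) = value_at m1 a b * s"
       "value_at m2 (value_at l1 (value_at m1 a b * s) (value_at m2 a b * s)) (value_at l2 (value_at m1 a b * s) (value_at m2 a b * s)) = value_at m2 a b * s"
    for a b s
  proof -
    have "value_at l1 (value_at m1 a b * s) (value_at m2 a b * s) = a * s"
      "value_at l2 (value_at m1 a b * s) (value_at m2 a b * s) = b * s"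
      using homogeneous_value[OF hom_l(1) 1(1) 2(1) s] homogeneous_value[OF hom_l(2) 1(2) 2(2) s] 1
      by (simp_all add: mult.commute)
    then show ?thesis using 2 by simp
  qed
  note nz = eventually_neq_0
  have ev: "generically (\<lambda>a b. \<forall>\<^sub>F s in at 0. value_at m1 (a * s) (b * s) = value_at m1 a b * s \<and> value_at m2 (a * s) (b * s) = value_at m2 a b * s)"
  proof (rule generically_mono[OF G], elim conjE)
    fix a b
    assume 1: "ok_at l1 (value_at m1 a b) (value_at m2 a b)" "ok_at l2 (value_at m1 a b) (value_at m2 a b)"
       "value_at l1 (value_at m1 a b) (value_at m2 a b) = a" "value_at l2 (value_at m1 a b) (value_at m2 a b) = b"
      and 2: "\<forall>\<^sub>F s in at 0. right_inverse_at m1 m2 l1 l2 (value_at m1 a b * s) (value_at m2 a b * s)"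
    from 2 nz show "\<forall>\<^sub>F s in at 0. value_at m1 (a * s) (b * s) = value_at m1 a b * s \<and> value_at m2 (a * s) (b * s) = value_at m2 a b * s"
      by eventually_elim (rule *[OF 1]; blast)
  qed
  show "homogeneous 1 m1" "homogeneous 1 m2"
    by (rule homogeneousI, rule generically_mono[OF ev], erule eventually_mono, simp add: mult.commute)+
qed

end

section \<open>The canonical flows\<close>

definition canon1 :: "nat \<Rightarrow> real \<Rightarrow> real \<Rightarrow> real" where
  "canon1 N a b = a * (b + 1) powi (int N - 1)"

definition canon2 :: "real \<Rightarrow> real" where
  "canon2 b = b / (b + 1)"

lemma canonical_flow_at:
  assumes "b + 1 \<noteq> 0"
  shows "ok_at (fst (canonical_flow N)) a b" "ok_at (snd (canonical_flow N)) a b"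
    "value_at (fst (canonical_flow N)) a b = canon1 N a b" "value_at (snd (canonical_flow N)) a b = canon2 b"
  using assms
  by (simp_all add: canonical_flow_def canon1_def canon2_def ok_intros ok_basic value_simps value_basic)

lemma generically_neq_const: "generically (\<lambda>a b. b \<noteq> c)" "generically (\<lambda>a b. a \<noteq> c)"
proof -
  have "Y - const2 c \<noteq> 0"
  proof
    assume "Y - const2 c = 0"
    then have "value_at (Y - const2 c) 0 (c + 1) = 0" by (simp add: value_simps)
    then show False by (simp add: value_simps value_basic ok_basic)
  qed
  from generically_value_neq_0[OF this] show "generically (\<lambda>a b. b \<noteq> c)"
    by (rule generically_mono) (simp add: value_simps value_basic ok_basic)
  have "X - const2 c \<noteq> 0"
  proof
    assume "X - const2 c = 0"
    then have "value_at (X - const2 c) (c + 1) 0 = 0" by (simp add: value_simps)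
    then show False by (simp add: value_simps value_basic ok_basic)
  qed
  from generically_value_neq_0[OF this] show "generically (\<lambda>a b. a \<noteq> c)"
    by (rule generically_mono) (simp add: value_simps value_basic ok_basic)
qed

lemma generically_canonical:
  assumes "generically R"
  shows "generically (\<lambda>a b. b + 1 \<noteq> 0 \<and> R (canon1 N a b) (canon2 b))"
proof -
  have "generically (\<lambda>a b. ok_at (fst (canonical_flow N)) a b \<and> ok_at (snd (canonical_flow N)) a b \<and>
     R (value_at (fst (canonical_flow N)) a b) (value_at (snd (canonical_flow N)) a b))"
  proof (rule generically_pullback[OF assms])
    fix d :: "real poly poly" assume "d \<noteq> 0"
    from generically_ex[OF generically_conj[OF generically_psubst[OF this] generically_neq_const(1)[of 1]]]
    obtain a b where ab: "psubst id d a b \<noteq> (0::real)" "b \<noteq> 1" by blast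
    define b' where "b' = b / (1 - b)"
    define a' where "a' = a / (b' + 1) powi (int N - 1)"
    have b': "b' + 1 = 1 / (1 - b)" using ab(2) by (simp add: b'_def field_simps)
    then have nz: "b' + 1 \<noteq> 0" using ab(2) by simp
    have "canon2 b' = b" using ab(2) unfolding canon2_def b' by (simp add: b'_def)
    moreover have "canon1 N a' b' = a" unfolding canon1_def a'_def using nz by simp
    ultimately show "\<exists>a b. ok_at (fst (canonical_flow N)) a b \<and> ok_at (snd (canonical_flow N)) a b \<and>
      psubst id d (value_at (fst (canonical_flow N)) a b) (value_at (snd (canonical_flow N)) a b) \<noteq> 0"
      using ab(1) canonical_flow_at[OF nz, of N a'] by (intro exI[of _ a'] exI[of _ b']) simp
  qed
  from generically_conj[OF this generically_neq_const(1)[of "-1"]] show ?thesis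
  proof (rule generically_mono, elim conjE)
    fix a b assume *: "R (value_at (fst (canonical_flow N)) a b) (value_at (snd (canonical_flow N)) a b)" "b \<noteq> - 1"
    from *(2) have "b + 1 \<noteq> 0" by linarith
    with *(1) canonical_flow_at[OF this] show "b + 1 \<noteq> 0 \<and> R (canon1 N a b) (canon2 b)" by simp
  qed
qed

text \<open>
  Evaluated at \<open>(a t, b t)\<close>, the ratio of the coordinates is a polynomial of degree \<open>N\<close> in \<open>t\<close>; the
  level is recovered from it as this degree.
\<close>

lemma canon_ratio:
  assumes "b + 1 \<noteq> 0" "b \<noteq> 0"
  shows "canon1 N a b / canon2 b = a / b * (b + 1) ^ N"
proof -
  have "(b + 1) powi (int N - 1) = (b + 1) ^ N / (b + 1)"
    using assms(1) by (simp add: power_int_diff)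
  moreover have "a * (d / c) / (b / c) = a / b * d" if "c \<noteq> 0" for c d :: real
    using that assms(2) by simp
  ultimately show ?thesis using assms(1) unfolding canon1_def canon2_def by simp
qed

text \<open>
  The translation equation for the canonical flow.
\<close>

lemma canonical_translation:
  assumes "b + 1 \<noteq> 0" "z * b + 1 \<noteq> 0" "z \<noteq> 0"
  shows "canon2 ((1 - z) / z * canon2 (z * b)) = (1 - z) * canon2 b"
    "canon1 N ((1 - z) / z * canon1 N (z * a) (z * b)) ((1 - z) / z * canon2 (z * b)) = (1 - z) * canon1 N a b"
    "(1 - z) / z * canon2 (z * b) + 1 = (b + 1) / (z * b + 1)"
proof -
  have *: "(1 - z) / z * canon2 (z * b) = (1 - z) * b / (z * b + 1)"
    using assms(3) by (simp add: canon2_def)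
  have **: "(1 - z) * b / (z * b + 1) + 1 = (b + 1) / (z * b + 1)"
    using assms(2) by (simp add: field_simps)
  then show "(1 - z) / z * canon2 (z * b) + 1 = (b + 1) / (z * b + 1)" using * by simp
  show "canon2 ((1 - z) / z * canon2 (z * b)) = (1 - z) * canon2 b"
    unfolding * unfolding canon2_def ** using assms(2) by simp
  show "canon1 N ((1 - z) / z * canon1 N (z * a) (z * b)) ((1 - z) / z * canon2 (z * b)) = (1 - z) * canon1 N a b"
    unfolding * unfolding canon1_def ** using assms by (simp add: power_int_divide_distrib)
qed

context birational_pair
begin

text \<open>
  All that is used about \<open>\<phi> = m \<circ> \<phi>\<^sub>N \<circ> l\<close> at a point: every composition is defined there, and both
  \<open>\<phi> = m \<circ> \<phi>\<^sub>N \<circ> l\<close> and \<open>l \<circ> \<phi> = \<phi>\<^sub>N \<circ> l\<close> hold.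
\<close>

abbreviation conjugate_at :: "nat \<Rightarrow> rat2 \<Rightarrow> rat2 \<Rightarrow> real \<Rightarrow> real \<Rightarrow> bool" where
  "conjugate_at N u v a b \<equiv>
     ok_at l1 a b \<and> ok_at l2 a b \<and> value_at l2 a b + 1 \<noteq> 0 \<and> ok_at u a b \<and> ok_at v a b \<and>
     ok_at m1 (canon1 N (value_at l1 a b) (value_at l2 a b)) (canon2 (value_at l2 a b)) \<and>
     ok_at m2 (canon1 N (value_at l1 a b) (value_at l2 a b)) (canon2 (value_at l2 a b)) \<and>
     value_at u a b = value_at m1 (canon1 N (value_at l1 a b) (value_at l2 a b)) (canon2 (value_at l2 a b)) \<and>
     value_at v a b = value_at m2 (canon1 N (value_at l1 a b) (value_at l2 a b)) (canon2 (value_at l2 a b)) \<and>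
     ok_at l1 (value_at u a b) (value_at v a b) \<and>
     ok_at l2 (value_at u a b) (value_at v a b) \<and>
     value_at l1 (value_at u a b) (value_at v a b) = canon1 N (value_at l1 a b) (value_at l2 a b) \<and>
     value_at l2 (value_at u a b) (value_at v a b) = canon2 (value_at l2 a b)"

lemma conjugate_value:
  assumes "\<phi> = comp2 (m1, m2) (comp2 (canonical_flow N) (l1, l2))" "composable (canonical_flow N) (l1, l2)"
    "composable (m1, m2) (comp2 (canonical_flow N) (l1, l2))" and R: "generically R"
  shows "generically (\<lambda>a b. conjugate_at N (fst \<phi>) (snd \<phi>) a b \<and> R (value_at (fst \<phi>) a b) (value_at (snd \<phi>) a b))"
proof -
  define p q where "p = rsubst const2 (fst (canonical_flow N)) l1 l2" and "q = rsubst const2 (snd (canonical_flow N)) l1 l2"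
  have ok: "subst_ok const2 (fst (canonical_flow N)) l1 l2" "subst_ok const2 (snd (canonical_flow N)) l1 l2"
    "subst_ok const2 m1 p q" "subst_ok const2 m2 p q"
    and phi: "fst \<phi> = rsubst const2 m1 p q" "snd \<phi> = rsubst const2 m2 p q"
    using assms(1-3) by (simp_all add: comp2_def composable_def p_def q_def)
  note G1 = generically_conj[OF generically_comp[OF ok(1)] generically_comp[OF ok(2)], folded p_def q_def]
  note G2 = generically_conj[OF generically_comp[OF ok(3)] generically_comp[OF ok(4)], folded phi]
  note G3 = pull_l[OF generically_canonical[OF generically_conj[OF l_m pull_m[OF R]], of N]]
  note G4 = generically_conj[OF generically_ok[of "fst \<phi>"] generically_ok[of "snd \<phi>"]]
  from generically_conj[OF G1 generically_conj[OF G2 generically_conj[OF G3 G4]]] show ?thesis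
    by (rule generically_mono) (auto simp: canonical_flow_at)
qed

end

section \<open>Uniqueness of the level\<close>

text \<open>
  A \<open>0\<close>-homogeneous function is a function of \<open>x / y\<close>: restrict it to a line \<open>y = b\<^sub>0\<close> on which its
  denominator does not vanish identically.
\<close>

lemma homogeneous_0_univariate:
  assumes "homogeneous 0 r"
  obtains R1 R2 where "R2 \<noteq> 0"
    "generically (\<lambda>a b. b \<noteq> 0 \<and> poly R2 (a / b) \<noteq> 0 \<and> value_at r a b = poly R1 (a / b) / poly R2 (a / b))"
proof -
  define P Q where "P = fst (quot_of_fract r)" and "Q = snd (quot_of_fract r)"
  obtain a0 b0 where "ok_at r a0 b0" and b0: "b0 \<noteq> 0"
    using generically_ex[OF generically_conj[OF generically_ok[of r] generically_neq_const(1)[of 0]]] by blast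
  then have Q0: "psubst id Q a0 b0 \<noteq> 0" by (simp add: subst_ok_def Q_def)
  define lp where "lp p = poly (map_poly (\<lambda>q. pcompose q [:0, b0:]) p) [:b0:]" for p :: "real poly poly"
  have lp: "poly (lp p) x = psubst id p (b0 * x) b0" for p x
  proof -
    have "poly (lp p) x = poly (map_poly (\<lambda>q. poly q (b0 * x)) p) b0"
      unfolding lp_def by (induction p) (simp_all add: map_poly_pCons poly_pcompose mult.commute)
    then show ?thesis by (simp add: psubst_def)
  qed
  have vr: "value_at r (b0 * x) b0 = poly (lp P) x / poly (lp Q) x" for x
    by (simp add: lp rsubst_def P_def Q_def)
  have okr: "ok_at r (b0 * x) b0 \<longleftrightarrow> poly (lp Q) x \<noteq> 0" for x
    by (simp add: lp subst_ok_def Q_def)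
  have "poly (lp Q) (a0 / b0) \<noteq> 0" using Q0 b0 by (simp add: lp)
  then have nz: "lp Q \<noteq> 0" by auto
  define f where "f = psubst const2 Q (const2 b0 * (X / Y)) (const2 b0)"
  have f: "value_at f a b = poly (lp Q) (a / b)" if "b \<noteq> 0" for a b
    unfolding f_def using that by (simp add: ok_value_psubst ok_intros value_simps ok_basic value_basic lp)
  have "f \<noteq> 0"
  proof
    assume "f = 0"
    then show False using f[of b0 a0] \<open>poly (lp Q) (a0 / b0) \<noteq> 0\<close> b0 by (simp add: value_simps)
  qed
  note G = generically_conj[OF generically_conj[OF generically_value_neq_0[OF this] generically_ok[of r]] generically_neq_const(1)[of 0]]
  have "generically (\<lambda>a b. b \<noteq> 0 \<and> poly (lp Q) (a / b) \<noteq> 0 \<and> value_at r a b = poly (lp P) (a / b) / poly (lp Q) (a / b))"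
  proof (rule generically_mono[OF G], elim conjE)
    fix a b :: real
    assume *: "value_at f a b \<noteq> 0" "ok_at r a b" "b \<noteq> 0"
    have e: "a * (b0 / b) = b0 * (a / b)" "b * (b0 / b) = b0" using *(3) by simp_all
    have "ok_at r (a * (b0 / b)) (b * (b0 / b))" unfolding e okr using *(1) f[OF *(3)] by simp
    then have "value_at r (a * (b0 / b)) (b * (b0 / b)) = (b0 / b) powi 0 * value_at r a b"
      by (rule homogeneous_value[OF assms *(2)]) (use * b0 in simp)
    then show "b \<noteq> 0 \<and> poly (lp Q) (a / b) \<noteq> 0 \<and> value_at r a b = poly (lp P) (a / b) / poly (lp Q) (a / b)"
      using * f unfolding e vr by simp
  qed
  with nz that show ?thesis by blast
qed

text \<open>
  Suppose that \<open>\<phi>\<close> is conjugate by \<open>l\<close> to the canonical flow of level \<open>N\<close> and by \<open>k\<close> to that of level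
  \<open>M\<close>. The ratio \<open>k\<^sub>1 / k\<^sub>2\<close> is \<open>0\<close>-homogeneous, hence a univariate rational function \<open>R\<^sub>1 / R\<^sub>2\<close> of
  \<open>l\<^sub>1 / l\<^sub>2\<close>. Evaluating both ratios after \<open>\<phi>\<close>, along a ray with parameter \<open>t\<close>, turns them into
  polynomials \<open>Q\<close> and \<open>P\<close> of degrees \<open>M\<close> and \<open>N\<close> by \<open>canon_ratio\<close>. From \<open>R\<^sub>1(P) = Q R\<^sub>2(P)\<close> the degree
  \<open>M\<close> is a difference of multiples of \<open>N\<close>.
\<close>

lemma level_dvd:
  assumes "conjugate_to_canonical \<phi> N" "conjugate_to_canonical \<phi> M"
  shows "N dvd M"
proof -
  obtain l1 l2 m1 m2 where "one_BIR (l1, l2)" and li: "birational_inverse (l1, l2) (m1, m2)"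
    and lc: "\<phi> = comp2 (m1, m2) (comp2 (canonical_flow N) (l1, l2))" "composable (canonical_flow N) (l1, l2)"
      "composable (m1, m2) (comp2 (canonical_flow N) (l1, l2))"
    using assms(1) unfolding conjugate_to_canonical_def by auto
  then interpret L: birational_pair l1 l2 m1 m2 by unfold_locales (auto simp: one_BIR_def)
  obtain k1 k2 n1 n2 where "one_BIR (k1, k2)" and ki: "birational_inverse (k1, k2) (n1, n2)"
    and kc: "\<phi> = comp2 (n1, n2) (comp2 (canonical_flow M) (k1, k2))" "composable (canonical_flow M) (k1, k2)"
      "composable (n1, n2) (comp2 (canonical_flow M) (k1, k2))"
    using assms(2) unfolding conjugate_to_canonical_def by auto
  then interpret K: birational_pair k1 k2 n1 n2 by unfold_locales (auto simp: one_BIR_def)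
  have "k2 \<noteq> 0"
    using generically_ex[OF generically_conj[OF K.pull_l[OF generically_neq_const(1)[of 0]] generically_ok[of k2]]]
    by (auto simp: value_simps)
  define f where "f = k1 / k2"
  have hf: "homogeneous 0 f" using homogeneous_divide[OF K.hom_l \<open>k2 \<noteq> 0\<close>] by (simp add: f_def)
  have okf: "subst_ok const2 f m1 m2"
    using generically_ex[OF L.pull_m[OF generically_ok[of f]]] ok_value_rsubst(1) by blast
  define r where "r = rsubst const2 f m1 m2"
  have hr: "homogeneous 0 r" unfolding r_def by (rule homogeneous_comp[OF L.hom_m hf okf])
  obtain R1 R2 where R2: "R2 \<noteq> 0" and
    R: "generically (\<lambda>a b. b \<noteq> 0 \<and> poly R2 (a / b) \<noteq> 0 \<and> value_at r a b = poly R1 (a / b) / poly R2 (a / b))"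
    using homogeneous_0_univariate[OF hr] by blast
  have knz: "generically (\<lambda>a b. value_at k2 a b \<noteq> 0 \<and> ok_at k1 a b \<and> ok_at k2 a b)"
    by (intro generically_conj generically_ok generically_value_neq_0 \<open>k2 \<noteq> 0\<close>)
  note G1 = generically_conj[OF L.pull_l[OF generically_conj[OF R generically_comp[OF okf, folded r_def]]] generically_conj[OF L.m_l knz]]
  have G2: "generically (\<lambda>a b. poly R2 (value_at l1 a b / value_at l2 a b) \<noteq> 0 \<and>
     value_at k1 a b / value_at k2 a b =
       poly R1 (value_at l1 a b / value_at l2 a b) / poly R2 (value_at l1 a b / value_at l2 a b))"
    by (rule generically_mono[OF G1]) (auto simp: f_def value_simps)
  have G3: "generically (\<lambda>a b. ok_at l1 a b \<and> ok_at l2 a b \<and> ok_at k1 a b \<and> ok_at k2 a b \<and>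
      value_at l2 a b + 1 \<noteq> 0 \<and> value_at k2 a b + 1 \<noteq> 0 \<and>
      poly R2 (canon1 N (value_at l1 a b) (value_at l2 a b) / canon2 (value_at l2 a b)) \<noteq> 0 \<and>
      canon1 M (value_at k1 a b) (value_at k2 a b) / canon2 (value_at k2 a b) =
      poly R1 (canon1 N (value_at l1 a b) (value_at l2 a b) / canon2 (value_at l2 a b)) /
      poly R2 (canon1 N (value_at l1 a b) (value_at l2 a b) / canon2 (value_at l2 a b)))"
    by (rule generically_mono[OF generically_conj[OF L.conjugate_value[OF lc G2] K.conjugate_value[OF kc G2]]],
        elim conjE) (intro conjI; simp)
  note G4 = generically_conj[OF L.pull_l[OF generically_conj[OF generically_neq_const(1)[of 0] generically_neq_const(2)[of 0]]]
       K.pull_l[OF generically_conj[OF generically_neq_const(1)[of 0] generically_neq_const(2)[of 0]]]]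
  from generically_ex[OF generically_conj[OF G4 generically_line[OF G3]]]
  obtain a b where okl: "ok_at l1 a b" "ok_at l2 a b" "ok_at k1 a b" "ok_at k2 a b"
    and nz: "value_at l1 a b \<noteq> 0" "value_at l2 a b \<noteq> 0" "value_at k1 a b \<noteq> 0" "value_at k2 a b \<noteq> 0"
    and ev: "\<forall>\<^sub>F t in at 0. ok_at l1 (a * t) (b * t) \<and> ok_at l2 (a * t) (b * t) \<and> ok_at k1 (a * t) (b * t) \<and> ok_at k2 (a * t) (b * t) \<and>
      value_at l2 (a * t) (b * t) + 1 \<noteq> 0 \<and> value_at k2 (a * t) (b * t) + 1 \<noteq> 0 \<and>
      poly R2 (canon1 N (value_at l1 (a * t) (b * t)) (value_at l2 (a * t) (b * t)) / canon2 (value_at l2 (a * t) (b * t))) \<noteq> 0 \<and>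
      canon1 M (value_at k1 (a * t) (b * t)) (value_at k2 (a * t) (b * t)) / canon2 (value_at k2 (a * t) (b * t)) =
      poly R1 (canon1 N (value_at l1 (a * t) (b * t)) (value_at l2 (a * t) (b * t)) / canon2 (value_at l2 (a * t) (b * t))) /
      poly R2 (canon1 N (value_at l1 (a * t) (b * t)) (value_at l2 (a * t) (b * t)) / canon2 (value_at l2 (a * t) (b * t)))"
    by blast
  define P where "P = smult (value_at l1 a b / value_at l2 a b) ([:1, value_at l2 a b:] ^ N)"
  define Q where "Q = smult (value_at k1 a b / value_at k2 a b) ([:1, value_at k2 a b:] ^ M)"
  have dP: "degree P = N" and dQ: "degree Q = M" and Q0: "Q \<noteq> 0"
    using nz by (simp_all add: P_def Q_def degree_power_eq)
  note nzt = eventually_neq_0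
  have ev2: "\<forall>\<^sub>F t in at 0. poly R2 (poly P t) \<noteq> 0 \<and> poly R1 (poly P t) = poly Q t * poly R2 (poly P t)"
    using ev nzt
  proof eventually_elim
    case (elim t)
    have l: "value_at l1 (a * t) (b * t) = t * value_at l1 a b" "value_at l2 (a * t) (b * t) = t * value_at l2 a b"
      "value_at k1 (a * t) (b * t) = t * value_at k1 a b" "value_at k2 (a * t) (b * t) = t * value_at k2 a b"
      using homogeneous_value[OF L.hom_l(1) okl(1)] homogeneous_value[OF L.hom_l(2) okl(2)]
        homogeneous_value[OF K.hom_l(1) okl(3)] homogeneous_value[OF K.hom_l(2) okl(4)] elim by simp_all
    have "canon1 N (t * value_at l1 a b) (t * value_at l2 a b) / canon2 (t * value_at l2 a b) = poly P t"
      using elim nz by (subst canon_ratio) (simp_all add: l P_def field_simps)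
    moreover have "canon1 M (t * value_at k1 a b) (t * value_at k2 a b) / canon2 (t * value_at k2 a b) = poly Q t"
      using elim nz by (subst canon_ratio) (simp_all add: l Q_def field_simps)
    ultimately show ?case using elim unfolding l by (metis eq_divide_eq)
  qed
  have "pcompose R2 P \<noteq> 0"
  proof
    assume "pcompose R2 P = 0"
    then have "poly R2 (poly P t) = 0" for t by (metis poly_pcompose poly_0)
    then have "\<forall>\<^sub>F t::real in at 0. False" using ev2 by simp
    then show False by simp
  qed
  have "pcompose R1 P = Q * pcompose R2 P"
  proof (rule ccontr)
    assume "pcompose R1 P \<noteq> Q * pcompose R2 P"
    then have "\<forall>\<^sub>F t in at 0. poly (pcompose R1 P - Q * pcompose R2 P) t \<noteq> 0"
      by (intro eventually_poly_neq_0) simp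
    with ev2 have "\<forall>\<^sub>F t::real in at 0. False" by eventually_elim (simp add: poly_pcompose)
    then show False by simp
  qed
  then have "degree (pcompose R1 P) = degree Q + degree (pcompose R2 P)"
    using degree_mult_eq[OF Q0 \<open>pcompose R2 P \<noteq> 0\<close>] by simp
  then have "degree R1 * N = M + degree R2 * N"
    by (simp only: degree_pcompose dP dQ)
  then show "N dvd M" by (metis dvd_add_left_iff dvd_triv_right)
qed

lemma level_unique:
  "conjugate_to_canonical \<phi> N \<Longrightarrow> has_level \<phi> N"
  unfolding has_level_def using level_dvd dvd_antisym by blast

section \<open>Flows from linearising transformations\<close>

text \<open>
  A punctured neighbourhood of \<open>0\<close> is not connected, so constancy can only be concluded on one side.
\<close>

lemma zero_derivative_at_right:
  fixes h :: "real \<Rightarrow> real"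
  assumes "\<forall>\<^sub>F t in at_right 0. (h has_real_derivative 0) (at t)" "(h \<longlongrightarrow> L) (at_right 0)"
  shows "\<forall>\<^sub>F t in at_right 0. h t = L"
proof -
  obtain e where e: "e > 0" "\<And>t. 0 < t \<Longrightarrow> t < e \<Longrightarrow> (h has_real_derivative 0) (at t)"
    using assms(1) unfolding eventually_at_right_field by blast
  have const: "h s = h (e / 2)" if "0 < s" "s < e" for s
    by (rule DERIV_isconst3[of 0 e]) (use e that in auto)
  have near: "\<forall>\<^sub>F t in at_right 0. 0 < t \<and> t < e"
    unfolding eventually_at_right_field using e by blast
  then have "\<forall>\<^sub>F t in at_right 0. h t = h (e / 2)" by eventually_elim (use const in blast)
  then have "(h \<longlongrightarrow> h (e / 2)) (at_right 0)" by (rule tendsto_eventually)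
  then have L: "h (e / 2) = L" using tendsto_unique[OF trivial_limit_at_right_real _ assms(2)] by blast
  from near show ?thesis by eventually_elim (use const L in blast)
qed

text \<open>
  The equations \<open>f' = n f g\<close> and \<open>g' = - g\<^sup>2\<close> have the first integrals \<open>1 / g - t\<close> and \<open>f g\<^sup>n\<close>, which
  the initial values determine.
\<close>

lemma canonical_curve:
  fixes f g :: "real \<Rightarrow> real"
  assumes f: "\<forall>\<^sub>F t in at_right 0. (f has_real_derivative of_int n * f t * g t) (at t)"
    and g: "\<forall>\<^sub>F t in at_right 0. (g has_real_derivative - (g t)\<^sup>2) (at t)"
    and lim: "(f \<longlongrightarrow> \<alpha>) (at_right 0)" "(g \<longlongrightarrow> \<beta>) (at_right 0)" and \<beta>: "\<beta> \<noteq> 0"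
  shows "\<forall>\<^sub>F t in at_right 0. t * \<beta> + 1 \<noteq> 0 \<and> f t = \<alpha> * (t * \<beta> + 1) powi n \<and> g t = \<beta> / (t * \<beta> + 1)"
proof -
  have gnz: "\<forall>\<^sub>F t in at_right 0. g t \<noteq> 0" by (rule tendsto_imp_eventually_ne[OF lim(2) \<beta>])
  have "\<forall>\<^sub>F t in at_right 0. ((\<lambda>t. inverse (g t) - t) has_real_derivative 0) (at t)"
    using g gnz
  proof eventually_elim
    case (elim t)
    show ?case
      by (rule DERIV_cong[OF DERIV_diff[OF DERIV_inverse'[OF elim] DERIV_ident]])
        (use elim in \<open>simp add: power2_eq_square field_simps\<close>)
  qed
  moreover have "((\<lambda>t. inverse (g t) - t) \<longlongrightarrow> inverse \<beta> - 0) (at_right 0)"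
    by (intro tendsto_intros lim \<beta>)
  ultimately have 1: "\<forall>\<^sub>F t in at_right 0. inverse (g t) - t = inverse \<beta> - 0"
    by (rule zero_derivative_at_right)
  have "\<forall>\<^sub>F t in at_right 0. ((\<lambda>t. f t * g t powi n) has_real_derivative 0) (at t)"
    using f g gnz
  proof eventually_elim
    case (elim t)
    have "g t powi n = g t powi (n - 1) * g t" using elim by (simp add: power_int_diff)
    then show ?case
      by (intro DERIV_cong[OF DERIV_mult[OF elim(1) DERIV_power_int[OF elim(2)]]])
        (use elim in \<open>simp_all add: power2_eq_square\<close>)
  qed
  moreover have "((\<lambda>t. f t * g t powi n) \<longlongrightarrow> \<alpha> * \<beta> powi n) (at_right 0)"
    by (intro tendsto_intros lim) (simp add: \<beta>)
  ultimately have 2: "\<forall>\<^sub>F t in at_right 0. f t * g t powi n = \<alpha> * \<beta> powi n"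
    by (rule zero_derivative_at_right)
  show ?thesis using 1 2 gnz
  proof eventually_elim
    case (elim t)
    have "(t * \<beta> + 1) / \<beta> = t + inverse \<beta>" using \<beta> by (simp add: add_divide_distrib inverse_eq_divide)
    moreover have "inverse (g t) = t + inverse \<beta>" using elim(1) by linarith
    ultimately have i: "inverse (g t) = (t * \<beta> + 1) / \<beta>" by (rule trans[OF _ sym, rotated])
    then have nz: "t * \<beta> + 1 \<noteq> 0" using elim(3) by auto
    have "g t = inverse ((t * \<beta> + 1) / \<beta>)" using i by (metis inverse_inverse_eq)
    then have g: "g t = \<beta> / (t * \<beta> + 1)" by simp
    then have eq: "f t * (\<beta> powi n / (t * \<beta> + 1) powi n) = \<alpha> * \<beta> powi n" using elim(2) by (simp add: power_int_divide_distrib)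
    have "y = \<alpha> * c" if "y * (b / c) = \<alpha> * b" "b \<noteq> 0" "c \<noteq> 0" for y b c :: real
      using that by (simp add: divide_eq_eq)
    from this[OF eq] have "f t = \<alpha> * (t * \<beta> + 1) powi n" using nz \<beta> by simp
    with nz g show ?case by blast
  qed
qed

context birational_pair
begin

abbreviation canonical_image :: "nat \<Rightarrow> rat2 \<times> rat2" where
  "canonical_image N \<equiv> comp2 (canonical_flow N) (l1, l2)"

lemma composable_canonical: "composable (canonical_flow N) (l1, l2)"
proof -
  from generically_ex[OF pull_l[OF generically_neq_const(1)[of "-1"]]] obtain a b
    where *: "ok_at l1 a b" "ok_at l2 a b" "value_at l2 a b \<noteq> - 1" by blast
  then have "value_at l2 a b + 1 \<noteq> 0" by linarith
  then show ?thesis unfolding composable_def fst_conv snd_conv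
    by (intro conjI ok_value_rsubst(1)[OF *(1,2)] canonical_flow_at)
qed

lemma comp_canonical_value:
  "generically (\<lambda>a b. ok_at l1 a b \<and> ok_at l2 a b \<and> value_at l2 a b + 1 \<noteq> 0 \<and>
     ok_at (fst (canonical_image N)) a b \<and> ok_at (snd (canonical_image N)) a b \<and>
     value_at (fst (canonical_image N)) a b = canon1 N (value_at l1 a b) (value_at l2 a b) \<and>
     value_at (snd (canonical_image N)) a b = canon2 (value_at l2 a b))"
proof -
  have c: "subst_ok const2 (fst (canonical_flow N)) l1 l2" "subst_ok const2 (snd (canonical_flow N)) l1 l2"
    using composable_canonical[of N] by (simp_all add: composable_def)
  note G = generically_conj[OF pull_l[OF generically_neq_const(1)[of "-1"]] generically_conj[OF generically_comp[OF c(1)] generically_comp[OF c(2)]]]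
  note G2 = generically_conj[OF generically_ok[of "fst (canonical_image N)"] generically_ok[of "snd (canonical_image N)"]]
  show ?thesis
  proof (rule generically_mono[OF generically_conj[OF G G2]], elim conjE)
    fix a b
    assume *: "value_at l2 a b \<noteq> - 1" "ok_at l1 a b" "ok_at l2 a b"
      "value_at (rsubst const2 (fst (canonical_flow N)) l1 l2) a b = value_at (fst (canonical_flow N)) (value_at l1 a b) (value_at l2 a b)"
      "value_at (rsubst const2 (snd (canonical_flow N)) l1 l2) a b = value_at (snd (canonical_flow N)) (value_at l1 a b) (value_at l2 a b)"
      "ok_at (fst (canonical_image N)) a b" "ok_at (snd (canonical_image N)) a b"
    have "value_at l2 a b + 1 \<noteq> 0" using *(1) by linarith
    then show "ok_at l1 a b \<and> ok_at l2 a b \<and> value_at l2 a b + 1 \<noteq> 0 \<and>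
     ok_at (fst (canonical_image N)) a b \<and> ok_at (snd (canonical_image N)) a b \<and>
     value_at (fst (canonical_image N)) a b = canon1 N (value_at l1 a b) (value_at l2 a b) \<and>
     value_at (snd (canonical_image N)) a b = canon2 (value_at l2 a b)"
      using * by (simp add: comp2_def canonical_flow_at)
  qed
qed

lemma composable_conjugate: "composable (m1, m2) (canonical_image N)"
proof -
  note G = pull_l[OF generically_canonical[OF generically_conj[OF generically_ok[of m1] generically_ok[of m2]], of N]]
  from generically_ex[OF generically_conj[OF G comp_canonical_value[of N]]]
  obtain a b where *: "ok_at m1 (canon1 N (value_at l1 a b) (value_at l2 a b)) (canon2 (value_at l2 a b))"
    "ok_at m2 (canon1 N (value_at l1 a b) (value_at l2 a b)) (canon2 (value_at l2 a b))"
    and ok: "ok_at (fst (canonical_image N)) a b" "ok_at (snd (canonical_image N)) a b"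
    and e: "value_at (fst (canonical_image N)) a b = canon1 N (value_at l1 a b) (value_at l2 a b)"
     "value_at (snd (canonical_image N)) a b = canon2 (value_at l2 a b)"
    by blast
  show ?thesis unfolding composable_def fst_conv snd_conv
    by (intro conjI ok_value_rsubst(1)[OF ok, unfolded e] *)
qed

lemma l2_neq_0: "l2 \<noteq> 0"
  using generically_ex[OF generically_conj[OF pull_l[OF generically_neq_const(1)[of 0]] generically_ok[of l2]]]
  by (auto simp: value_simps)

text \<open>
  The hypotheses say that \<open>l\<close> carries the field to \<open>((N - 1) x y, - y\<^sup>2)\<close>. So the image under \<open>l\<close> of
  the integral curve \<open>t \<mapsto> \<phi>(a t, b t) / t\<close> solves the system of \<open>canonical_curve\<close>, with initial value
  \<open>l(a, b)\<close>. By homogeneity of \<open>l\<close> this means \<open>l \<circ> \<phi> = \<phi>\<^sub>N \<circ> l\<close> along the ray, and rays are enough to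
  identify rational maps.
\<close>

lemma flow_is_conjugate:
  assumes flow: "rational_flow (u, v)" and vf: "has_vector_field (u, v) (\<omega>, \<rho>)"
    and D1: "\<omega> * diff_x l1 + \<rho> * diff_y l1 = const2 (real_of_int (int N - 1)) * l1 * l2"
    and D2: "\<omega> * diff_x l2 + \<rho> * diff_y l2 = - (l2\<^sup>2)"
    and one: "one_BIR (l1, l2)"
  shows "conjugate_to_canonical (u, v) N"
proof -
  define B where "B = comp2 (canonical_flow N) (l1, l2)"
  note lim = rational_flow_limit[OF flow]
  have okl: "generically (\<lambda>a b. ok_at l1 a b \<and> ok_at l2 a b)" by (intro generically_conj generically_ok)
  have okw: "generically (\<lambda>a b. ok_at \<omega> a b \<and> ok_at \<rho> a b)" by (intro generically_conj generically_ok)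
  note pull = generically_flow[OF lim okl]
  have sok: "subst_ok const2 l1 u v" "subst_ok const2 l2 u v"
    using generically_ex[OF pull] ok_value_rsubst(1) by blast+
  define A1 A2 where "A1 = rsubst const2 l1 u v" and "A2 = rsubst const2 l2 u v"
  note GA = generically_conj[OF generically_comp[OF sok(1)] generically_comp[OF sok(2)], folded A1_def A2_def]
  note GB = comp_canonical_value[of N, folded B_def]
  note G = generically_conj[OF generically_conj[OF generically_conj[OF lim flow_curve[OF flow vf]] generically_conj[OF okl okw]]
      generically_conj[OF generically_value_neq_0[OF l2_neq_0] generically_line[OF generically_conj[OF GA GB]]]]
  have "generically (\<lambda>a b. frequently (\<lambda>t. value_at A1 (a * t) (b * t) = value_at (fst B) (a * t) (b * t) \<and>
        value_at A2 (a * t) (b * t) = value_at (snd B) (a * t) (b * t)) (at 0))"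
  proof (rule generically_mono[OF G], elim conjE)
    fix a b
    assume l: "(ray u a b \<longlongrightarrow> a) (at 0)" "(ray v a b \<longlongrightarrow> b) (at 0)"
      and curve: "\<forall>\<^sub>F t in at 0. integral_curve_at u v \<omega> \<rho> a b t"
      and okl: "ok_at l1 a b" "ok_at l2 a b" and okw: "ok_at \<omega> a b" "ok_at \<rho> a b" and \<beta>: "value_at l2 a b \<noteq> 0"
      and line: "\<forall>\<^sub>F z in at 0.
        ((ok_at u (a * z) (b * z) \<and> ok_at v (a * z) (b * z) \<and>
          ok_at l1 (value_at u (a * z) (b * z)) (value_at v (a * z) (b * z)) \<and>
          value_at A1 (a * z) (b * z) = value_at l1 (value_at u (a * z) (b * z)) (value_at v (a * z) (b * z))) \<and>
         ok_at u (a * z) (b * z) \<and> ok_at v (a * z) (b * z) \<and>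
         ok_at l2 (value_at u (a * z) (b * z)) (value_at v (a * z) (b * z)) \<and>
         value_at A2 (a * z) (b * z) = value_at l2 (value_at u (a * z) (b * z)) (value_at v (a * z) (b * z))) \<and>
        ok_at l1 (a * z) (b * z) \<and> ok_at l2 (a * z) (b * z) \<and> value_at l2 (a * z) (b * z) + 1 \<noteq> 0 \<and>
        ok_at (fst B) (a * z) (b * z) \<and> ok_at (snd B) (a * z) (b * z) \<and>
        value_at (fst B) (a * z) (b * z) = canon1 N (value_at l1 (a * z) (b * z)) (value_at l2 (a * z) (b * z)) \<and>
        value_at (snd B) (a * z) (b * z) = canon2 (value_at l2 (a * z) (b * z))"
    define c1 c2 where "c1 t = ray u a b t" and "c2 t = ray v a b t" for t
    define f g where "f t = value_at l1 (c1 t) (c2 t)" and "g t = value_at l2 (c1 t) (c2 t)" for t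
    define \<alpha> \<beta> where "\<alpha> = value_at l1 a b" and "\<beta> = value_at l2 a b"
    have l': "(c1 \<longlongrightarrow> a) (at 0)" "(c2 \<longlongrightarrow> b) (at 0)" using l unfolding c1_def c2_def .
    note okc = eventually_ok_at[OF okl(1) l'] eventually_ok_at[OF okl(2) l'] eventually_ok_at[OF okw(1) l'] eventually_ok_at[OF okw(2) l']
    have der: "\<forall>\<^sub>F t in at 0. (f has_real_derivative of_int (int N - 1) * f t * g t) (at t) \<and>
        (g has_real_derivative - (g t)\<^sup>2) (at t)"
      using curve okc
    proof eventually_elim
      case (elim t)
      have c: "(c1 has_real_derivative value_at \<omega> (c1 t) (c2 t)) (at t)" "(c2 has_real_derivative value_at \<rho> (c1 t) (c2 t)) (at t)"
        using elim(1) unfolding c1_def c2_def by blast+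
      have "value_at (\<omega> * diff_x l1 + \<rho> * diff_y l1) (c1 t) (c2 t) = of_int (int N - 1) * f t * g t"
        unfolding D1 f_def g_def using elim by (simp only: value_simps ok_intros ok_basic value_basic)
      moreover have "value_at (\<omega> * diff_x l2 + \<rho> * diff_y l2) (c1 t) (c2 t) = - (g t)\<^sup>2"
        unfolding D2 g_def using elim by (simp only: value_simps ok_intros)
      ultimately show ?case
        using DERIV_value_at[OF elim(2) c] DERIV_value_at[OF elim(3) c] elim
        unfolding f_def[abs_def] g_def[abs_def]
        by (simp add: value_simps ok_intros ok_at_diff mult.commute)
    qed
    have le: "at_right 0 \<le> at (0::real)" by (rule at_le) simp
    have fl: "(f \<longlongrightarrow> \<alpha>) (at 0)" "(g \<longlongrightarrow> \<beta>) (at 0)"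
      unfolding f_def[abs_def] g_def[abs_def] \<alpha>_def \<beta>_def by (intro tendsto_value_at okl l')+
    have can: "\<forall>\<^sub>F t in at_right 0. t * \<beta> + 1 \<noteq> 0 \<and> f t = \<alpha> * (t * \<beta> + 1) powi (int N - 1) \<and> g t = \<beta> / (t * \<beta> + 1)"
    proof (rule canonical_curve)
      show "\<forall>\<^sub>F t in at_right 0. (f has_real_derivative of_int (int N - 1) * f t * g t) (at t)"
        "\<forall>\<^sub>F t in at_right 0. (g has_real_derivative - (g t)\<^sup>2) (at t)"
        using filter_leD[OF le der] by (auto elim: eventually_mono)
      show "(f \<longlongrightarrow> \<alpha>) (at_right 0)" "(g \<longlongrightarrow> \<beta>) (at_right 0)" by (rule tendsto_mono[OF le fl(1)], rule tendsto_mono[OF le fl(2)])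
      show "\<beta> \<noteq> 0" using \<beta> by (simp add: \<beta>_def)
    qed
    have "\<forall>\<^sub>F t in at_right 0. value_at A1 (a * t) (b * t) = value_at (fst B) (a * t) (b * t) \<and>
        value_at A2 (a * t) (b * t) = value_at (snd B) (a * t) (b * t)"
      using can filter_leD[OF le line] filter_leD[OF le curve] filter_leD[OF le okc(1)] filter_leD[OF le okc(2)]
    proof eventually_elim
      case (elim t)
      have t: "t \<noteq> 0" using elim(3) by blast
      have uv: "value_at u (a * t) (b * t) = c1 t * t" "value_at v (a * t) (b * t) = c2 t * t"
        using t by (simp_all add: c1_def c2_def)
      have "value_at l1 (c1 t * t) (c2 t * t) = t * f t" "value_at l2 (c1 t * t) (c2 t * t) = t * g t"
        using homogeneous_value[OF hom_l(1) elim(4) _ t] homogeneous_value[OF hom_l(2) elim(5) _ t] elim(2)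
        unfolding uv f_def g_def by simp_all
      moreover have "value_at l1 (a * t) (b * t) = t * \<alpha>" "value_at l2 (a * t) (b * t) = t * \<beta>"
        using homogeneous_value[OF hom_l(1) okl(1) _ t] homogeneous_value[OF hom_l(2) okl(2) _ t] elim(2)
        unfolding \<alpha>_def \<beta>_def by simp_all
      ultimately show ?case using elim(1,2) unfolding uv by (simp add: canon1_def canon2_def)
    qed
    then have "frequently (\<lambda>t. value_at A1 (a * t) (b * t) = value_at (fst B) (a * t) (b * t) \<and>
        value_at A2 (a * t) (b * t) = value_at (snd B) (a * t) (b * t)) (at_right 0)"
      by (rule eventually_frequently[OF trivial_limit_at_right_real])
    then show "frequently (\<lambda>t. value_at A1 (a * t) (b * t) = value_at (fst B) (a * t) (b * t) \<and>
        value_at A2 (a * t) (b * t) = value_at (snd B) (a * t) (b * t)) (at 0)"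
      using filter_leD[OF le] unfolding frequently_def by blast
  qed
  note freq = this
  have AB: "A1 = fst B" "A2 = snd B"
    by (rule generically_lineD, rule generically_mono[OF freq], erule frequently_elim1, erule conjunct1)
      (rule generically_lineD, rule generically_mono[OF freq], erule frequently_elim1, erule conjunct2)
  note Gm = generically_conj[OF generically_flow[OF lim m_l] GA[unfolded AB]]
  have "(u, v) = comp2 (m1, m2) B"
  proof -
    have cm: "subst_ok const2 m1 (fst B) (snd B)" "subst_ok const2 m2 (fst B) (snd B)"
      using composable_conjugate[of N] by (simp_all add: composable_def B_def)
    note Gc = generically_conj[OF Gm generically_conj[OF generically_comp[OF cm(1)] generically_comp[OF cm(2)]]]
    have "rsubst const2 m1 (fst B) (snd B) = u" "rsubst const2 m2 (fst B) (snd B) = v"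
      by (rule rat2_eqI, rule generically_mono[OF Gc], simp)+
    then show ?thesis by (simp add: comp2_def)
  qed
  then show ?thesis
    unfolding conjugate_to_canonical_def
    using one inv composable_canonical[of N] composable_conjugate[of N] unfolding B_def by blast
qed

text \<open>
  With \<open>(\<alpha>, \<beta>) = l(a, b)\<close>, homogeneity gives \<open>\<phi>(a z, b z) / z = m(e(z))\<close>, where \<open>e\<close> is the integral
  curve of \<open>((N - 1) x y, - y\<^sup>2)\<close> through \<open>(\<alpha>, \<beta>)\<close>. It remains to see that \<open>m \<circ> e\<close> has the tangent
  vector \<open>(\<omega>, \<rho>)\<close> at \<open>0\<close>. Instead of inverting the derivative of \<open>l\<close>, \<open>e\<close> is compared with the image
  under \<open>l\<close> of a straight line through \<open>(a, b)\<close>: both curves have the same tangent vector at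
  \<open>(\<alpha>, \<beta>)\<close>, and \<open>m\<close> maps the second one back to the line.
\<close>

lemma conjugate_limit:
  assumes phi: "(u, v) = comp2 (m1, m2) (comp2 (canonical_flow N) (l1, l2))"
    and D1: "\<omega> * diff_x l1 + \<rho> * diff_y l1 = const2 (real_of_int (int N - 1)) * l1 * l2"
    and D2: "\<omega> * diff_x l2 + \<rho> * diff_y l2 = - (l2\<^sup>2)"
  shows "generically (\<lambda>a b. (ray u a b \<longlongrightarrow> a) (at 0) \<and>
     (ray v a b \<longlongrightarrow> b) (at 0))" (is ?lim)
    and "has_vector_field (u, v) (\<omega>, \<rho>)"
proof -
  have tt: "generically (\<lambda>a b. True)" using generically_ok by (rule generically_mono) simp
  note C = conjugate_value[OF phi composable_canonical composable_conjugate tt, unfolded fst_conv snd_conv]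
  note ok = generically_conj[OF generically_ok[of \<omega>] generically_ok[of \<rho>]]
  note G = generically_conj[OF generically_line[OF C] generically_conj[OF m_l generically_conj[OF ok generically_nhds[OF m_l]]]]
  have main: "generically (\<lambda>a b.
     ((ray u a b \<longlongrightarrow> a) (at 0) \<and> (ray v a b \<longlongrightarrow> b) (at 0)) \<and>
     ((\<lambda>z. (ray u a b z - a) / z) \<longlongrightarrow> value_at \<omega> a b) (at 0) \<and>
     ((\<lambda>z. (ray v a b z - b) / z) \<longlongrightarrow> value_at \<rho> a b) (at 0))"
  proof (rule generically_mono[OF G], elim conjE)
    fix a b
    assume ok: "ok_at l1 a b" "ok_at l2 a b" "ok_at m1 (value_at l1 a b) (value_at l2 a b)" "ok_at m2 (value_at l1 a b) (value_at l2 a b)"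
      "ok_at \<omega> a b" "ok_at \<rho> a b"
      and inv: "value_at m1 (value_at l1 a b) (value_at l2 a b) = a" "value_at m2 (value_at l1 a b) (value_at l2 a b) = b"
      and nbh: "\<forall>x y (F :: real filter). (x \<longlongrightarrow> a) F \<longrightarrow> (y \<longlongrightarrow> b) F \<longrightarrow> eventually (\<lambda>z. right_inverse_at m1 m2 l1 l2 (x z) (y z)) F"
      and line: "\<forall>\<^sub>F z in at 0. conjugate_at N u v (a * z) (b * z) \<and> True"
    define \<alpha> \<beta> where "\<alpha> = value_at l1 a b" and "\<beta> = value_at l2 a b"
    define e1 e2 where "e1 z = \<alpha> * (z * \<beta> + 1) powi (int N - 1)" and "e2 z = \<beta> / (z * \<beta> + 1)" for z
    note okm = ok(3,4)[folded \<alpha>_def \<beta>_def]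
    have de1: "(e1 has_real_derivative of_int (int N - 1) * \<alpha> * \<beta>) (at 0)"
      unfolding e1_def[abs_def] by (rule derivative_eq_intros refl | simp)+
    have de2: "(e2 has_real_derivative - (\<beta>\<^sup>2)) (at 0)"
      unfolding e2_def[abs_def] by (rule derivative_eq_intros refl | simp add: power2_eq_square)+
    have e0: "e1 0 = \<alpha>" "e2 0 = \<beta>" by (simp_all add: e1_def e2_def)
    have te: "(e1 \<longlongrightarrow> \<alpha>) (at 0)" "(e2 \<longlongrightarrow> \<beta>) (at 0)"
      using DERIV_isCont[OF de1] DERIV_isCont[OF de2] by (simp_all add: isCont_def e0)
    have okme: "\<forall>\<^sub>F z in at 0. ok_at m1 (e1 z) (e2 z)" "\<forall>\<^sub>F z in at 0. ok_at m2 (e1 z) (e2 z)"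
      by (rule eventually_ok_at[OF okm(1) te], rule eventually_ok_at[OF okm(2) te])
    note nz = eventually_neq_0
    have ray: "\<forall>\<^sub>F z in at 0. ray u a b z = value_at m1 (e1 z) (e2 z) \<and>
        ray v a b z = value_at m2 (e1 z) (e2 z)"
      using line okme nz
    proof eventually_elim
      case (elim z)
      have l: "value_at l1 (a * z) (b * z) = z * \<alpha>" "value_at l2 (a * z) (b * z) = z * \<beta>"
        using homogeneous_value[OF hom_l(1) ok(1) _ elim(4)] homogeneous_value[OF hom_l(2) ok(2) _ elim(4)] elim(1)
        unfolding \<alpha>_def \<beta>_def by simp_all
      have c: "canon1 N (z * \<alpha>) (z * \<beta>) = e1 z * z" "canon2 (z * \<beta>) = e2 z * z"
        by (simp_all add: canon1_def canon2_def e1_def e2_def)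
      have "value_at m1 (e1 z * z) (e2 z * z) = z powi 1 * value_at m1 (e1 z) (e2 z)"
        "value_at m2 (e1 z * z) (e2 z * z) = z powi 1 * value_at m2 (e1 z) (e2 z)"
        by (rule homogeneous_value[OF hom_m(1) elim(2) _ elim(4)], use elim(1) in \<open>simp add: l c\<close>)
          (rule homogeneous_value[OF hom_m(2) elim(3) _ elim(4)], use elim(1) in \<open>simp add: l c\<close>)
      then show ?case using elim(1,4) by (simp add: l c)
    qed
    have tm: "((\<lambda>z. value_at m1 (e1 z) (e2 z)) \<longlongrightarrow> a) (at 0)" "((\<lambda>z. value_at m2 (e1 z) (e2 z)) \<longlongrightarrow> b) (at 0)"
      using tendsto_value_at[OF okm(1) te] tendsto_value_at[OF okm(2) te] inv unfolding \<alpha>_def \<beta>_def by simp_all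
    have ray': "\<forall>\<^sub>F z in at 0. value_at m1 (e1 z) (e2 z) = ray u a b z"
      "\<forall>\<^sub>F z in at 0. value_at m2 (e1 z) (e2 z) = ray v a b z"
      using ray by (auto elim: eventually_mono)
    have L: "(ray u a b \<longlongrightarrow> a) (at 0)" "(ray v a b \<longlongrightarrow> b) (at 0)"
      by (rule Lim_transform_eventually[OF tm(1) ray'(1)], rule Lim_transform_eventually[OF tm(2) ray'(2)])
    \<comment> \<open>the line through \<open>(a, b)\<close> in the direction of the vector field\<close>
    define x y where "x z = a + z * value_at \<omega> a b" and "y z = b + z * value_at \<rho> a b" for z
    have dx: "(x has_real_derivative value_at \<omega> a b) (at 0)" and dy: "(y has_real_derivative value_at \<rho> a b) (at 0)"
      unfolding x_def[abs_def] y_def[abs_def] by (rule derivative_eq_intros refl | simp)+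
    have x0: "x 0 = a" "y 0 = b" by (simp_all add: x_def y_def)
    have "(x \<longlongrightarrow> x 0) (nhds 0)" "(y \<longlongrightarrow> y 0) (nhds 0)"
      using DERIV_isCont[OF dx] DERIV_isCont[OF dy] by (simp_all add: isCont_def tendsto_nhds_iff)
    then have near: "\<forall>\<^sub>F z in nhds 0. value_at m1 (value_at l1 (x z) (y z)) (value_at l2 (x z) (y z)) = x z \<and>
         value_at m2 (value_at l1 (x z) (y z)) (value_at l2 (x z) (y z)) = y z"
      using nbh[rule_format, of x "nhds 0" y] unfolding x0 by (auto elim: eventually_mono)
    have "value_at (\<omega> * diff_x l1 + \<rho> * diff_y l1) a b = of_int (int N - 1) * \<alpha> * \<beta>"
      unfolding D1 \<alpha>_def \<beta>_def using ok by (simp only: value_simps ok_intros ok_basic value_basic)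
    then have dl1: "((\<lambda>z. value_at l1 (x z) (y z)) has_real_derivative of_int (int N - 1) * \<alpha> * \<beta>) (at 0)"
      using DERIV_value_at[of l1 x 0 y, OF _ dx dy] ok
      by (simp add: x0 value_simps ok_intros ok_at_diff mult.commute)
    have "value_at (\<omega> * diff_x l2 + \<rho> * diff_y l2) a b = - (\<beta>\<^sup>2)"
      unfolding D2 \<beta>_def using ok by (simp only: value_simps ok_intros)
    then have dl2: "((\<lambda>z. value_at l2 (x z) (y z)) has_real_derivative - (\<beta>\<^sup>2)) (at 0)"
      using DERIV_value_at[of l2 x 0 y, OF _ dx dy] ok
      by (simp add: x0 value_simps ok_intros ok_at_diff mult.commute)
    have D: "((\<lambda>z. value_at m (e1 z) (e2 z)) has_real_derivative w) (at 0)"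
      if m: "ok_at m \<alpha> \<beta>" and c: "\<forall>\<^sub>F z in nhds 0. value_at m (value_at l1 (x z) (y z)) (value_at l2 (x z) (y z)) = c z"
        and d: "(c has_real_derivative w) (at 0)" for m c w
    proof -
      have 1: "((\<lambda>z. value_at m (e1 z) (e2 z)) has_real_derivative
          value_at (diff_x m) \<alpha> \<beta> * (of_int (int N - 1) * \<alpha> * \<beta>) + value_at (diff_y m) \<alpha> \<beta> * (- (\<beta>\<^sup>2))) (at 0)"
        using DERIV_value_at[of m e1 0 e2, OF _ de1 de2] m by (simp add: e0)
      have "((\<lambda>z. value_at m (value_at l1 (x z) (y z)) (value_at l2 (x z) (y z))) has_real_derivative
          value_at (diff_x m) \<alpha> \<beta> * (of_int (int N - 1) * \<alpha> * \<beta>) + value_at (diff_y m) \<alpha> \<beta> * (- (\<beta>\<^sup>2))) (at 0)"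
        using DERIV_value_at[of m "\<lambda>z. value_at l1 (x z) (y z)" 0 "\<lambda>z. value_at l2 (x z) (y z)", OF _ dl1 dl2] m
        by (simp add: x0 \<alpha>_def \<beta>_def)
      with DERIV_cong_ev[OF refl c refl] have "(c has_real_derivative
          value_at (diff_x m) \<alpha> \<beta> * (of_int (int N - 1) * \<alpha> * \<beta>) + value_at (diff_y m) \<alpha> \<beta> * (- (\<beta>\<^sup>2))) (at 0)"
        by (rule iffD1)
      from DERIV_unique[OF this d] 1 show ?thesis by simp
    qed
    have n1: "\<forall>\<^sub>F z in nhds 0. value_at m1 (value_at l1 (x z) (y z)) (value_at l2 (x z) (y z)) = x z"
      and n2: "\<forall>\<^sub>F z in nhds 0. value_at m2 (value_at l1 (x z) (y z)) (value_at l2 (x z) (y z)) = y z"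
      using near by (auto elim: eventually_mono)
    have tw: "((\<lambda>z. (value_at m1 (e1 z) (e2 z) - a) / z) \<longlongrightarrow> value_at \<omega> a b) (at 0)"
      "((\<lambda>z. (value_at m2 (e1 z) (e2 z) - b) / z) \<longlongrightarrow> value_at \<rho> a b) (at 0)"
      using D[OF okm(1) n1 dx] D[OF okm(2) n2 dy] inv
      by (simp_all add: DERIV_def e0 \<alpha>_def \<beta>_def)
    have rw: "\<forall>\<^sub>F z in at 0. (value_at m1 (e1 z) (e2 z) - a) / z = (ray u a b z - a) / z"
      "\<forall>\<^sub>F z in at 0. (value_at m2 (e1 z) (e2 z) - b) / z = (ray v a b z - b) / z"
      using ray by (auto elim: eventually_mono)
    show "((ray u a b \<longlongrightarrow> a) (at 0) \<and> (ray v a b \<longlongrightarrow> b) (at 0)) \<and>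
     ((\<lambda>z. (ray u a b z - a) / z) \<longlongrightarrow> value_at \<omega> a b) (at 0) \<and>
     ((\<lambda>z. (ray v a b z - b) / z) \<longlongrightarrow> value_at \<rho> a b) (at 0)"
      by (intro conjI L Lim_transform_eventually[OF tw(1) rw(1)] Lim_transform_eventually[OF tw(2) rw(2)])
  qed
  show ?lim by (rule generically_mono[OF main]) blast
  show "has_vector_field (u, v) (\<omega>, \<rho>)"
    unfolding has_vector_field_def fst_conv snd_conv by (rule generically_mono[OF main]) blast
qed

text \<open>
  The translation equation is the one of the canonical flow, transported by \<open>l\<close> and \<open>m\<close>, whose
  \<open>1\<close>-homogeneity lets them commute with the scalings by \<open>(1 - z) / z\<close> and \<open>1 - z\<close>. The limit
  relations are those of \<open>conjugate_limit\<close>, and the flow is not the identity because its field is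
  not zero.
\<close>

lemma conjugate_is_flow:
  assumes D1: "\<omega> * diff_x l1 + \<rho> * diff_y l1 = const2 (real_of_int (int N - 1)) * l1 * l2"
    and D2: "\<omega> * diff_x l2 + \<rho> * diff_y l2 = - (l2\<^sup>2)"
    and nz: "\<not> (\<omega> = 0 \<and> \<rho> = 0)"
  shows "\<exists>\<phi>. rational_flow \<phi> \<and> has_vector_field \<phi> (\<omega>, \<rho>)"
proof -
  obtain u v where phi: "(u, v) = comp2 (m1, m2) (comp2 (canonical_flow N) (l1, l2))" by (metis surj_pair)
  note lim = conjugate_limit(1)[OF phi D1 D2] and vf = conjugate_limit(2)[OF phi D1 D2]
  have "(u, v) \<noteq> (X, Y)"
  proof
    assume uv: "(u, v) = (X, Y)"
    have "generically (\<lambda>a b. value_at \<omega> a b = 0 \<and> value_at \<rho> a b = 0)"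
    proof (rule generically_mono[OF vf[unfolded has_vector_field_def fst_conv snd_conv]], elim conjE)
      fix a b
      assume l: "((\<lambda>z. (ray u a b z - a) / z) \<longlongrightarrow> value_at \<omega> a b) (at 0)"
        "((\<lambda>z. (ray v a b z - b) / z) \<longlongrightarrow> value_at \<rho> a b) (at 0)"
      note n = eventually_neq_0
      have "\<forall>\<^sub>F z in at 0. (ray u a b z - a) / z = 0" "\<forall>\<^sub>F z in at 0. (ray v a b z - b) / z = 0"
        using n uv by (auto simp: value_basic elim!: eventually_mono)
      from tendsto_eventually[OF this(1)] tendsto_eventually[OF this(2)]
      show "value_at \<omega> a b = 0 \<and> value_at \<rho> a b = 0"
        using l tendsto_unique[OF at_neq_bot] by blast
    qed
    then have "\<omega> = 0" "\<rho> = 0" by (auto intro!: rat2_eqI simp: value_simps elim!: generically_mono)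
    with nz show False by blast
  qed
  define S where "S a b \<longleftrightarrow> conjugate_at N u v a b" for a b
  have tt: "generically (\<lambda>a b. True)" using generically_ok by (rule generically_mono) simp
  have S: "generically S"
    by (rule generically_mono[OF conjugate_value[OF phi composable_canonical composable_conjugate tt, unfolded fst_conv snd_conv]])
      (unfold S_def, blast)
  note z0 = eventually_neq_0
  have main: "generically (\<lambda>a b. \<forall>\<^sub>F z in at 0. z \<noteq> 0 \<and> S a b \<and> S (a * z) (b * z) \<and>
     S (jump u a b z) (jump v a b z) \<and>
     value_at u (jump u a b z) (jump v a b z) = (1 - z) * value_at u a b \<and>
     value_at v (jump u a b z) (jump v a b z) = (1 - z) * value_at v a b)"
  proof (rule generically_mono[OF generically_conj[OF generically_conj[OF S generically_line[OF S]] generically_conj[OF lim generically_nhds[OF S]]]], elim conjE)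
    fix a b
    assume Sab: "S a b" and line: "\<forall>\<^sub>F z in at 0. S (a * z) (b * z)"
      and l: "(ray u a b \<longlongrightarrow> a) (at 0)" "(ray v a b \<longlongrightarrow> b) (at 0)"
      and nbh: "\<forall>x y (F :: real filter). (x \<longlongrightarrow> a) F \<longrightarrow> (y \<longlongrightarrow> b) F \<longrightarrow> eventually (\<lambda>z. S (x z) (y z)) F"
    have "((\<lambda>z. ray u a b z * (1 - z)) \<longlongrightarrow> a * (1 - 0)) (at 0)"
      "((\<lambda>z. ray v a b z * (1 - z)) \<longlongrightarrow> b * (1 - 0)) (at 0)"
      by (intro tendsto_intros l)+
    then have near: "\<forall>\<^sub>F z in at 0. S (ray u a b z * (1 - z)) (ray v a b z * (1 - z))"
      using nbh[rule_format, of "\<lambda>z. ray u a b z * (1 - z)" "at 0" "\<lambda>z. ray v a b z * (1 - z)"] by simp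
    have z1: "\<forall>\<^sub>F z in at 0. 1 - z \<noteq> (0::real)"
      by (rule tendsto_imp_eventually_ne[of _ 1]) (auto intro!: tendsto_eq_intros)
    \<comment> \<open>the jump \<open>\<phi>(x z) (1 - z) / z\<close> tends to \<open>x\<close>, so it is generic for small \<open>z\<close>\<close>
    from z0 z1 line near show "\<forall>\<^sub>F z in at 0. z \<noteq> 0 \<and> S a b \<and> S (a * z) (b * z) \<and>
     S (jump u a b z) (jump v a b z) \<and>
     value_at u (jump u a b z) (jump v a b z) = (1 - z) * value_at u a b \<and>
     value_at v (jump u a b z) (jump v a b z) = (1 - z) * value_at v a b"
    proof eventually_elim
      case (elim z)
      define k where "k = (1 - z) / z"
      define p q where "p = value_at u (a * z) (b * z)" and "q = value_at v (a * z) (b * z)"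
      define \<alpha> \<beta> where "\<alpha> = value_at l1 a b" and "\<beta> = value_at l2 a b"
      have k: "k \<noteq> 0" using elim(1,2) by (simp add: k_def)
      have Spq: "S (p * k) (q * k)" using elim(4) by (simp add: p_def q_def k_def)
      have l: "value_at l1 (a * z) (b * z) = z * \<alpha>" "value_at l2 (a * z) (b * z) = z * \<beta>"
        using homogeneous_value[OF hom_l(1) _ _ elim(1), of a b] homogeneous_value[OF hom_l(2) _ _ elim(1), of a b] Sab elim(3)
        unfolding \<alpha>_def \<beta>_def S_def by simp_all
      have lp: "value_at l1 p q = canon1 N (z * \<alpha>) (z * \<beta>)" "value_at l2 p q = canon2 (z * \<beta>)"
        using elim(3) unfolding S_def p_def q_def l by blast+
      have okp: "ok_at l1 p q" "ok_at l2 p q" using elim(3) unfolding S_def p_def q_def by blast+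
      have lk: "value_at l1 (p * k) (q * k) = k * canon1 N (z * \<alpha>) (z * \<beta>)" "value_at l2 (p * k) (q * k) = k * canon2 (z * \<beta>)"
        using homogeneous_value[OF hom_l(1) okp(1) _ k] homogeneous_value[OF hom_l(2) okp(2) _ k] Spq
        unfolding lp S_def by simp_all
      have \<beta>: "\<beta> + 1 \<noteq> 0" "z * \<beta> + 1 \<noteq> 0" using Sab elim(3) l(2) unfolding S_def \<beta>_def by auto
      note ct = canonical_translation(1)[OF \<beta> elim(1), folded k_def]
        canonical_translation(2)[OF \<beta> elim(1), folded k_def, of N \<alpha>]
      have ms: "ok_at m1 (canon1 N \<alpha> \<beta> * (1 - z)) (canon2 \<beta> * (1 - z))" "ok_at m2 (canon1 N \<alpha> \<beta> * (1 - z)) (canon2 \<beta> * (1 - z))"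
        and uv: "value_at u (p * k) (q * k) = value_at m1 (canon1 N \<alpha> \<beta> * (1 - z)) (canon2 \<beta> * (1 - z))"
         "value_at v (p * k) (q * k) = value_at m2 (canon1 N \<alpha> \<beta> * (1 - z)) (canon2 \<beta> * (1 - z))"
        using Spq unfolding S_def lk ct by (simp_all add: mult.commute)
      have mo: "ok_at m1 (canon1 N \<alpha> \<beta>) (canon2 \<beta>)" "ok_at m2 (canon1 N \<alpha> \<beta>) (canon2 \<beta>)"
        and uv0: "value_at u a b = value_at m1 (canon1 N \<alpha> \<beta>) (canon2 \<beta>)" "value_at v a b = value_at m2 (canon1 N \<alpha> \<beta>) (canon2 \<beta>)"
        using Sab unfolding S_def \<alpha>_def \<beta>_def by blast+
      have "value_at u (p * k) (q * k) = (1 - z) * value_at u a b" "value_at v (p * k) (q * k) = (1 - z) * value_at v a b"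
        using homogeneous_value[OF hom_m(1) mo(1) ms(1) elim(2)] homogeneous_value[OF hom_m(2) mo(2) ms(2) elim(2)]
        unfolding uv uv0 by simp_all
      then show ?case using elim(1,3) Sab Spq unfolding p_def q_def k_def by blast
    qed
  qed
  define s t where "s = rsubst const3 u (X3 * Z3) (Y3 * Z3) * ((1 - Z3) / Z3)"
    and "t = rsubst const3 v (X3 * Z3) (Y3 * Z3) * ((1 - Z3) / Z3)"
  note R = ok3_intros ok3_basic val3_simps val3_basic
  have at: "ok3 s a b z \<and> ok3 t a b z \<and> val3 s a b z = jump u a b z \<and>
      val3 t a b z = jump v a b z"
    if "z \<noteq> 0" "S (a * z) (b * z)" for a b z
  proof -
    have "ok3 (rsubst const3 u (X3 * Z3) (Y3 * Z3)) a b z" "val3 (rsubst const3 u (X3 * Z3) (Y3 * Z3)) a b z = value_at u (a * z) (b * z)"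
      "ok3 (rsubst const3 v (X3 * Z3) (Y3 * Z3)) a b z" "val3 (rsubst const3 v (X3 * Z3) (Y3 * Z3)) a b z = value_at v (a * z) (b * z)"
      using ok3_rsubst(2,3)[of "X3 * Z3" a b z "Y3 * Z3"] that(2) unfolding S_def by (simp_all add: R)
    then show ?thesis using that(1) unfolding s_def t_def by (simp add: R)
  qed
  have at2: "ok3 ((1 - Z3) * rsubst const3 w X3 Y3) a b z \<and> val3 ((1 - Z3) * rsubst const3 w X3 Y3) a b z = (1 - z) * value_at w a b"
    if "ok_at w a b" for w a b z
    using ok3_rsubst(2,3)[of X3 a b z Y3 w] that by (simp add: R)
  obtain a b z where "z \<noteq> 0" "S (a * z) (b * z)"
    "S (jump u a b z) (jump v a b z)"
    using generically_ex[OF main] eventually_happens'[OF at_neq_bot] by blast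
  then have sok: "subst_ok const3 u s t" "subst_ok const3 v s t"
    using at[of z a b] ok3_rsubst(1)[of s a b z t] unfolding S_def by auto
  have eq3: "(1 - Z3) * rsubst const3 w X3 Y3 = rsubst const3 w s t"
    if w: "\<And>a b. S a b \<Longrightarrow> ok_at w a b"
      and PTE: "generically (\<lambda>a b. \<forall>\<^sub>F z in at 0. z \<noteq> 0 \<and> S a b \<and> S (a * z) (b * z) \<and> S (jump u a b z) (jump v a b z) \<and>
        value_at w (jump u a b z) (jump v a b z) = (1 - z) * value_at w a b)" for w
  proof (rule rat3_eqI, rule generically_mono[OF PTE], erule eventually_mono, elim conjE)
    fix a b z
    assume "z \<noteq> 0" "S (a * z) (b * z)" and S1: "S (jump u a b z) (jump v a b z)" and S0: "S a b"
      and eq: "value_at w (jump u a b z) (jump v a b z) = (1 - z) * value_at w a b"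
    note st = at[OF this(1,2)]
    have "ok_at w (val3 s a b z) (val3 t a b z)" using w[OF S1] st by simp
    with ok3_rsubst(2,3)[of s a b z t w] at2[OF w[OF S0]] st eq
    show "ok3 ((1 - Z3) * rsubst const3 w X3 Y3) a b z \<and> ok3 (rsubst const3 w s t) a b z \<and>
      val3 ((1 - Z3) * rsubst const3 w X3 Y3) a b z = val3 (rsubst const3 w s t) a b z"
      by simp
  qed
  have "(1 - Z3) * rsubst const3 u X3 Y3 = rsubst const3 u s t"
    by (rule eq3, simp add: S_def, rule generically_mono[OF main], erule eventually_mono, blast)
  moreover have "(1 - Z3) * rsubst const3 v X3 Y3 = rsubst const3 v s t"
    by (rule eq3, simp add: S_def, rule generically_mono[OF main], erule eventually_mono, blast)
  ultimately have "rational_flow (u, v)"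
    unfolding rational_flow_def Let_def fst_conv snd_conv s_def[symmetric] t_def[symmetric]
    using \<open>(u, v) \<noteq> (X, Y)\<close> sok lim by blast
  then show ?thesis using vf by blast
qed

end

section \<open>Transformations with a common homogeneous factor\<close>

lemma const2_add: "const2 (a + b) = const2 a + const2 b"
  and const2_mult: "const2 (a * b) = const2 a * const2 b"
  and const2_diff: "const2 (a - b) = const2 a - const2 b"
  and const2_uminus: "const2 (- a) = - const2 a"
  using unital_hom.hom_add[OF unital_hom_const2] unital_hom.hom_mult[OF unital_hom_const2]
    unital_hom.hom_diff[OF unital_hom_const2] unital_hom.hom_uminus[OF unital_hom_const2] by auto

lemma const2_eq_0_iff [simp]: "const2 a = 0 \<longleftrightarrow> a = 0"
  by (simp add: const2_def)

lemma XY_neq_0 [simp]: "X \<noteq> 0" "Y \<noteq> 0"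
  by (simp_all add: X_def Y_def)

definition linear_form :: "real \<Rightarrow> real \<Rightarrow> rat2" where
  "linear_form p q = const2 p * X + const2 q * Y"

lemma linear_form_at: "ok_at (linear_form p q) a b" "value_at (linear_form p q) a b = p * a + q * b"
  by (simp_all add: linear_form_def ok_intros ok_basic value_simps value_basic)

lemma linear_form_eq_0_iff: "linear_form p q = 0 \<longleftrightarrow> p = 0 \<and> q = 0"
proof
  assume *: "linear_form p q = 0"
  show "p = 0 \<and> q = 0"
    using linear_form_at(2)[of p q 1 0] linear_form_at(2)[of p q 0 1] unfolding * by (simp add: value_simps)
qed (simp add: linear_form_def const2_zero)

lemma homogeneous_linear_form: "homogeneous 1 (linear_form p q)"
  unfolding linear_form_def
  using homogeneous_mult[OF homogeneous_basic(3) homogeneous_basic(1)] homogeneous_mult[OF homogeneous_basic(3) homogeneous_basic(2)]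
  by (intro homogeneous_add) simp_all

text \<open>
  The map \<open>x \<mapsto> Q(x) x\<close> preserves each line through the origin, and on a generic such line only isolated
  points are bad for \<open>P\<close>. One point that avoids them makes the symbolic substitution legitimate.
\<close>

lemma generically_rescaled_ok:
  assumes Q: "homogeneous 0 Q" "Q \<noteq> 0"
  shows "generically (\<lambda>a b. ok_at P (a * value_at Q a b) (b * value_at Q a b))"
proof -
  note G = generically_conj[OF generically_conj[OF generically_ok[of Q] generically_value_neq_0[OF Q(2)]]
      generically_conj[OF generically_line[OF generically_ok[of P]] generically_line[OF generically_ok[of Q]]]]
  from generically_ex[OF G] obtain a b where ab: "ok_at Q a b" "value_at Q a b \<noteq> 0"
    and line: "\<forall>\<^sub>F z in at 0. ok_at P (a * z) (b * z)" "\<forall>\<^sub>F z in at 0. ok_at Q (a * z) (b * z)"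
    by blast
  note z0 = eventually_neq_0
  have "((\<lambda>z. z * value_at Q a b) \<longlongrightarrow> 0 * value_at Q a b) (at 0)" by (intro tendsto_intros)
  then have "filterlim (\<lambda>z. z * value_at Q a b) (at 0) (at 0)"
    unfolding filterlim_at using z0 ab(2) by (auto elim: eventually_mono)
  from eventually_compose_filterlim[OF line(1) this]
  have "\<forall>\<^sub>F z in at 0. ok_at P (a * (z * value_at Q a b)) (b * (z * value_at Q a b))" .
  with z0 line(2) have "\<forall>\<^sub>F z in at 0. z \<noteq> 0 \<and> ok_at Q (a * z) (b * z) \<and> ok_at P (a * (z * value_at Q a b)) (b * (z * value_at Q a b))"
    by eventually_elim blast
  from eventually_happens'[OF at_neq_bot this] obtain z where
    z: "z \<noteq> 0" "ok_at Q (a * z) (b * z)" "ok_at P (a * (z * value_at Q a b)) (b * (z * value_at Q a b))"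
    by blast
  have "value_at Q (a * z) (b * z) = value_at Q a b"
    using homogeneous_value[OF Q(1) ab(1) z(2,1)] by simp
  then have "subst_ok const2 P (X * Q) (Y * Q)"
    by (intro ok_value_rsubst(1)[of _ "a * z" "b * z"])
      (use z in \<open>simp_all add: ok_intros ok_basic value_simps value_basic mult.assoc\<close>)
  from generically_conj[OF generically_comp[OF this] generically_ok[of Q]] show ?thesis
  proof (rule generically_mono, elim conjE)
    fix a b assume *: "ok_at P (value_at (X * Q) a b) (value_at (Y * Q) a b)" "ok_at Q a b"
    have "value_at (X * Q) a b = a * value_at Q a b" "value_at (Y * Q) a b = b * value_at Q a b"
      using *(2) by (simp_all add: ok_basic value_simps value_basic)
    with *(1) show "ok_at P (a * value_at Q a b) (b * value_at Q a b)" by simp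
  qed
qed

text \<open>
  For an invertible linear map \<open>L\<close> with inverse \<open>M\<close>, the map \<open>P L\<close> has the inverse \<open>M / (P \<circ> M)\<close>: since
  \<open>P\<close> is \<open>0\<close>-homogeneous, it does not notice scalar factors. All linearising transformations below
  are of this form.
\<close>

lemma scaled_linear_birational:
  assumes det: "p1 * q2 - p2 * q1 \<noteq> 0" and P: "homogeneous 0 P" "P \<noteq> 0"
  shows "\<exists>m1 m2. birational_pair (linear_form p1 q1 * P) (linear_form p2 q2 * P) m1 m2"
proof -
  define \<delta> where "\<delta> = p1 * q2 - p2 * q1"
  have \<delta>: "\<delta> \<noteq> 0" using det by (simp add: \<delta>_def)
  define M1 M2 where "M1 = linear_form (q2 / \<delta>) (- q1 / \<delta>)" and "M2 = linear_form (- p2 / \<delta>) (p1 / \<delta>)"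
  have M: "ok_at M1 a b" "ok_at M2 a b" "value_at M1 a b = (q2 * a - q1 * b) / \<delta>" "value_at M2 a b = (p1 * b - p2 * a) / \<delta>" for a b
    by (simp_all add: M1_def M2_def linear_form_at diff_divide_distrib)
  have L_M: "p1 * ((q2 * a - q1 * b) / \<delta>) + q1 * ((p1 * b - p2 * a) / \<delta>) = a"
    "p2 * ((q2 * a - q1 * b) / \<delta>) + q2 * ((p1 * b - p2 * a) / \<delta>) = b" for a b
  proof -
    have "p1 * ((q2 * a - q1 * b) / \<delta>) + q1 * ((p1 * b - p2 * a) / \<delta>) = \<delta> * a / \<delta>"
      "p2 * ((q2 * a - q1 * b) / \<delta>) + q2 * ((p1 * b - p2 * a) / \<delta>) = \<delta> * b / \<delta>"
      unfolding times_divide_eq_right add_divide_distrib[symmetric] \<delta>_def by (simp_all add: algebra_simps)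
    then show "p1 * ((q2 * a - q1 * b) / \<delta>) + q1 * ((p1 * b - p2 * a) / \<delta>) = a"
      "p2 * ((q2 * a - q1 * b) / \<delta>) + q2 * ((p1 * b - p2 * a) / \<delta>) = b" using \<delta> by simp_all
  qed
  have M_L: "(q2 * (p1 * a + q1 * b) - q1 * (p2 * a + q2 * b)) / \<delta> = a"
    "(p1 * (p2 * a + q2 * b) - p2 * (p1 * a + q1 * b)) / \<delta> = b" for a b
  proof -
    have "q2 * (p1 * a + q1 * b) - q1 * (p2 * a + q2 * b) = \<delta> * a" "p1 * (p2 * a + q2 * b) - p2 * (p1 * a + q1 * b) = \<delta> * b"
      unfolding \<delta>_def by (simp_all add: algebra_simps)
    then show "(q2 * (p1 * a + q1 * b) - q1 * (p2 * a + q2 * b)) / \<delta> = a"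
    "(p1 * (p2 * a + q2 * b) - p2 * (p1 * a + q1 * b)) / \<delta> = b" using \<delta> by simp_all
  qed
  have pull_M: "generically (\<lambda>a b. R (value_at M1 a b) (value_at M2 a b))" if "generically R" for R
  proof -
    have "generically (\<lambda>a b. ok_at M1 a b \<and> ok_at M2 a b \<and> R (value_at M1 a b) (value_at M2 a b))"
    proof (rule generically_pullback[OF that])
      fix d :: "real poly poly" assume "d \<noteq> 0"
      then obtain a b where "psubst id d a b \<noteq> (0::real)" using exists_psubst_neq_0 by blast
      then show "\<exists>a b. ok_at M1 a b \<and> ok_at M2 a b \<and> psubst id d (value_at M1 a b) (value_at M2 a b) \<noteq> 0"
        by (intro exI[of _ "p1 * a + q1 * b"] exI[of _ "p2 * a + q2 * b"]) (simp add: M M_L)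
    qed
    then show ?thesis by (rule generically_mono) blast
  qed
  have okPM: "subst_ok const2 P M1 M2"
    using generically_ex[OF pull_M[OF generically_ok[of P]]] ok_value_rsubst(1)[OF M(1,2)] by blast
  define PM where "PM = rsubst const2 P M1 M2"
  have PM: "ok_at PM a b" "value_at PM a b = value_at P (value_at M1 a b) (value_at M2 a b)"
    if "ok_at P (value_at M1 a b) (value_at M2 a b)" for a b
    using ok_value_rsubst(2,3)[OF M(1,2) that] by (simp_all add: PM_def)
  define l1 l2 m1 m2 where "l1 = linear_form p1 q1 * P" and "l2 = linear_form p2 q2 * P"
    and "m1 = M1 / PM" and "m2 = M2 / PM"
  have l: "ok_at l1 a b" "ok_at l2 a b" "value_at l1 a b = (p1 * a + q1 * b) * value_at P a b" "value_at l2 a b = (p2 * a + q2 * b) * value_at P a b"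
    if "ok_at P a b" for a b
    using that by (simp_all add: l1_def l2_def linear_form_at ok_intros value_simps)
  have m: "ok_at m1 a b" "ok_at m2 a b" "value_at m1 a b = value_at M1 a b / value_at P (value_at M1 a b) (value_at M2 a b)"
    "value_at m2 a b = value_at M2 a b / value_at P (value_at M1 a b) (value_at M2 a b)"
    if "ok_at P (value_at M1 a b) (value_at M2 a b)" "value_at P (value_at M1 a b) (value_at M2 a b) \<noteq> 0" for a b
    using that PM[OF that(1)] M by (simp_all add: m1_def m2_def ok_intros value_simps)
  have iP: "homogeneous 0 (inverse P)" "inverse P \<noteq> 0" using homogeneous_inverse[OF P] P(2) by simp_all
  note basic = generically_conj[OF generically_ok[of P] generically_value_neq_0[OF P(2)]]
  have "generically (\<lambda>a b. ok_at P (value_at M1 a b) (value_at M2 a b) \<and> value_at P (value_at M1 a b) (value_at M2 a b) \<noteq> 0 \<and>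
     ok_at P (value_at m1 a b) (value_at m2 a b))"
  proof (rule generically_mono[OF pull_M[OF generically_conj[OF basic generically_rescaled_ok[OF iP, of P]]]], elim conjE)
    fix a b
    assume *: "ok_at P (value_at M1 a b) (value_at M2 a b)" "value_at P (value_at M1 a b) (value_at M2 a b) \<noteq> 0"
      "ok_at P (value_at M1 a b * value_at (inverse P) (value_at M1 a b) (value_at M2 a b))
          (value_at M2 a b * value_at (inverse P) (value_at M1 a b) (value_at M2 a b))"
    have "value_at (inverse P) (value_at M1 a b) (value_at M2 a b) = inverse (value_at P (value_at M1 a b) (value_at M2 a b))"
      by (rule value_simps(9)[OF *(1,2)])
    with *(3) have "ok_at P (value_at m1 a b) (value_at m2 a b)" unfolding m(3,4)[OF *(1,2)] divide_inverse by simp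
    then show "ok_at P (value_at M1 a b) (value_at M2 a b) \<and> value_at P (value_at M1 a b) (value_at M2 a b) \<noteq> 0 \<and>
     ok_at P (value_at m1 a b) (value_at m2 a b)" using * by blast
  qed
  then have lm: "generically (\<lambda>a b. right_inverse_at l1 l2 m1 m2 a b)"
  proof (rule generically_mono, elim conjE)
    fix a b
    define x y r where "x = value_at M1 a b" and "y = value_at M2 a b" and "r = value_at P (value_at M1 a b) (value_at M2 a b)"
    assume *: "ok_at P (value_at M1 a b) (value_at M2 a b)" "value_at P (value_at M1 a b) (value_at M2 a b) \<noteq> 0"
      "ok_at P (value_at m1 a b) (value_at m2 a b)"
    have r: "r \<noteq> 0" "value_at P x y = r" using *(2) by (simp_all add: r_def x_def y_def)
    have mv: "value_at m1 a b = x * (1 / r)" "value_at m2 a b = y * (1 / r)" using m[OF *(1,2)] by (simp_all add: x_def y_def r_def)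
    have "value_at P (x * (1 / r)) (y * (1 / r)) = value_at P x y"
      using homogeneous_value[OF P(1), of x y "1 / r"] * r unfolding mv x_def[symmetric] y_def[symmetric] by simp
    then have lv: "value_at l1 (x * (1 / r)) (y * (1 / r)) = p1 * x + q1 * y" "value_at l2 (x * (1 / r)) (y * (1 / r)) = p2 * x + q2 * y"
      using l(3,4)[OF *(3)] r unfolding mv by (simp_all add: add_divide_distrib[symmetric])
    have "p1 * x + q1 * y = a" "p2 * x + q2 * y = b" unfolding x_def y_def M L_M by simp_all
    then show "right_inverse_at l1 l2 m1 m2 a b"
      using m(1,2)[OF *(1,2)] l(1,2)[OF *(3)] lv unfolding mv by simp
  qed
  have ml: "generically (\<lambda>a b. right_inverse_at m1 m2 l1 l2 a b)"
  proof (rule generically_mono[OF generically_conj[OF basic generically_rescaled_ok[OF P, of P]]], elim conjE)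
    fix a b
    define r where "r = value_at P a b"
    assume *: "ok_at P a b" "value_at P a b \<noteq> 0" "ok_at P (a * value_at P a b) (b * value_at P a b)"
    have r: "r \<noteq> 0" using *(2) by (simp add: r_def)
    have lv: "value_at l1 a b = p1 * (a * r) + q1 * (b * r)" "value_at l2 a b = p2 * (a * r) + q2 * (b * r)"
      using l(3,4)[OF *(1)] by (simp_all add: r_def algebra_simps)
    have Mv: "value_at M1 (value_at l1 a b) (value_at l2 a b) = a * r" "value_at M2 (value_at l1 a b) (value_at l2 a b) = b * r"
      unfolding lv M M_L by simp_all
    have Pr: "value_at P (a * r) (b * r) = r"
      using homogeneous_value[OF P(1) *(1) *(3) *(2)] by (simp add: r_def)
    have okP: "ok_at P (value_at M1 (value_at l1 a b) (value_at l2 a b)) (value_at M2 (value_at l1 a b) (value_at l2 a b))"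
      using *(3) unfolding Mv r_def .
    have nz: "value_at P (value_at M1 (value_at l1 a b) (value_at l2 a b)) (value_at M2 (value_at l1 a b) (value_at l2 a b)) \<noteq> 0"
      unfolding Mv Pr by (rule r)
    show "right_inverse_at m1 m2 l1 l2 a b"
      using m[OF okP nz] l(1,2)[OF *(1)] r unfolding Mv Pr by simp
  qed
  have inv: "composable (f1, f2) (g1, g2) \<and> comp2 (f1, f2) (g1, g2) = (X, Y)"
    if "generically (\<lambda>a b. right_inverse_at f1 f2 g1 g2 a b)" for f1 f2 g1 g2
  proof -
    have "subst_ok const2 f1 g1 g2" "subst_ok const2 f2 g1 g2"
      using generically_ex[OF that] ok_value_rsubst(1) by blast+
    moreover have "rsubst const2 f1 g1 g2 = X" "rsubst const2 f2 g1 g2 = Y"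
      by (rule rat2_eqI, rule generically_mono[OF that], simp add: ok_value_rsubst(3) value_basic)+
    ultimately show ?thesis by (simp add: composable_def comp2_def)
  qed
  have "birational_pair l1 l2 m1 m2"
  proof
    show "homogeneous 1 l1" "homogeneous 1 l2"
      using homogeneous_mult[OF homogeneous_linear_form P(1)] by (simp_all add: l1_def l2_def)
    show "birational_inverse (l1, l2) (m1, m2)"
      using inv[OF lm] inv[OF ml] by (simp add: birational_inverse_def)
  qed
  then show ?thesis unfolding l1_def l2_def by blast
qed

section \<open>Linearising transformations\<close>

definition along :: "rat2 \<Rightarrow> rat2 \<Rightarrow> rat2 \<Rightarrow> rat2" where
  "along \<omega> \<rho> f = \<omega> * diff_x f + \<rho> * diff_y f"

lemma along_mult: "along \<omega> \<rho> (f * g) = along \<omega> \<rho> f * g + f * along \<omega> \<rho> g"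
  by (simp add: along_def dx.D_mult dy.D_mult algebra_simps)

lemma along_divide: "g \<noteq> 0 \<Longrightarrow> along \<omega> \<rho> (f / g) = (along \<omega> \<rho> f * g - f * along \<omega> \<rho> g) / g\<^sup>2"
  by (simp add: along_def dx.D_divide dy.D_divide add_divide_distrib[symmetric] algebra_simps)

lemma along_uminus: "along \<omega> \<rho> (- f) = - along \<omega> \<rho> f"
  by (simp add: along_def dx.D_uminus dy.D_uminus)

lemma along_const: "along \<omega> \<rho> (const2 c) = 0"
  by (simp add: along_def)

lemma along_linear_form: "along \<omega> \<rho> (linear_form p q) = const2 p * \<omega> + const2 q * \<rho>"
  by (simp add: along_def linear_form_def dx.D_add dy.D_add dx.D_mult dy.D_mult algebra_simps)

text \<open>
  This function vanishes where the field is radial. The next two are its partial derivatives with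
  the coefficients \<open>x\<close> and \<open>y\<close> held constant; they occur in the conditions on the field.
\<close>

abbreviation contact :: "rat2 \<Rightarrow> rat2 \<Rightarrow> rat2" where
  "contact \<omega> \<rho> \<equiv> Y * \<omega> - X * \<rho>"

abbreviation contact_x :: "rat2 \<Rightarrow> rat2 \<Rightarrow> rat2" where
  "contact_x \<omega> \<rho> \<equiv> Y * diff_x \<omega> - X * diff_x \<rho>"

abbreviation contact_y :: "rat2 \<Rightarrow> rat2 \<Rightarrow> rat2" where
  "contact_y \<omega> \<rho> \<equiv> Y * diff_y \<omega> - X * diff_y \<rho>"

text \<open>
  The field is radial, \<open>(\<omega>, \<rho>) = J (x, y)\<close> with \<open>J\<close> homogeneous of degree one. Euler's identity makes
  the derivative of \<open>J\<close> along the field equal to \<open>J\<^sup>2\<close>, while \<open>x / y\<close> is constant along the field. Hence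
  \<open>l = - J (x / y, 1)\<close> has the required derivatives.
\<close>

lemma linearisation_level_0:
  assumes hom: "homogeneous 2 \<rho>" and nz: "\<not> (\<omega> = 0 \<and> \<rho> = 0)" and G: "contact \<omega> \<rho> = 0"
  shows "\<exists>l1 l2 m1 m2. birational_pair l1 l2 m1 m2 \<and>
     along \<omega> \<rho> l1 = const2 (real_of_int (int 0 - 1)) * l1 * l2 \<and> along \<omega> \<rho> l2 = - (l2\<^sup>2)"
proof -
  have \<rho>0: "\<rho> \<noteq> 0"
  proof
    assume "\<rho> = 0"
    with G nz show False by simp
  qed
  define J P where "J = \<rho> / Y" and "P = - (J / Y)"
  have J: "homogeneous 1 J" "J \<noteq> 0" using homogeneous_divide[OF hom homogeneous_basic(2)] \<rho>0 by (simp_all add: J_def)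
  have P: "homogeneous 0 P" "P \<noteq> 0"
    using homogeneous_uminus[OF homogeneous_divide[OF J(1) homogeneous_basic(2)]] J(2) by (simp_all add: P_def)
  have \<rho>: "\<rho> = Y * J" and \<omega>: "\<omega> = X * J" using G by (simp_all add: J_def field_simps)
  obtain m1 m2 where b: "birational_pair (linear_form 1 0 * P) (linear_form 0 1 * P) m1 m2"
    using scaled_linear_birational[of 1 1 0 0 P] P by auto
  have lX: "linear_form 1 0 = X" "linear_form 0 1 = Y" by (simp_all add: linear_form_def const2_zero const2_one)
  have YP: "Y * P = - J" and XP: "X * P = - J * (X / Y)" by (simp_all add: P_def)
  have aJ: "along \<omega> \<rho> J = J\<^sup>2"
  proof -
    have "along \<omega> \<rho> J = J * (X * diff_x J + Y * diff_y J)" unfolding along_def \<omega> \<rho> by (simp add: algebra_simps)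
    also have "\<dots> = J\<^sup>2" unfolding Euler_identity[OF J(1)] by (simp add: const2_one power2_eq_square)
    finally show ?thesis .
  qed
  have aX: "along \<omega> \<rho> X = \<omega>" "along \<omega> \<rho> Y = \<rho>" by (simp_all add: along_def)
  have "along \<omega> \<rho> (X / Y) = 0" by (simp add: along_divide aX) (simp add: \<omega> \<rho> algebra_simps)
  then have "along \<omega> \<rho> (X * P) = - (J\<^sup>2) * (X / Y)" unfolding XP along_mult by (simp add: along_uminus aJ)
  moreover have "\<dots> = const2 (real_of_int (int 0 - 1)) * (X * P) * (Y * P)"
    unfolding YP XP by (simp add: const2_uminus const2_one power2_eq_square)
  moreover have "along \<omega> \<rho> (Y * P) = - ((Y * P)\<^sup>2)" unfolding YP along_uminus aJ by simp
  ultimately show ?thesis using b unfolding lX by metis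
qed

lemma contact_Euler:
  assumes "homogeneous 2 \<omega>" "homogeneous 2 \<rho>"
  shows "X * (contact_x \<omega> \<rho>) + Y * (contact_y \<omega> \<rho>) = 2 * (contact \<omega> \<rho>)"
proof -
  have "X * (contact_x \<omega> \<rho>) + Y * (contact_y \<omega> \<rho>) =
      Y * (X * diff_x \<omega> + Y * diff_y \<omega>) - X * (X * diff_x \<rho> + Y * diff_y \<rho>)"
    by (simp add: algebra_simps)
  also have "\<dots> = 2 * (contact \<omega> \<rho>)" unfolding Euler_identity[OF assms(1)] Euler_identity[OF assms(2)]
    by (simp add: const2_numeral algebra_simps)
  finally show ?thesis .
qed

lemma along_contact:
  "along \<omega> \<rho> (contact \<omega> \<rho>) =
     \<omega> * (contact_x \<omega> \<rho>) + \<rho> * (contact_y \<omega> \<rho>)"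
  by (simp add: along_def dx.D_diff dx.D_mult dy.D_diff dy.D_mult algebra_simps)

text \<open>
  The ratio condition with denominators cleared, which admits vanishing numerators and denominators
  and thereby includes the condition for level one as the case \<open>N = 1\<close>.
\<close>

definition projective_ratio :: "rat2 \<Rightarrow> rat2 \<Rightarrow> nat \<Rightarrow> bool" where
  "projective_ratio \<omega> \<rho> N \<longleftrightarrow> (\<exists>a b c d. a \<noteq> d \<and> (a + d)\<^sup>2 - 4 * b * c = (real N)\<^sup>2 * (a - d)\<^sup>2 \<and>
     linear_form c d * (contact_y \<omega> \<rho>) = linear_form a b * (contact_x \<omega> \<rho>))"

text \<open>
  The form \<open>c x\<^sup>2 + (a + d) x y + b y\<^sup>2\<close> with discriminant \<open>\<delta>\<^sup>2\<close> is a product of two real linear forms,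
  ordered such that their determinant is \<open>\<delta>\<close> rather than \<open>- \<delta>\<close>.
\<close>

lemma binary_quadratic_split:
  fixes a b c d \<delta> :: real
  assumes "(a + d)\<^sup>2 - 4 * b * c = \<delta>\<^sup>2" "\<delta> \<noteq> 0"
  obtains p1 q1 p2 q2 where "p1 * p2 = c" "p1 * q2 + q1 * p2 = a + d" "q1 * q2 = b" "p1 * q2 - p2 * q1 = \<delta>"
proof -
  define s r where "s = (a + d + \<delta>) / 2" and "r = (a + d - \<delta>) / 2"
  have sr: "s * r = b * c" "s + r = a + d" "s - r = \<delta>"
    using assms(1) by (simp_all add: s_def r_def power2_eq_square field_simps)
  \<comment> \<open>\<open>s\<close> and \<open>r\<close> are the roots of \<open>T\<^sup>2 - (a + d) T + b c\<close>; one of them vanishes if \<open>c\<close> does\<close>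
  consider "c \<noteq> 0" | "c = 0" "s \<noteq> 0" "r = 0" | "c = 0" "s = 0" "r \<noteq> 0" using sr assms(2) by fastforce
  then show ?thesis
  proof cases
    case 1
    then show ?thesis using sr by (intro that[of 1 c s "r / c"]) (simp_all add: field_simps)
  next
    case 2
    then show ?thesis using sr by (intro that[of 1 0 s "b / s"]) simp_all
  next
    case 3
    then show ?thesis using sr by (intro that[of 0 1 "b / r" r]) simp_all
  qed
qed

text \<open>
  Write \<open>G\<close>, \<open>A\<close>, \<open>B\<close> for the three functions above and \<open>Q = x (c x + d y) + y (a x + b y)\<close>. Euler's
  identity \<open>x A + y B = 2 G\<close> and the ratio of \<open>A\<close> and \<open>B\<close> yield \<open>A Q = 2 G (c x + d y)\<close> and
  \<open>B Q = 2 G (a x + b y)\<close>, which determines the derivative of \<open>G / Q\<close> along the field: it is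
  \<open>- (a - d) (G / Q)\<^sup>2\<close>. Hence \<open>l\<^sub>2 = (a - d) G / Q\<close>. For \<open>Q = L\<^sub>1 L\<^sub>2\<close> the derivative of \<open>L\<^sub>1 / L\<^sub>2\<close> is the
  determinant times \<open>G / L\<^sub>2\<^sup>2\<close>, that is \<open>N l\<^sub>2 L\<^sub>1 / L\<^sub>2\<close>, and \<open>l\<^sub>1 = l\<^sub>2 L\<^sub>1 / L\<^sub>2\<close> completes the
  transformation.
\<close>

lemma linearisation_positive_level:
  assumes hom: "homogeneous 2 \<omega>" "homogeneous 2 \<rho>" and nz: "\<not> (\<omega> = 0 \<and> \<rho> = 0)" and N: "N > 0"
    and ratio: "projective_ratio \<omega> \<rho> N"
  shows "\<exists>l1 l2 m1 m2. birational_pair l1 l2 m1 m2 \<and>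
     along \<omega> \<rho> l1 = const2 (real_of_int (int N - 1)) * l1 * l2 \<and> along \<omega> \<rho> l2 = - (l2\<^sup>2)"
proof -
  obtain a b c d where ad: "a \<noteq> d" and disc: "(a + d)\<^sup>2 - 4 * b * c = (real N)\<^sup>2 * (a - d)\<^sup>2"
    and rat: "linear_form c d * (contact_y \<omega> \<rho>) = linear_form a b * (contact_x \<omega> \<rho>)"
    using ratio unfolding projective_ratio_def by blast
  define \<delta> where "\<delta> = real N * (a - d)"
  have \<delta>: "\<delta> \<noteq> 0" "(a + d)\<^sup>2 - 4 * b * c = \<delta>\<^sup>2" using ad N disc by (simp_all add: \<delta>_def power_mult_distrib)
  obtain p1 q1 p2 q2 where pq: "p1 * p2 = c" "p1 * q2 + q1 * p2 = a + d" "q1 * q2 = b" "p1 * q2 - p2 * q1 = \<delta>"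
    using binary_quadratic_split[OF \<delta>(2,1)] by metis
  define L1 L2 Q where "L1 = linear_form p1 q1" and "L2 = linear_form p2 q2" and "Q = L1 * L2"
  define A B G where "A = contact_x \<omega> \<rho>" and "B = contact_y \<omega> \<rho>" and "G = contact \<omega> \<rho>"
  have L0: "L1 \<noteq> 0" "L2 \<noteq> 0" using pq(4) \<delta>(1) by (auto simp: L1_def L2_def linear_form_eq_0_iff)
  have Q0: "Q \<noteq> 0" using L0 by (simp add: Q_def)
  have Q: "Q = X * linear_form c d + Y * linear_form a b"
  proof -
    have "const2 p1 * const2 p2 = const2 c" "const2 q1 * const2 q2 = const2 b"
      "const2 p1 * const2 q2 + const2 q1 * const2 p2 = const2 a + const2 d"
      using pq by (simp_all flip: const2_mult const2_add)
    moreover have "Q = (const2 p1 * const2 p2) * X\<^sup>2 + (const2 p1 * const2 q2 + const2 q1 * const2 p2) * X * Y + (const2 q1 * const2 q2) * Y\<^sup>2"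
      unfolding Q_def L1_def L2_def linear_form_def by (simp add: algebra_simps power2_eq_square)
    ultimately show ?thesis unfolding linear_form_def by (simp add: algebra_simps power2_eq_square)
  qed
  have AB: "X * A + Y * B = 2 * G" using contact_Euler[OF hom] unfolding A_def B_def G_def .
  have AQ: "A * Q = 2 * G * linear_form c d" and BQ: "B * Q = 2 * G * linear_form a b"
    using AB rat[folded A_def B_def] unfolding Q by algebra+
  have Gx: "diff_x G = A - \<rho>" and Gy: "diff_y G = B + \<omega>"
    by (simp_all add: G_def A_def B_def dx.D_diff dx.D_mult dy.D_diff dy.D_mult algebra_simps)
  have G0: "G \<noteq> 0"
  proof
    assume "G = 0"
    then have "A = 0" "B = 0" using AQ BQ Q0 by simp_all
    moreover have "diff_x G = 0" "diff_y G = 0" using \<open>G = 0\<close> dx.D_zero dy.D_zero by simp_all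
    ultimately show False using Gx Gy nz by simp
  qed
  have hG: "homogeneous 3 G" unfolding G_def
    using homogeneous_mult[OF homogeneous_basic(2) hom(1)] homogeneous_mult[OF homogeneous_basic(1) hom(2)]
    by (intro homogeneous_diff) simp_all
  have hQ: "homogeneous 2 Q"
    using homogeneous_mult[OF homogeneous_linear_form homogeneous_linear_form] by (simp add: Q_def L1_def L2_def)
  define l2 P where "l2 = const2 (a - d) * G / Q" and "P = l2 / L2"
  have l20: "l2 \<noteq> 0" using ad G0 Q0 by (simp add: l2_def)
  have "homogeneous 1 l2"
    using homogeneous_divide[OF homogeneous_mult[OF homogeneous_basic(3) hG] hQ Q0] by (simp add: l2_def)
  then have P: "homogeneous 0 P" "P \<noteq> 0"
    using homogeneous_divide[of 1 l2 1 L2] homogeneous_linear_form L0 l20 by (simp_all add: P_def L2_def)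
  obtain m1 m2 where b: "birational_pair (L1 * P) (L2 * P) m1 m2"
    using scaled_linear_birational[of p1 q2 p2 q1 P] P pq \<delta> unfolding L1_def L2_def by auto
  have P2: "L2 * P = l2" and P1: "L1 * P = l2 * (L1 / L2)" using L0 by (simp_all add: P_def)
  have aG: "along \<omega> \<rho> G = \<omega> * A + \<rho> * B" unfolding along_def Gx Gy by (simp add: algebra_simps)
  have aX: "along \<omega> \<rho> X = \<omega>" "along \<omega> \<rho> Y = \<rho>" by (simp_all add: along_def)
  have aQ: "along \<omega> \<rho> Q = \<omega> * linear_form c d + X * (const2 c * \<omega> + const2 d * \<rho>) + \<rho> * linear_form a b + Y * (const2 a * \<omega> + const2 b * \<rho>)"
    unfolding Q by (simp add: along_def dx.D_add dy.D_add dx.D_mult dy.D_mult linear_form_def algebra_simps)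
  have num: "along \<omega> \<rho> G * Q - G * along \<omega> \<rho> Q = - (const2 (a - d) * G\<^sup>2)"
  proof -
    have "along \<omega> \<rho> G * Q = 2 * G * (\<omega> * linear_form c d + \<rho> * linear_form a b)"
    proof -
      have "along \<omega> \<rho> G * Q = \<omega> * (A * Q) + \<rho> * (B * Q)" unfolding aG by (simp add: algebra_simps)
      then show ?thesis unfolding AQ BQ by (simp add: algebra_simps)
    qed
    then show ?thesis unfolding aQ linear_form_def const2_diff G_def by algebra
  qed
  have al2: "along \<omega> \<rho> l2 = - (l2\<^sup>2)"
  proof -
    have "along \<omega> \<rho> l2 = const2 (a - d) * ((along \<omega> \<rho> G * Q - G * along \<omega> \<rho> Q) / Q\<^sup>2)"
      unfolding l2_def times_divide_eq_right[symmetric] along_mult along_const along_divide[OF Q0] by simp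
    then show ?thesis unfolding num by (simp add: l2_def power_divide power_mult_distrib power2_eq_square)
  qed
  have akappa: "along \<omega> \<rho> (L1 / L2) = const2 (real N) * l2 * (L1 / L2)"
  proof -
    have "const2 p1 * const2 q2 - const2 p2 * const2 q1 = const2 (real N) * const2 (a - d)"
      using pq(4) unfolding \<delta>_def by (simp flip: const2_mult const2_diff)
    then have "along \<omega> \<rho> L1 * L2 - L1 * along \<omega> \<rho> L2 = const2 (real N) * const2 (a - d) * G"
      unfolding L1_def L2_def along_linear_form unfolding linear_form_def G_def by algebra
    then have "along \<omega> \<rho> (L1 / L2) = const2 (real N) * const2 (a - d) * G / L2\<^sup>2"
      unfolding along_divide[OF L0(2)] by simp
    also have "\<dots> = const2 (real N) * l2 * (L1 / L2)"
      using L0 by (simp add: l2_def Q_def power2_eq_square)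
    finally show ?thesis .
  qed
  have "along \<omega> \<rho> (L1 * P) = const2 (real_of_int (int N - 1)) * (L1 * P) * (L2 * P)"
  proof -
    have alg: "- (s\<^sup>2) * K + s * (n * s * K) = (n - 1) * (s * K) * s" for s n K :: rat2
      by (simp add: power2_eq_square algebra_simps)
    have n: "const2 (real_of_int (int N - 1)) = const2 (real N) - 1" by (simp add: const2_diff const2_one)
    show ?thesis unfolding P1 P2 along_mult al2 akappa n by (rule alg)
  qed
  moreover have "along \<omega> \<rho> (L2 * P) = - ((L2 * P)\<^sup>2)" unfolding P2 by (rule al2)
  ultimately show ?thesis using b by blast
qed

section \<open>Rational solutions of a second order equation on the projective line\<close>

text \<open>
  For \<open>w = A / B\<close> the first two derivatives are \<open>w' = wronskian A B / B\<^sup>2\<close> and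
  \<open>w'' = accel A B / B\<^sup>3\<close>. The equation \<open>w'' = (S\<^sub>1(w) / S\<^sub>2(w)) w'\<^sup>2\<close> thus reads
  \<open>accel A B * B * S\<^sub>2(A / B) = S\<^sub>1(A / B) * (wronskian A B)\<^sup>2\<close>.
\<close>

abbreviation wronskian :: "real poly \<Rightarrow> real poly \<Rightarrow> real poly" where
  "wronskian A B \<equiv> pderiv A * B - A * pderiv B"

abbreviation accel :: "real poly \<Rightarrow> real poly \<Rightarrow> real poly" where
  "accel A B \<equiv> pderiv (wronskian A B) * B - 2 * wronskian A B * pderiv B"

text \<open>
  \<open>B\<^sup>n p(A / B)\<close>, a polynomial for \<open>n \<ge> degree p\<close>.
\<close>

definition hom_subst :: "nat \<Rightarrow> real poly \<Rightarrow> real poly \<Rightarrow> real poly \<Rightarrow> real poly" where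
  "hom_subst n p A B = (\<Sum>k\<le>n. smult (coeff p k) (A ^ k * B ^ (n - k)))"

lemma poly_hom_subst:
  assumes "degree p \<le> n" "poly B t \<noteq> 0"
  shows "poly (hom_subst n p A B) t = poly B t ^ n * poly p (poly A t / poly B t)"
proof -
  have "poly p x = (\<Sum>k\<le>n. coeff p k * x ^ k)" for x
    unfolding poly_altdef by (rule sum.mono_neutral_left) (use assms(1) in \<open>auto simp: coeff_eq_0\<close>)
  moreover have "poly A t ^ k * poly B t ^ (n - k) = poly B t ^ n * (poly A t / poly B t) ^ k" if "k \<le> n" for k
    using that assms(2) by (simp add: power_divide power_diff)
  ultimately show ?thesis
    unfolding hom_subst_def by (simp add: poly_sum sum_distrib_left mult.left_commute mult.assoc)
qed

lemma hom_subst_mod: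
  "B dvd hom_subst n p A B - smult (coeff p n) (A ^ n)"
proof -
  have "hom_subst n p A B - smult (coeff p n) (A ^ n) = (\<Sum>k<n. smult (coeff p k) (A ^ k * B ^ (n - k)))"
    unfolding hom_subst_def lessThan_Suc_atMost[symmetric] by simp
  moreover have "B dvd (\<Sum>k<n. smult (coeff p k) (A ^ k * B ^ (n - k)))"
    by (intro dvd_sum dvd_smult dvd_mult dvd_power) auto
  ultimately show ?thesis by simp
qed

text \<open>
  The coefficient \<open>c\<close> may vanish, so that \<open>s\<close> is only a bound for the degree. This makes leading terms
  of sums and products computable without distinguishing cases of cancellation.
\<close>

definition leading :: "real poly \<Rightarrow> nat \<Rightarrow> real \<Rightarrow> bool" where
  "leading p s c \<longleftrightarrow> degree p \<le> s \<and> coeff p s = c"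

lemma leading_diff: "leading p s c \<Longrightarrow> leading q s d \<Longrightarrow> leading (p - q) s (c - d)"
  by (auto simp: leading_def intro: degree_diff_le)

lemma leading_smult: "leading p s c \<Longrightarrow> leading (smult x p) s (x * c)"
  by (auto simp: leading_def intro: order_trans[OF degree_smult_le])

lemma leading_mult: 
  assumes "leading p s c" "leading q t d"
  shows "leading (p * q) (s + t) (c * d)"
proof -
  have "coeff (p * q) (s + t) = (\<Sum>i\<le>s + t. coeff p i * coeff q (s + t - i))" by (rule coeff_mult)
  also have "\<dots> = (\<Sum>i\<in>{s}. coeff p i * coeff q (s + t - i))"
  proof (rule sum.mono_neutral_right)
    show "\<forall>i\<in>{..s + t} - {s}. coeff p i * coeff q (s + t - i) = 0"
    proof
      fix i assume "i \<in> {..s + t} - {s}"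
      then have "s < i \<or> t < s + t - i" by auto
      then show "coeff p i * coeff q (s + t - i) = 0"
        using assms by (auto simp: leading_def coeff_eq_0)
    qed
  qed auto
  finally show ?thesis using assms degree_mult_le[of p q] by (auto simp: leading_def)
qed

lemma leading_power: "leading p s c \<Longrightarrow> leading (p ^ n) (n * s) (c ^ n)"
proof (induction n)
  case 0
  then show ?case by (simp add: leading_def)
next
  case (Suc n)
  then show ?case using leading_mult[of p s c "p ^ n" "n * s" "c ^ n"] by simp
qed

lemma leading_theta: "leading p s c \<Longrightarrow> leading (pCons 0 (pderiv p)) s (of_nat s * c)"
proof -
  assume p: "leading p s c"
  have "coeff (pCons 0 (pderiv p)) s = of_nat s * c"
    using p by (cases s) (auto simp: leading_def coeff_pderiv)
  moreover have "degree (pCons 0 (pderiv p)) \<le> s"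
    using p by (cases s) (auto simp: leading_def degree_pderiv pderiv_eq_0_iff intro!: degree_le simp: coeff_pCons coeff_pderiv coeff_eq_0 split: nat.split)
  ultimately show ?thesis by (simp add: leading_def)
qed

lemma leading_hom_subst:
  assumes "leading A \<alpha> a" "leading B \<beta> b" "\<beta> < \<alpha>"
  shows "leading (hom_subst n p A B) (n * \<alpha>) (coeff p n * a ^ n)"
proof -
  have "leading (smult (coeff p k) (A ^ k * B ^ (n - k))) (n * \<alpha>) (if k = n then coeff p n * a ^ n else 0)" if "k \<le> n" for k
  proof (cases "k = n")
    case True
    then show ?thesis using leading_smult[OF leading_power[OF assms(1), of n], where x = "coeff p n"] by simp
  next
    case False
    have "degree (A ^ k * B ^ (n - k)) \<le> k * \<alpha> + (n - k) * \<beta>"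
      using leading_mult[OF leading_power[OF assms(1)] leading_power[OF assms(2)], of k "n - k"] by (simp add: leading_def)
    moreover have "k * \<alpha> + (n - k) * \<beta> < k * \<alpha> + (n - k) * \<alpha>" using False that assms(3) by simp
    moreover have "k * \<alpha> + (n - k) * \<alpha> = n * \<alpha>" using that by (simp flip: distrib_right)
    ultimately have "degree (A ^ k * B ^ (n - k)) < n * \<alpha>" by linarith
    then have "leading (A ^ k * B ^ (n - k)) (n * \<alpha>) 0" by (simp add: leading_def coeff_eq_0)
    from leading_smult[OF this, where x = "coeff p k"] False show ?thesis by simp
  qed
  then have "degree (hom_subst n p A B) \<le> n * \<alpha>" "coeff (hom_subst n p A B) (n * \<alpha>) = (\<Sum>k\<le>n. if k = n then coeff p n * a ^ n else 0)"
    unfolding hom_subst_def coeff_sum by (auto simp: leading_def intro!: degree_sum_le sum.cong)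
  then show ?thesis by (simp add: leading_def)
qed

text \<open>
  If \<open>w\<close> behaves like \<open>t\<^sup>e\<close> at infinity, then \<open>w'' / w'\<^sup>2\<close> behaves like \<open>(e - 1) / (e w)\<close>, and this is
  compared with \<open>S\<^sub>1(w) / S\<^sub>2(w)\<close>. The computation uses \<open>\<theta> = t d/dt\<close> instead of \<open>d/dt\<close>, as \<open>\<theta>\<close> does not
  shift degrees.
\<close>

lemma coefficients_at_infinity:
  fixes A B S1 S2 :: "real poly"
  assumes B: "B \<noteq> 0" "degree B < degree A"
    and eq: "hom_subst (Suc m) S2 A B * accel A B
      = hom_subst m S1 A B * (wronskian A B)\<^sup>2"
  shows "(real (degree A) - real (degree B) - 1) * coeff S2 (Suc m) = (real (degree A) - real (degree B)) * coeff S1 m"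
proof -
  define \<alpha> \<beta> a b where "\<alpha> = degree A" and "\<beta> = degree B" and "a = lead_coeff A" and "b = lead_coeff B"
  define J where "J = wronskian A B"
  define \<theta> where "\<theta> p = pCons 0 (pderiv p)" for p :: "real poly"
  have \<theta>: "\<theta> p = [:0, 1:] * pderiv p" for p by (simp add: \<theta>_def)
  define K where "K = \<theta> A * B - A * \<theta> B"
  have a: "a \<noteq> 0" and b: "b \<noteq> 0" using B by (auto simp: a_def b_def)
  have tA: "leading A \<alpha> a" and tB: "leading B \<beta> b" by (simp_all add: leading_def \<alpha>_def \<beta>_def a_def b_def)
  have lt: "\<beta> < \<alpha>" using B by (simp add: \<alpha>_def \<beta>_def)
  define e where "e = real \<alpha> - real \<beta>"
  have e: "e \<noteq> 0" using lt by (simp add: e_def)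
  have K: "K = [:0, 1:] * J" by (simp add: K_def \<theta> J_def algebra_simps)
  have \<theta>K: "\<theta> K - K = [:0, 1:]\<^sup>2 * pderiv J"
    unfolding \<theta> K by (simp add: pderiv_mult pderiv_pCons algebra_simps power2_eq_square)
  have tK: "leading K (\<alpha> + \<beta>) (e * a * b)"
    using leading_diff[OF leading_mult[OF leading_theta[OF tA] tB] leading_mult[OF tA leading_theta[OF tB]]]
    unfolding K_def \<theta>_def e_def by (simp add: algebra_simps)
  define E where "E = pderiv J * B - 2 * J * pderiv B"
  have E: "[:0, 1:]\<^sup>2 * E = (\<theta> K - K) * B - smult 2 (K * \<theta> B)"
    unfolding \<theta>K unfolding E_def K \<theta> by (simp add: algebra_simps power2_eq_square numeral_poly)
  have tE: "leading ([:0, 1:]\<^sup>2 * E) (\<alpha> + \<beta> + \<beta>) (e * (e - 1) * a * b\<^sup>2)"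
    using leading_diff[OF leading_mult[OF leading_diff[OF leading_theta[OF tK] tK] tB] leading_smult[OF leading_mult[OF tK leading_theta[OF tB]], of 2]]
    unfolding E \<theta>_def[of K, symmetric] \<theta>_def[of B, symmetric]
    by (simp add: e_def algebra_simps power2_eq_square)
  have "hom_subst (Suc m) S2 A B * ([:0, 1:]\<^sup>2 * E) = hom_subst m S1 A B * K\<^sup>2"
    using arg_cong[OF eq, of "\<lambda>p. [:0, 1:]\<^sup>2 * p"] unfolding K E_def J_def
    by (simp only: power_mult_distrib mult_ac)
  moreover have "leading (hom_subst (Suc m) S2 A B * ([:0, 1:]\<^sup>2 * E)) (Suc m * \<alpha> + (\<alpha> + \<beta> + \<beta>)) (coeff S2 (Suc m) * a ^ Suc m * (e * (e - 1) * a * b\<^sup>2))"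
    by (intro leading_mult leading_hom_subst[OF tA tB lt] tE)
  moreover have "leading (hom_subst m S1 A B * K\<^sup>2) (m * \<alpha> + 2 * (\<alpha> + \<beta>)) (coeff S1 m * a ^ m * (e * a * b)\<^sup>2)"
    by (intro leading_mult leading_hom_subst[OF tA tB lt] leading_power tK)
  moreover have "Suc m * \<alpha> + (\<alpha> + \<beta> + \<beta>) = m * \<alpha> + 2 * (\<alpha> + \<beta>)" by simp
  ultimately have "coeff S2 (Suc m) * a ^ Suc m * (e * (e - 1) * a * b\<^sup>2) = coeff S1 m * a ^ m * (e * a * b)\<^sup>2"
    by (metis leading_def)
  then have "(a ^ m * a\<^sup>2 * b\<^sup>2 * e) * ((e - 1) * coeff S2 (Suc m)) = (a ^ m * a\<^sup>2 * b\<^sup>2 * e) * (e * coeff S1 m)"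
    by (simp add: power2_eq_square mult_ac)
  then show ?thesis using a b e by (simp add: e_def \<alpha>_def \<beta>_def)
qed

text \<open>
  If \<open>w\<close> behaves like \<open>(t - t\<^sub>0)\<^sup>-\<^sup>k\<close>, then \<open>w'' / w'\<^sup>2\<close> behaves like \<open>(k + 1) / (k w)\<close>. Poles need not
  be real, and therefore the expansion at \<open>t\<^sub>0\<close> is replaced by congruences modulo a prime factor \<open>\<pi>\<close>
  of the denominator, of multiplicity \<open>k\<close>.
\<close>

lemma coefficients_at_pole:
  fixes A B S1 S2 :: "real poly"
  assumes B: "degree B > 0" and cop: "coprime A B"
    and eq: "hom_subst (Suc m) S2 A B * accel A B
      = hom_subst m S1 A B * (wronskian A B)\<^sup>2"
  shows "\<exists>k::nat. k > 0 \<and> (real k + 1) * coeff S2 (Suc m) = real k * coeff S1 m"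
proof -
  have B0: "B \<noteq> 0" using B by auto
  have Bu: "\<not> is_unit B" using B is_unit_iff_degree[OF B0] by simp
  obtain \<pi> where \<pi>: "\<pi> dvd B" "prime \<pi>" using prime_divisor_exists[OF B0 Bu] by blast
  have pe: "prime_elem \<pi>" using \<pi>(2) by blast
  have \<pi>0: "\<pi> \<noteq> 0" "\<not> is_unit \<pi>" using pe by auto
  define k where "k = multiplicity \<pi> B"
  obtain B1 where B1: "B = \<pi> ^ k * B1" "\<not> \<pi> dvd B1"
    using multiplicity_decompose'[OF B0 \<pi>0(2)] unfolding k_def by metis
  have "k > 0" using \<pi>(1) B0 \<pi>0 by (simp add: k_def multiplicity_gt_zero_iff)
  then obtain j where j: "k = Suc j" by (cases k) auto
  have nA: "\<not> \<pi> dvd A" using cop \<pi> \<pi>0(2) by (metis coprime_common_divisor)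
  have d\<pi>: "degree \<pi> > 0" using \<pi>0 by (metis is_unit_iff_degree neq0_conv)
  have n\<pi>': "\<not> \<pi> dvd pderiv \<pi>"
  proof
    assume "\<pi> dvd pderiv \<pi>"
    moreover have "pderiv \<pi> \<noteq> 0" using d\<pi> by (simp add: pderiv_eq_0_iff)
    ultimately have "degree \<pi> \<le> degree (pderiv \<pi>)" by (rule dvd_imp_degree_le)
    then show False using d\<pi> by (simp add: degree_pderiv)
  qed
  define J where "J = wronskian A B"
  define u where "u = pderiv \<pi>"
  define c :: "real poly" where "c = of_nat (Suc j)"
  have pd: "pderiv (\<pi> ^ Suc i) = of_nat (Suc i) * (\<pi> ^ i * u)" for i
    unfolding pderiv_power_Suc u_def by (simp add: of_nat_poly)
  have dB: "pderiv B = \<pi> ^ j * (c * u * B1 + \<pi> * pderiv B1)"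
    unfolding B1(1) j pderiv_mult pd c_def by (simp add: algebra_simps)
  define J1 where "J1 = pderiv A * \<pi> * B1 - A * (c * u * B1 + \<pi> * pderiv B1)"
  have J: "J = \<pi> ^ j * J1"
    unfolding J_def dB J1_def unfolding B1(1) j by (simp add: algebra_simps)
  have dJ: "\<pi> * pderiv J = \<pi> ^ j * ((c - 1) * u * J1 + \<pi> * pderiv J1)"
  proof (cases j)
    case 0
    then show ?thesis by (simp add: J c_def)
  next
    case (Suc i)
    have "pderiv J = \<pi> ^ i * (of_nat (Suc i) * u * J1 + \<pi> * pderiv J1)"
      unfolding J Suc pderiv_mult pd by (simp add: algebra_simps)
    then show ?thesis by (simp add: Suc c_def algebra_simps)
  qed
  define E where "E = ((c - 1) * u * J1 + \<pi> * pderiv J1) * B1 - 2 * J1 * (c * u * B1 + \<pi> * pderiv B1)"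
  have "pderiv J * B - 2 * J * pderiv B = \<pi> ^ j * (\<pi> * pderiv J) * B1 - 2 * J * pderiv B"
    unfolding B1(1) j by (simp add: algebra_simps)
  also have "\<dots> = (\<pi> ^ j)\<^sup>2 * E"
    unfolding dJ dB unfolding J E_def by (simp add: algebra_simps power2_eq_square)
  finally have E: "pderiv J * B - 2 * J * pderiv B = (\<pi> ^ j)\<^sup>2 * E" .
  have "(\<pi> ^ j)\<^sup>2 * (hom_subst (Suc m) S2 A B * E) = (\<pi> ^ j)\<^sup>2 * (hom_subst m S1 A B * J1\<^sup>2)"
    using eq unfolding J_def[symmetric] E unfolding J by (simp add: power_mult_distrib mult_ac)
  then have main: "hom_subst (Suc m) S2 A B * E = hom_subst m S1 A B * J1\<^sup>2"
    using \<pi>0(1) by simp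
  define eqm where "eqm x y \<longleftrightarrow> \<pi> dvd x - y" for x y
  have eqm_mult: "eqm (x * z) (y * w)" if "eqm x y" "eqm z w" for x y z w
  proof -
    have "x * z - y * w = (x - y) * z + y * (z - w)" by (simp add: algebra_simps)
    then show ?thesis using that unfolding eqm_def by (metis dvd_add dvd_mult dvd_mult2)
  qed
  have eqm_trans: "eqm x z" if "eqm x y" "eqm y z" for x y z
  proof -
    have "x - z = (x - y) + (y - z)" by simp
    then show ?thesis using that unfolding eqm_def by (metis dvd_add)
  qed
  have eqm_diff: "\<pi> dvd z - y" if "eqm x y" "eqm x z" for x y z
  proof -
    have "z - y = (x - y) - (x - z)" by simp
    then show ?thesis using that unfolding eqm_def by (metis dvd_diff)
  qed
  have H: "eqm (hom_subst n p A B) (smult (coeff p n) (A ^ n))" for n p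
    unfolding eqm_def using hom_subst_mod \<pi>(1) dvd_trans by blast
  have J1m: "eqm J1 (- (c * A * u * B1))"
  proof -
    have "J1 - - (c * A * u * B1) = \<pi> * (pderiv A * B1 - A * pderiv B1)"
      unfolding J1_def by (simp add: algebra_simps)
    then show ?thesis unfolding eqm_def by (metis dvd_triv_left)
  qed
  have "eqm E (- ((c + 1) * u * B1) * J1)"
  proof -
    have "E - (- ((c + 1) * u * B1) * J1) = \<pi> * (pderiv J1 * B1 - 2 * J1 * pderiv B1)"
      unfolding E_def by (simp add: algebra_simps)
    then show ?thesis unfolding eqm_def by (metis dvd_triv_left)
  qed
  moreover have "eqm (- ((c + 1) * u * B1) * J1) (- ((c + 1) * u * B1) * (- (c * A * u * B1)))"
    by (rule eqm_mult[OF _ J1m]) (simp add: eqm_def)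
  ultimately have "eqm E (- ((c + 1) * u * B1) * (- (c * A * u * B1)))"
    by (rule eqm_trans)
  from eqm_mult[OF H this, of "Suc m" S2]
  have 1: "eqm (hom_subst m S1 A B * J1\<^sup>2) (smult (coeff S2 (Suc m)) (A ^ Suc m) * (- ((c + 1) * u * B1) * (- (c * A * u * B1))))"
    unfolding main .
  have 2: "eqm (hom_subst m S1 A B * J1\<^sup>2) (smult (coeff S1 m) (A ^ m) * (- (c * A * u * B1))\<^sup>2)"
    unfolding power2_eq_square by (intro eqm_mult H J1m)
  have "\<pi> dvd smult (coeff S1 m) (A ^ m) * (- (c * A * u * B1))\<^sup>2 - smult (coeff S2 (Suc m)) (A ^ Suc m) * (- ((c + 1) * u * B1) * (- (c * A * u * B1)))"
    using eqm_diff[OF 1 2] .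
  also have "\<dots> = smult (real (Suc j) * (real (Suc j) * coeff S1 m - (real (Suc j) + 1) * coeff S2 (Suc m))) (A ^ (m + 2) * u\<^sup>2 * B1\<^sup>2)"
  proof -
    define r where "r = real (Suc j)"
    define P where "P = A ^ (m + 2) * u\<^sup>2 * B1\<^sup>2"
    have c: "c = [:r:]" by (simp add: c_def r_def of_nat_poly)
    have c1: "c + 1 = [:r + 1:]" by (simp add: c one_pCons)
    have "smult (coeff S1 m) (A ^ m) * (- (c * A * u * B1))\<^sup>2 = smult (coeff S1 m * r\<^sup>2) P"
      unfolding c P_def by (simp add: power2_eq_square mult_ac)
    moreover have "smult (coeff S2 (Suc m)) (A ^ Suc m) * (- ((c + 1) * u * B1) * (- (c * A * u * B1))) =
        smult (coeff S2 (Suc m) * (r + 1) * r) P"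
      unfolding c1 unfolding c P_def by (simp add: power2_eq_square mult_ac)
    moreover have "coeff S1 m * r\<^sup>2 - coeff S2 (Suc m) * (r + 1) * r = r * (r * coeff S1 m - (r + 1) * coeff S2 (Suc m))"
      by (simp add: power2_eq_square algebra_simps)
    ultimately show ?thesis unfolding r_def[symmetric] P_def[symmetric] by (metis smult_diff_left)
  qed
  finally have dv: "\<pi> dvd smult (real (Suc j) * (real (Suc j) * coeff S1 m - (real (Suc j) + 1) * coeff S2 (Suc m))) (A ^ (m + 2) * u\<^sup>2 * B1\<^sup>2)" .
  have nd: "\<not> \<pi> dvd A ^ (m + 2) * u\<^sup>2 * B1\<^sup>2"
    using pe nA n\<pi>' B1(2) unfolding u_def by (simp only: prime_elem_dvd_mult_iff prime_elem_dvd_power_iff) (auto dest: prime_elem_dvd_power)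
  have "real (Suc j) * (real (Suc j) * coeff S1 m - (real (Suc j) + 1) * coeff S2 (Suc m)) = 0"
    using dv nd dvd_smult_cancel by blast
  then have "(real (Suc j) + 1) * coeff S2 (Suc m) = real (Suc j) * coeff S1 m" by (simp del: of_nat_Suc)
  then show ?thesis by blast
qed

text \<open>
  If \<open>p'' = 0\<close>, then \<open>S\<^sub>1 = 0\<close> and \<open>p\<close> is linear. Otherwise, as \<open>S\<^sub>1(p)\<close> and \<open>S\<^sub>2(p)\<close> are coprime, \<open>S\<^sub>1(p)\<close> divides \<open>p''\<close>, whose degree is smaller than that of \<open>p\<close>.
  So \<open>S\<^sub>1\<close> is constant; then \<open>S\<^sub>2\<close> is linear by comparing degrees, and leading coefficients fix the
  ratio. The solutions \<open>p\<close> are the polynomials \<open>c + k (t - t\<^sub>0)\<^sup>N\<close>.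
\<close>

lemma polynomial_solution:
  fixes p S1 S2 :: "real poly"
  assumes p: "degree p > 0" and S2: "S2 \<noteq> 0" and cop: "coprime S1 S2"
    and eq: "pderiv (pderiv p) * pcompose S2 p = pcompose S1 p * (pderiv p)\<^sup>2"
  shows "\<exists>c. smult (real (degree p)) (S1 * [:- c, 1:]) = smult (real (degree p) - 1) S2"
proof (cases "pderiv (pderiv p) = 0")
  case True
  then have "degree p = 1" using p by (simp add: pderiv_eq_0_iff degree_pderiv)
  moreover have "pderiv p \<noteq> 0" using p by (simp add: pderiv_eq_0_iff)
  then have "pcompose S1 p = 0" using eq True by simp
  then have "S1 = 0" using p by (metis pcompose_eq_0)
  ultimately show ?thesis by simp
next
  case False
  define n where "n = degree p"
  have n2: "n \<ge> 2" using False p by (simp add: n_def pderiv_eq_0_iff degree_pderiv)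
  have p': "pderiv p \<noteq> 0" using p by (simp add: pderiv_eq_0_iff)
  have dp: "degree (pderiv p) = n - 1" "degree (pderiv (pderiv p)) = n - 2" by (simp_all add: degree_pderiv n_def)
  obtain u v where "u * S1 + v * S2 = 1" using cop by (metis bezout_coefficients_fst_snd coprime_iff_gcd_eq_1)
  then have bez: "pcompose u p * pcompose S1 p + pcompose v p * pcompose S2 p = 1"
    by (metis pcompose_1 pcompose_add pcompose_mult)
  have "pcompose S1 p dvd pderiv (pderiv p)"
  proof -
    have "pderiv (pderiv p) = pderiv (pderiv p) * (pcompose u p * pcompose S1 p + pcompose v p * pcompose S2 p)"
      unfolding bez by simp
    also have "\<dots> = pcompose S1 p * (pderiv (pderiv p) * pcompose u p) + pcompose v p * (pderiv (pderiv p) * pcompose S2 p)"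
      by (simp add: algebra_simps)
    also have "\<dots> = pcompose S1 p * (pderiv (pderiv p) * pcompose u p + pcompose v p * (pderiv p)\<^sup>2)"
      unfolding eq by (simp add: algebra_simps)
    finally show ?thesis by (rule dvdI)
  qed
  from dvd_imp_degree_le[OF this False] have "degree S1 * n \<le> n - 2" by (simp add: dp n_def[symmetric] degree_pcompose)
  then have dS1: "degree S1 = 0" using n2 by (cases "degree S1") auto
  then obtain s where s: "S1 = [:s:]" by (rule degree_eq_zeroE)
  have "pcompose S2 p \<noteq> 0" using S2 p by (metis pcompose_eq_0)
  then have "pderiv (pderiv p) * pcompose S2 p \<noteq> 0" using False by simp
  then have s0: "s \<noteq> 0" using eq s by auto
  have "degree (pderiv (pderiv p) * pcompose S2 p) = n - 2 + degree S2 * n"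
    using False \<open>pcompose S2 p \<noteq> 0\<close> by (simp add: degree_mult_eq dp degree_pcompose n_def)
  moreover have "degree (pcompose S1 p * (pderiv p)\<^sup>2) = 2 * (n - 1)"
    using s s0 p' by (simp add: degree_power_eq dp pcompose_const)
  ultimately have "n - 2 + degree S2 * n = 2 * (n - 1)" using eq by simp
  then have "degree S2 * n = 1 * n" using n2 by linarith
  then have dS2: "degree S2 = 1" using n2 by simp
  then obtain y z where S2yz: "S2 = [:y, z:]" and z: "z \<noteq> 0" by (metis degree1_coeffs)
  have "lead_coeff (pderiv (pderiv p) * pcompose S2 p) = lead_coeff (pcompose S1 p * (pderiv p)\<^sup>2)" using eq by simp
  moreover have lc: "lead_coeff (pderiv q) = real (degree q) * lead_coeff q" if "degree q > 0" for q :: "real poly"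
    using that by (cases "degree q") (simp_all add: degree_pderiv coeff_pderiv)
  have a1: "lead_coeff (pderiv p) = real n * lead_coeff p" unfolding n_def by (rule lc[OF p])
  have pos: "degree (pderiv p) > 0" using n2 dp by linarith
  have "real (degree (pderiv p)) = real (n - 1)" by (simp only: dp)
  then have a2: "lead_coeff (pderiv (pderiv p)) = real (n - 1) * (real n * lead_coeff p)"
    using lc[OF pos] by (simp only: a1)
  note a1 a2
  moreover have "lead_coeff (pcompose S2 p) = z * lead_coeff p"
    using lead_coeff_comp[of p S2] p dS2 S2yz z by simp
  ultimately have "real (n - 1) * (real n * lead_coeff p) * (z * lead_coeff p) = s * (real n * lead_coeff p)\<^sup>2"
    by (simp only: lead_coeff_mult lead_coeff_power s pcompose_const) (simp add: lead_coeff_mult lead_coeff_power)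
  then have "(real n * (lead_coeff p)\<^sup>2) * ((real n - 1) * z) = (real n * (lead_coeff p)\<^sup>2) * (real n * s)"
    using n2 by (simp add: power2_eq_square of_nat_diff mult_ac)
  moreover have "real n * (lead_coeff p)\<^sup>2 \<noteq> 0" using p by (auto simp: n_def)
  ultimately have key: "(real n - 1) * z = real n * s" by simp
  have "real n * s * (y / z) = (real n - 1) * y" unfolding key[symmetric] using z by simp
  with key show ?thesis unfolding n_def[symmetric]
    by (intro exI[of _ "- (y / z)"]) (simp add: s S2yz mult_ac)
qed

text \<open>
  Let \<open>s\<^sub>1\<close> and \<open>s\<^sub>2\<close> be the leading coefficients of numerator and denominator of the equation. At
  infinity, \<open>(e - 1) s\<^sub>2 = e s\<^sub>1\<close> with \<open>e = degree A - degree B > 0\<close>; at a pole of order \<open>k\<close>,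
  \<open>(k + 1) s\<^sub>2 = k s\<^sub>1\<close>. Together \<open>(k + e) s\<^sub>2 = 0\<close>, so both vanish, contrary to their being leading.
  Hence there is no finite pole and \<open>polynomial_solution\<close> applies.
\<close>

lemma totally_ramified_solution:
  fixes A B S1 S2 :: "real poly"
  assumes cop: "coprime A B" and deg: "degree B < degree A" and S2: "S2 \<noteq> 0"
    and ev: "\<forall>\<^sub>F t in at 0. poly B t \<noteq> 0 \<and> poly S2 (poly A t / poly B t) \<noteq> 0 \<and>
      poly (accel A B) t
        * poly B t * poly S2 (poly A t / poly B t) =
      poly S1 (poly A t / poly B t) * (poly (wronskian A B) t)\<^sup>2"
  shows "\<exists>N>0. \<exists>c. smult (real N) (S1 * [:- c, 1:]) = smult (real N - 1) S2"
proof -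
  define J where "J = wronskian A B"
  define E where "E = pderiv J * B - 2 * J * pderiv B"
  have "gcd S1 S2 \<noteq> 0" using S2 by simp
  from gcd_coprime_exists[OF this] obtain T1 T2 where
    T': "S1 = T1 * gcd S1 S2" "S2 = T2 * gcd S1 S2" and T12: "coprime T1 T2" by blast
  define g where "g = gcd S1 S2"
  have T: "S1 = T1 * g" "S2 = T2 * g" using T' unfolding g_def by blast+
  have T2: "T2 \<noteq> 0" using T S2 by auto
  have evT: "\<forall>\<^sub>F t in at 0. poly B t \<noteq> 0 \<and> poly E t * poly B t * poly T2 (poly A t / poly B t) =
      poly T1 (poly A t / poly B t) * (poly J t)\<^sup>2"
    using ev unfolding J_def[symmetric] E_def[symmetric]
  proof eventually_elim
    case (elim t)
    define x where "x = poly A t / poly B t"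
    have gx: "poly g x \<noteq> 0" using elim unfolding T(2) x_def by auto
    have "(poly E t * poly B t * poly T2 x) * poly g x = (poly T1 x * (poly J t)\<^sup>2) * poly g x"
      using elim unfolding T(1,2) x_def by (auto simp: mult_ac)
    then have "poly E t * poly B t * poly T2 x = poly T1 x * (poly J t)\<^sup>2" using gx mult_right_cancel by blast
    then show ?case using elim unfolding x_def by blast
  qed
  have B0: "B \<noteq> 0"
  proof
    assume "B = 0"
    then have "\<forall>\<^sub>F t::real in at 0. False" using evT by simp
    then show False by simp
  qed
  have poly_eqI: "p = q" if *: "\<forall>\<^sub>F t in at 0. poly p t = poly q t" for p q :: "real poly"
  proof (rule ccontr)
    assume "p \<noteq> q"
    then have "\<forall>\<^sub>F t in at 0. poly (p - q) t \<noteq> 0" by (intro eventually_poly_neq_0) simp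
    with * have "\<forall>\<^sub>F t::real in at 0. False" by eventually_elim simp
    then show False by simp
  qed
  \<comment> \<open>the extra factor makes \<open>U2\<close> nonconstant, so that \<open>degree U2 - 1\<close> is no truncated difference
      and one of the two coefficients at \<open>m\<close> and \<open>Suc m\<close> does not vanish\<close>
  define U1 U2 where "U1 = [:0, 1:] * T1" and "U2 = [:0, 1:] * T2"
  define m where "m = max (degree U1) (degree U2 - 1)"
  have m: "degree U1 \<le> m" "degree U2 \<le> Suc m" by (auto simp: m_def)
  have U2: "degree U2 \<noteq> 0" using T2 by (simp add: U2_def)
  have eq: "hom_subst (Suc m) U2 A B * E = hom_subst m U1 A B * J\<^sup>2"
  proof (rule poly_eqI)
    show "\<forall>\<^sub>F t in at 0. poly (hom_subst (Suc m) U2 A B * E) t = poly (hom_subst m U1 A B * J\<^sup>2) t"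
      using evT
    proof eventually_elim
      case (elim t)
      define x where "x = poly A t / poly B t"
      have "poly B t ^ m * x * (poly E t * poly B t * poly T2 x) = poly B t ^ m * x * (poly T1 x * (poly J t)\<^sup>2)"
        using elim by (simp add: x_def)
      moreover have "poly (hom_subst m U1 A B) t = poly B t ^ m * (x * poly T1 x)"
        "poly (hom_subst (Suc m) U2 A B) t = poly B t ^ Suc m * (x * poly T2 x)"
        using elim poly_hom_subst[OF m(1)] poly_hom_subst[OF m(2)] by (simp_all add: U1_def U2_def x_def)
      ultimately show ?case unfolding poly_mult poly_power by (simp add: mult_ac)
    qed
  qed
  note inf = coefficients_at_infinity[OF B0 deg eq[unfolded E_def J_def]]
  have dB: "degree B = 0"
  proof (rule ccontr)
    assume "degree B \<noteq> 0"
    then obtain k where k: "k > 0" "(real k + 1) * coeff U2 (Suc m) = real k * coeff U1 m"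
      using coefficients_at_pole[OF _ cop eq[unfolded E_def J_def]] by blast
    define e s1 s2 where "e = real (degree A) - real (degree B)" and "s1 = coeff U1 m" and "s2 = coeff U2 (Suc m)"
    have "real k * ((e - 1) * s2) = e * (real k * s1)" using inf by (simp add: e_def s1_def s2_def)
    also have "\<dots> = e * ((real k + 1) * s2)" using k by (simp add: s1_def s2_def)
    finally have "(real k + e) * s2 = 0" by (simp add: algebra_simps)
    moreover have "real k + e > 0" using k deg by (simp add: e_def)
    ultimately have s2: "s2 = 0" by simp
    then have s1: "s1 = 0" using k by (simp add: s1_def s2_def)
    show False
    proof (cases "Suc m = degree U2")
      case True
      then show False using s2 U2 by (auto simp: s2_def)
    next
      case False
      then have "m = degree U1" "degree U1 > degree U2 - 1" using m U2 unfolding m_def by linarith+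
      then have "U1 = 0" using s1 by (simp add: s1_def)
      then show False using \<open>degree U1 > degree U2 - 1\<close> by simp
    qed
  qed
  then obtain b where b: "B = [:b:]" by (rule degree_eq_zeroE)
  have b0: "b \<noteq> 0" using B0 b by auto
  define p where "p = smult (1 / b) A"
  have dp: "degree p > 0" using deg b0 by (simp add: p_def)
  have A: "A = smult b p" using b0 by (simp add: p_def)
  have J: "J = smult (b\<^sup>2) (pderiv p)" unfolding J_def A b by (simp add: pderiv_smult pderiv_pCons power2_eq_square)
  have E: "E = smult (b ^ 3) (pderiv (pderiv p))"
    unfolding E_def J b by (simp add: pderiv_smult pderiv_pCons power2_eq_square power3_eq_cube mult.assoc)
  have "pderiv (pderiv p) * pcompose T2 p = pcompose T1 p * (pderiv p)\<^sup>2"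
  proof (rule poly_eqI)
    show "\<forall>\<^sub>F t in at 0. poly (pderiv (pderiv p) * pcompose T2 p) t = poly (pcompose T1 p * (pderiv p)\<^sup>2) t"
      using evT
    proof eventually_elim
      case (elim t)
      have x: "poly A t / poly B t = poly p t" using b0 by (simp add: A b)
      have "b ^ 4 * (poly (pderiv (pderiv p)) t * poly T2 (poly p t)) = b ^ 4 * (poly T1 (poly p t) * (poly (pderiv p) t)\<^sup>2)"
        using elim unfolding x unfolding E J b by (auto simp: power_mult_distrib eval_nat_numeral mult_ac)
      then show ?case using b0 by (simp add: poly_pcompose)
    qed
  qed
  from polynomial_solution[OF dp T2 T12 this] obtain c where
    "smult (real (degree p)) (T1 * [:- c, 1:]) = smult (real (degree p) - 1) T2" by blast
  then have "smult (real (degree p)) (T1 * [:- c, 1:]) * g = smult (real (degree p) - 1) T2 * g" by simp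
  then have "smult (real (degree p)) (S1 * [:- c, 1:]) = smult (real (degree p) - 1) S2"
  proof -
    assume *: "smult (real (degree p)) (T1 * [:- c, 1:]) * g = smult (real (degree p) - 1) T2 * g"
    have "smult r (T1 * g * L) = smult r (T1 * L) * g" "smult r (T2 * g) = smult r T2 * g" for r L
      by (simp_all only: mult_smult_left mult.assoc mult.commute[of g])
    then show ?thesis unfolding T using * by (simp only:)
  qed
  then show ?thesis using dp by blast
qed

section \<open>The vector field of a flow\<close>

definition ray_poly :: "real poly poly \<Rightarrow> real \<Rightarrow> real \<Rightarrow> real poly" where
  "ray_poly p a b = map_poly (\<lambda>q. psubst id q a b) (hexp p)"

lemma poly_ray_poly: "poly (ray_poly p a b) t = psubst id p (a * t) (b * t)"
  unfolding eval3_hexp[symmetric] by (simp add: ray_poly_def eval3_def)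

text \<open>
  Let \<open>D\<close> be the derivative along the field. For \<open>\<kappa> = x / y\<close> one finds \<open>D \<kappa> = G / y\<^sup>2 = K\<close>, and with
  Euler's identity \<open>D K = \<sigma> K\<^sup>2\<close>, where \<open>\<sigma> = y A / G\<close>. So along an integral curve \<open>w = \<kappa>\<close> satisfies
  \<open>w'' = \<sigma> w'\<^sup>2\<close>. The integral curves of a flow are rational in \<open>t\<close>, hence so is \<open>w\<close>.
\<close>

lemma ratio_along_flow:
  assumes flow: "rational_flow (u, v)" and vf: "has_vector_field (u, v) (\<omega>, \<rho>)"
    and G: "contact \<omega> \<rho> \<noteq> 0"
    and R: "generically (\<lambda>a b. b \<noteq> 0 \<and> poly R2 (a / b) \<noteq> 0 \<and>
       value_at (Y * (contact_x \<omega> \<rho>) / (contact \<omega> \<rho>)) a b = poly R1 (a / b) / poly R2 (a / b))"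
  shows "\<exists>A B. coprime A B \<and> (\<forall>\<^sub>F t in at 0. poly B t \<noteq> 0 \<and> poly R2 (poly A t / poly B t) \<noteq> 0 \<and>
      poly (wronskian A B) t \<noteq> 0 \<and>
      poly (accel A B) t
        * poly B t * poly R2 (poly A t / poly B t) =
      poly R1 (poly A t / poly B t) * (poly (wronskian A B) t)\<^sup>2)"
proof -
  have hom: "homogeneous 2 \<omega>" "homogeneous 2 \<rho>" using flow_vector_field_homogeneous[OF vf] by blast+
  define G A B where "G = contact \<omega> \<rho>" and "A = contact_x \<omega> \<rho>" and "B = contact_y \<omega> \<rho>"
  have G0: "G \<noteq> 0" using G by (simp add: G_def)
  define \<sigma> \<kappa> K where "\<sigma> = Y * A / G" and "\<kappa> = X / Y" and "K = G / Y\<^sup>2"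
  have aX: "along \<omega> \<rho> X = \<omega>" "along \<omega> \<rho> Y = \<rho>" by (simp_all add: along_def)
  have D1: "along \<omega> \<rho> \<kappa> = K"
    by (simp add: \<kappa>_def K_def along_divide aX G_def mult.commute)
  have D2: "along \<omega> \<rho> K = \<sigma> * K\<^sup>2"
  proof -
    have aG: "Y * along \<omega> \<rho> G - 2 * G * \<rho> = A * G"
    proof -
      have e1: "Y * along \<omega> \<rho> G = Y * \<omega> * A + \<rho> * (Y * B)"
        unfolding G_def along_contact A_def B_def by (simp add: algebra_simps)
      have e2: "Y * B = 2 * G - X * A"
        using contact_Euler[OF hom] unfolding A_def B_def G_def by (simp add: algebra_simps)
      have "Y * \<omega> * A + \<rho> * (2 * G - X * A) - 2 * G * \<rho> = A * (contact \<omega> \<rho>)"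
        by (simp add: algebra_simps)
      then show ?thesis unfolding e1 e2 G_def[symmetric] .
    qed
    have "along \<omega> \<rho> K = (along \<omega> \<rho> G * Y\<^sup>2 - G * along \<omega> \<rho> (Y\<^sup>2)) / (Y\<^sup>2)\<^sup>2"
      unfolding K_def by (rule along_divide) simp
    also have "along \<omega> \<rho> (Y\<^sup>2) = 2 * Y * \<rho>" by (simp add: power2_eq_square along_mult aX)
    also have "(along \<omega> \<rho> G * Y\<^sup>2 - G * (2 * Y * \<rho>)) / (Y\<^sup>2)\<^sup>2 = Y * (Y * along \<omega> \<rho> G - 2 * G * \<rho>) / (Y\<^sup>2)\<^sup>2"
      by (simp add: power2_eq_square algebra_simps)
    also have "\<dots> = \<sigma> * K\<^sup>2"
      unfolding aG \<sigma>_def K_def using G0 by (simp add: power2_eq_square)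
    finally show ?thesis .
  qed
  define good where "good a b \<longleftrightarrow> b \<noteq> 0 \<and> poly R2 (a / b) \<noteq> 0 \<and> value_at \<sigma> a b = poly R1 (a / b) / poly R2 (a / b) \<and>
    ok_at \<sigma> a b \<and> ok_at \<kappa> a b \<and> ok_at K a b \<and> ok_at \<omega> a b \<and> ok_at \<rho> a b \<and> value_at K a b \<noteq> 0" for a b
  have K0: "K \<noteq> 0" using G0 by (simp add: K_def)
  have good: "generically good"
    by (rule generically_mono[OF generically_conj[OF generically_conj[OF R[folded A_def G_def, folded \<sigma>_def] generically_conj[OF generically_ok[of \<sigma>] generically_ok[of \<kappa>]]]
        generically_conj[OF generically_conj[OF generically_ok[of K] generically_value_neq_0[OF K0]] generically_conj[OF generically_ok[of \<omega>] generically_ok[of \<rho>]]]]])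
      (simp add: good_def)
  from generically_ex[OF generically_conj[OF generically_conj[OF rational_flow_limit[OF flow] flow_curve[OF flow vf]] generically_nhds[OF good]]]
  obtain a b where l: "(ray u a b \<longlongrightarrow> a) (at 0)" "(ray v a b \<longlongrightarrow> b) (at 0)"
    and curve: "\<forall>\<^sub>F t in at 0. integral_curve_at u v \<omega> \<rho> a b t"
    and nbh: "\<forall>x y (F :: real filter). (x \<longlongrightarrow> a) F \<longrightarrow> (y \<longlongrightarrow> b) F \<longrightarrow> eventually (\<lambda>z. good (x z) (y z)) F"
    by blast
  define c1 c2 where "c1 t = ray u a b t" and "c2 t = ray v a b t" for t
  have "\<forall>\<^sub>F t in at 0. good (c1 t) (c2 t)"
    using nbh l unfolding c1_def[abs_def] c2_def[abs_def] by blast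
  with curve have ev: "\<forall>\<^sub>F t in at 0. good (c1 t) (c2 t) \<and> t \<noteq> 0 \<and> ok_at u (a * t) (b * t) \<and> ok_at v (a * t) (b * t) \<and>
      (c1 has_real_derivative value_at \<omega> (c1 t) (c2 t)) (at t) \<and> (c2 has_real_derivative value_at \<rho> (c1 t) (c2 t)) (at t)"
    unfolding c1_def[abs_def] c2_def[abs_def] by eventually_elim blast
  then obtain e where e: "e > 0" and near: "\<And>t. t \<noteq> 0 \<Longrightarrow> dist t 0 < e \<Longrightarrow> good (c1 t) (c2 t) \<and> ok_at u (a * t) (b * t) \<and> ok_at v (a * t) (b * t) \<and>
      (c1 has_real_derivative value_at \<omega> (c1 t) (c2 t)) (at t) \<and> (c2 has_real_derivative value_at \<rho> (c1 t) (c2 t)) (at t)"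
    unfolding eventually_at by blast
  define I where "I = {t::real. t \<noteq> 0 \<and> dist t 0 < e}"
  have "I = {- e<..<0} \<union> {0<..<e}" by (auto simp: I_def dist_real_def)
  then have openI: "open I" by (simp add: open_Un)
  have nearI: "\<forall>\<^sub>F s in nhds t. s \<in> I" if "t \<in> I" for t using openI that by (rule eventually_nhds_in_open)
  have evI: "\<forall>\<^sub>F t in at 0. t \<in> I" unfolding eventually_at I_def using e by blast
  define P1 where "P1 = ray_poly (fst (quot_of_fract u)) a b * ray_poly (snd (quot_of_fract v)) a b"
  define P2 where "P2 = ray_poly (snd (quot_of_fract u)) a b * ray_poly (fst (quot_of_fract v)) a b"
  have w: "poly P2 t \<noteq> 0 \<and> value_at \<kappa> (c1 t) (c2 t) = poly P1 t / poly P2 t" if "t \<in> I" for t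
  proof -
    have t: "t \<noteq> 0" "good (c1 t) (c2 t)" "ok_at u (a * t) (b * t)" "ok_at v (a * t) (b * t)"
      using that near by (auto simp: I_def)
    have den: "poly (ray_poly (snd (quot_of_fract u)) a b) t \<noteq> 0" "poly (ray_poly (snd (quot_of_fract v)) a b) t \<noteq> 0"
      using t(3,4) by (simp_all add: poly_ray_poly subst_ok_def)
    have c: "c1 t = poly (ray_poly (fst (quot_of_fract u)) a b) t / poly (ray_poly (snd (quot_of_fract u)) a b) t / t"
       "c2 t = poly (ray_poly (fst (quot_of_fract v)) a b) t / poly (ray_poly (snd (quot_of_fract v)) a b) t / t"
      by (simp_all add: c1_def c2_def poly_ray_poly rsubst_def)
    have c20: "c2 t \<noteq> 0" using t(2) by (simp add: good_def)
    then have num: "poly (ray_poly (fst (quot_of_fract v)) a b) t \<noteq> 0" using c(2) by auto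
    have "value_at \<kappa> (c1 t) (c2 t) = c1 t / c2 t"
      unfolding \<kappa>_def using c20 by (simp add: value_simps ok_basic value_basic)
    then show ?thesis using t(1) den num by (simp add: c P1_def P2_def)
  qed
  have "gcd P1 P2 \<noteq> 0"
  proof -
    obtain t where "t \<in> I" using eventually_happens'[OF at_neq_bot evI] by blast
    then show ?thesis using w by auto
  qed
  from gcd_coprime_exists[OF this] obtain A0 B0 where AB': "P1 = A0 * gcd P1 P2" "P2 = B0 * gcd P1 P2" and cop: "coprime A0 B0"
    by blast
  define g where "g = gcd P1 P2"
  have AB: "P1 = A0 * g" "P2 = B0 * g" using AB' unfolding g_def by blast+
  have w0: "poly B0 t \<noteq> 0" "value_at \<kappa> (c1 t) (c2 t) = poly A0 t / poly B0 t" if "t \<in> I" for t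
    using w[OF that] unfolding AB by auto
  define J where "J = wronskian A0 B0"
  define E where "E = pderiv J * B0 - 2 * J * pderiv B0"
  have chain: "((\<lambda>t. value_at f (c1 t) (c2 t)) has_real_derivative value_at (along \<omega> \<rho> f) (c1 t) (c2 t)) (at t)"
    if "t \<in> I" "ok_at f (c1 t) (c2 t)" for f t
  proof -
    have *: "good (c1 t) (c2 t)" "(c1 has_real_derivative value_at \<omega> (c1 t) (c2 t)) (at t)" "(c2 has_real_derivative value_at \<rho> (c1 t) (c2 t)) (at t)"
      using near that by (auto simp: I_def)
    then show ?thesis using DERIV_value_at[OF that(2) *(2,3)] that(2)
      unfolding along_def good_def by (simp add: value_simps ok_intros ok_at_diff mult.commute)
  qed
  have goodI: "good (c1 t) (c2 t)" if "t \<in> I" for t using near that by (auto simp: I_def)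
  have K: "value_at K (c1 t) (c2 t) = poly J t / (poly B0 t)\<^sup>2" if t: "t \<in> I" for t
  proof -
    have "((\<lambda>t. poly A0 t / poly B0 t) has_real_derivative poly J t / (poly B0 t)\<^sup>2) (at t)"
      by (rule DERIV_cong[OF DERIV_divide[OF poly_DERIV poly_DERIV w0(1)[OF t]]]) (simp add: J_def power2_eq_square)
    moreover have "\<forall>\<^sub>F s in nhds t. value_at \<kappa> (c1 s) (c2 s) = poly A0 s / poly B0 s"
      using nearI[OF t] by eventually_elim (rule w0(2))
    note DERIV_cong_ev[OF refl this refl]
    moreover have "((\<lambda>t. value_at \<kappa> (c1 t) (c2 t)) has_real_derivative value_at K (c1 t) (c2 t)) (at t)"
      using chain[OF t, of \<kappa>] goodI[OF t] unfolding D1 good_def by blast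
    ultimately show ?thesis using DERIV_unique by blast
  qed
  have E: "poly E t / poly B0 t ^ 3 = value_at \<sigma> (c1 t) (c2 t) * (poly J t / (poly B0 t)\<^sup>2)\<^sup>2" if t: "t \<in> I" for t
  proof -
    have "((\<lambda>t. poly J t / (poly B0 t)\<^sup>2) has_real_derivative poly E t / poly B0 t ^ 3) (at t)"
    proof -
      have sq: "((\<lambda>t. (poly B0 t)\<^sup>2) has_real_derivative 2 * poly B0 t * poly (pderiv B0) t) (at t)"
        by (rule DERIV_cong[OF DERIV_power[OF poly_DERIV]]) simp
      have "(Jp * B\<^sup>2 - J * (2 * B * Bp)) / (B\<^sup>2 * B\<^sup>2) = (Jp * B - 2 * J * Bp) / B ^ 3" if "B \<noteq> 0" for Jp B J Bp :: real
      proof -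
        have "(Jp * B\<^sup>2 - J * (2 * B * Bp)) / (B\<^sup>2 * B\<^sup>2) = (B * (Jp * B - 2 * J * Bp)) / (B * B ^ 3)"
          by (simp add: power2_eq_square power3_eq_cube algebra_simps)
        then show ?thesis using that by simp
      qed
      from this[OF w0(1)[OF t]] show ?thesis
        by (intro DERIV_cong[OF DERIV_divide[OF poly_DERIV sq]]) (use w0(1)[OF t] in \<open>simp_all add: E_def\<close>)
    qed
    moreover have "\<forall>\<^sub>F s in nhds t. value_at K (c1 s) (c2 s) = poly J s / (poly B0 s)\<^sup>2"
      using nearI[OF t] by eventually_elim (rule K)
    note DERIV_cong_ev[OF refl this refl]
    moreover have "((\<lambda>t. value_at K (c1 t) (c2 t)) has_real_derivative value_at \<sigma> (c1 t) (c2 t) * (value_at K (c1 t) (c2 t))\<^sup>2) (at t)"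
      using chain[OF t, of K] goodI[OF t] unfolding D2 good_def by (simp add: value_simps ok_intros)
    ultimately show ?thesis using DERIV_unique K[OF t] by metis
  qed
  have fin: "poly B0 t \<noteq> 0 \<and> poly R2 (poly A0 t / poly B0 t) \<noteq> 0 \<and> poly J t \<noteq> 0 \<and>
      poly E t * poly B0 t * poly R2 (poly A0 t / poly B0 t) = poly R1 (poly A0 t / poly B0 t) * (poly J t)\<^sup>2" if t: "t \<in> I" for t
  proof -
    define x where "x = poly A0 t / poly B0 t"
    have g: "good (c1 t) (c2 t)" by (rule goodI[OF t])
    then have "value_at \<kappa> (c1 t) (c2 t) = c1 t / c2 t"
      unfolding \<kappa>_def good_def by (simp add: value_simps ok_basic value_basic)
    then have x: "c1 t / c2 t = x" using w0(2)[OF t] by (simp add: x_def)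
    have R2x: "poly R2 x \<noteq> 0" and \<sigma>x: "value_at \<sigma> (c1 t) (c2 t) = poly R1 x / poly R2 x"
      using g x unfolding good_def by auto
    have B0: "poly B0 t \<noteq> 0" by (rule w0(1)[OF t])
    have J0: "poly J t \<noteq> 0" using g K[OF t] unfolding good_def by auto
    have "poly E t * poly B0 t * poly R2 x = poly E t / poly B0 t ^ 3 * (poly B0 t ^ 4 * poly R2 x)"
      using B0 by (simp add: power4_eq_xxxx power3_eq_cube)
    also have "\<dots> = poly R1 x * (poly J t)\<^sup>2"
      unfolding E[OF t] \<sigma>x using B0 R2x by (simp add: power2_eq_square power4_eq_xxxx)
    finally show ?thesis using B0 R2x J0 by (simp add: x_def)
  qed
  have "\<forall>\<^sub>F t in at 0. poly B0 t \<noteq> 0 \<and> poly R2 (poly A0 t / poly B0 t) \<noteq> 0 \<and> poly J t \<noteq> 0 \<and>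
      poly E t * poly B0 t * poly R2 (poly A0 t / poly B0 t) = poly R1 (poly A0 t / poly B0 t) * (poly J t)\<^sup>2"
    using evI by eventually_elim (rule fin)
  then show ?thesis using cop unfolding E_def J_def by blast
qed

text \<open>
  Let \<open>w = P / Q\<close> be the ratio along an integral curve. If \<open>w(\<infinity>) = \<infinity>\<close>, \<open>totally_ramified_solution\<close>
  gives \<open>N \<sigma> (x - c y) = (N - 1) y\<close>, and Euler's identity turns this relation for \<open>A / G\<close> into one
  for \<open>B / A\<close>. If \<open>w(\<infinity>) = p\<close> is finite, the same lemma is applied to \<open>W = 1 / (w - p)\<close>, which satisfies
  \<open>W'' = ((2 W - \<sigma>(p + 1 / W)) / W\<^sup>2) W'\<^sup>2\<close> and has \<open>W(\<infinity>) = \<infinity>\<close>.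
\<close>

lemma projective_ratio_of_flow:
  assumes flow: "rational_flow (u, v)" and vf: "has_vector_field (u, v) (\<omega>, \<rho>)"
    and G: "contact \<omega> \<rho> \<noteq> 0"
  shows "\<exists>N>0. projective_ratio \<omega> \<rho> N"
proof -
  have hom: "homogeneous 2 \<omega>" "homogeneous 2 \<rho>" using flow_vector_field_homogeneous[OF vf] by blast+
  define G A B where "G = contact \<omega> \<rho>" and "A = contact_x \<omega> \<rho>" and "B = contact_y \<omega> \<rho>"
  have G0: "G \<noteq> 0" using G by (simp add: G_def)
  have Euler: "X * A + Y * B = 2 * G" using contact_Euler[OF hom] unfolding A_def B_def G_def .
  define \<sigma> where "\<sigma> = Y * A / G"
  have \<sigma>G: "\<sigma> * G = Y * A" using G0 by (simp add: \<sigma>_def)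
  have hA: "homogeneous 2 A" unfolding A_def
    using homogeneous_mult[OF homogeneous_basic(2) homogeneous_diff_x[OF hom(1)]] homogeneous_mult[OF homogeneous_basic(1) homogeneous_diff_x[OF hom(2)]]
    by (intro homogeneous_diff) simp_all
  have hG: "homogeneous 3 G" unfolding G_def
    using homogeneous_mult[OF homogeneous_basic(2) hom(1)] homogeneous_mult[OF homogeneous_basic(1) hom(2)]
    by (intro homogeneous_diff) simp_all
  have h\<sigma>: "homogeneous 0 \<sigma>" unfolding \<sigma>_def
    using homogeneous_divide[OF homogeneous_mult[OF homogeneous_basic(2) hA] hG G0] by simp
  obtain R1 R2 where R2: "R2 \<noteq> 0"
    and R: "generically (\<lambda>a b. b \<noteq> 0 \<and> poly R2 (a / b) \<noteq> 0 \<and> value_at \<sigma> a b = poly R1 (a / b) / poly R2 (a / b))"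
    using homogeneous_0_univariate[OF h\<sigma>] by blast
  obtain P Q where cop: "coprime P Q" and ev: "\<forall>\<^sub>F t in at 0. poly Q t \<noteq> 0 \<and> poly R2 (poly P t / poly Q t) \<noteq> 0 \<and>
      poly (wronskian P Q) t \<noteq> 0 \<and>
      poly (accel P Q) t
        * poly Q t * poly R2 (poly P t / poly Q t) =
      poly R1 (poly P t / poly Q t) * (poly (wronskian P Q) t)\<^sup>2"
    using ratio_along_flow[OF flow vf G R[unfolded \<sigma>_def A_def G_def]] by blast
  show ?thesis
  proof (cases "degree Q < degree P")
    case True
    have "\<exists>N>0. \<exists>c. smult (real N) (R1 * [:- c, 1:]) = smult (real N - 1) R2"
      by (rule totally_ramified_solution[OF cop True R2], rule eventually_mono[OF ev]) blast
    then obtain N c where N: "N > 0" and eq: "smult (real N) (R1 * [:- c, 1:]) = smult (real N - 1) R2" by blast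
    have "const2 (real N) * \<sigma> * (X - const2 c * Y) = const2 (real N - 1) * Y"
    proof (rule rat2_eqI, rule generically_mono[OF generically_conj[OF R generically_ok[of \<sigma>]]], elim conjE)
      fix a b
      assume *: "b \<noteq> 0" "poly R2 (a / b) \<noteq> 0" "value_at \<sigma> a b = poly R1 (a / b) / poly R2 (a / b)" "ok_at \<sigma> a b"
      have "real N * (poly R1 (a / b) * (a / b - c)) = (real N - 1) * poly R2 (a / b)"
        using arg_cong[OF eq, of "\<lambda>p. poly p (a / b)"] by (simp add: algebra_simps)
      then have "real N * value_at \<sigma> a b * (a / b - c) = real N - 1"
        unfolding *(3) using *(2) by (simp add: mult_ac divide_eq_eq)
      then have "real N * value_at \<sigma> a b * ((a / b - c) * b) = (real N - 1) * b" by simp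
      moreover have "(a / b - c) * b = a - c * b" using *(1) by (simp add: left_diff_distrib)
      ultimately show "value_at (const2 (real N) * \<sigma> * (X - const2 c * Y)) a b = value_at (const2 (real N - 1) * Y) a b"
        using *(4) by (simp add: value_simps value_basic ok_intros ok_basic)
    qed
    then have *: "(const2 (real N) * \<sigma> * (X - const2 c * Y)) * G = (const2 (real N - 1) * Y) * G"
      by (simp only:)
    have rearr: "(n * \<sigma> * Z) * G = n * (\<sigma> * G) * Z" "n * (Y * A) * Z = Y * (n * A * Z)" "(n * Y) * G = Y * (n * G)" for n Z
      by (simp_all only: mult_ac)
    from * have "Y * (const2 (real N) * A * (X - const2 c * Y)) = Y * (const2 (real N - 1) * G)"
      unfolding rearr \<sigma>G .
    then have key: "const2 (real N) * A * (X - const2 c * Y) = const2 (real N - 1) * G" by simp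
    have "linear_form 0 (real N - 1) * B = linear_form (real N + 1) (- 2 * real N * c) * A"
    proof -
      define n k where "n = const2 (real N)" and "k = const2 c"
      have "n * A * (X - k * Y) = (n - 1) * G" using key by (simp add: n_def k_def const2_diff const2_one)
      then have "(n - 1) * (2 * G - X * A) = ((n + 1) * X - 2 * n * k * Y) * A" by algebra
      moreover have "Y * B = 2 * G - X * A" using Euler by (simp add: algebra_simps)
      ultimately show ?thesis
        by (simp add: linear_form_def const2_zero const2_one const2_diff const2_add const2_mult const2_uminus const2_numeral
            n_def[symmetric] k_def[symmetric] mult.assoc)
    qed
    then have "projective_ratio \<omega> \<rho> N"
      unfolding projective_ratio_def A_def B_def
      by (intro exI[of _ "real N + 1"] exI[of _ "- 2 * real N * c"] exI[of _ 0] exI[of _ "real N - 1"])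
        (simp add: power2_eq_square algebra_simps)
    then show ?thesis using N by blast
  next
    case False
    define J where "J = wronskian P Q"
    define E where "E = pderiv J * Q - 2 * J * pderiv Q"
    obtain t0 where t0: "poly Q t0 \<noteq> 0" "poly J t0 \<noteq> 0" using eventually_happens'[OF at_neq_bot ev] unfolding J_def by blast
    have Q0: "Q \<noteq> 0" using t0 by auto
    \<comment> \<open>the value \<open>w(\<infinity>)\<close>, and the denominator of \<open>1 / (w - p)\<close>\<close>
    define p where "p = coeff P (degree Q) / lead_coeff Q"
    define C where "C = P - smult p Q"
    have C0: "C \<noteq> 0"
    proof
      assume "C = 0"
      then have "P = smult p Q" by (simp add: C_def)
      then have "J = 0" unfolding J_def by (simp add: pderiv_smult mult.commute)
      then show False using t0 by simp
    qed
    have "degree C \<le> degree Q" unfolding C_def using False by (intro degree_diff_le) (simp_all add: degree_smult_le)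
    moreover have "coeff C (degree Q) = 0" unfolding C_def p_def using Q0 by simp
    ultimately have degC: "degree C < degree Q" using C0 by (metis le_neq_implies_less leading_coeff_0_iff)
    have copC: "coprime Q C"
    proof -
      have "gcd Q (P - smult p Q) = gcd Q P"
        using gcd_add_mult[of Q "- [:p:]" P] by simp
      then show ?thesis using cop unfolding C_def by (simp add: coprime_iff_gcd_eq_1 gcd.commute)
    qed
    \<comment> \<open>\<open>T R\<close> is \<open>x\<^sup>n R(p + 1 / x)\<close>\<close>
    define n where "n = max (degree R1) (degree R2)"
    define T where "T R = hom_subst n R [:1, p:] [:0, 1:]" for R
    have T: "poly (T R) x = x ^ n * poly R (1 / x + p)" if "x \<noteq> 0" "degree R \<le> n" for R x
      unfolding T_def using poly_hom_subst[of R n "[:0, 1:]" x "[:1, p:]"] that by (simp add: add_divide_distrib)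
    have dR: "degree R1 \<le> n" "degree R2 \<le> n" by (simp_all add: n_def)
    define S1 S2 where "S1 = [:0, 2:] * T R2 - T R1" and "S2 = [:0, 1:]\<^sup>2 * T R2"
    have J': "wronskian Q C = - J"
      unfolding C_def J_def by (simp add: pderiv_diff pderiv_smult algebra_simps)
    have QE: "Q * (pderiv J * C - 2 * J * pderiv C) = C * E - 2 * J\<^sup>2"
      unfolding C_def E_def by (simp add: pderiv_diff pderiv_smult algebra_simps power2_eq_square J_def[symmetric])
        (simp add: J_def algebra_simps)
    have evS: "\<forall>\<^sub>F t in at 0. poly C t \<noteq> 0 \<and> poly S2 (poly Q t / poly C t) \<noteq> 0 \<and>
      poly (accel Q C) t
        * poly C t * poly S2 (poly Q t / poly C t) =
      poly S1 (poly Q t / poly C t) * (poly (wronskian Q C) t)\<^sup>2"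
      using ev eventually_poly_neq_0[OF C0] unfolding J_def[symmetric] unfolding E_def[symmetric]
    proof eventually_elim
      case (elim t)
      define x where "x = poly Q t / poly C t"
      define w where "w = poly P t / poly Q t"
      have x0: "x \<noteq> 0" using elim by (simp add: x_def)
      have w: "1 / x + p = w" using elim by (simp add: x_def w_def C_def field_simps)
      have S2x: "poly S2 x = x\<^sup>2 * (x ^ n * poly R2 w)" and S1x: "poly S1 x = x ^ n * (2 * x * poly R2 w - poly R1 w)"
        using T[OF x0 dR(1)] T[OF x0 dR(2)] unfolding w by (simp_all add: S1_def S2_def power2_eq_square algebra_simps)
      define j f c q r1 r2 where "j = poly J t" and "f = poly (pderiv J * C - 2 * J * pderiv C) t" and "c = poly C t" and "q = poly Q t"
        and "r1 = poly R1 w" and "r2 = poly R2 w"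
      have qf: "q * f = c * poly E t - 2 * j\<^sup>2"
        using arg_cong[OF QE, of "\<lambda>p. poly p t"] by (simp add: j_def f_def c_def q_def)
      have Eq: "poly E t * q * r2 = r1 * j\<^sup>2" using elim by (simp add: q_def r2_def r1_def j_def w_def)
      have xc: "x * c = q" using elim by (simp add: x_def c_def q_def)
      have "- f * c * (x\<^sup>2 * r2) = - (q * f) * x * r2" unfolding xc[symmetric] by (simp add: power2_eq_square mult_ac)
      also have "\<dots> = 2 * j\<^sup>2 * x * r2 - poly E t * (x * c) * r2" unfolding qf by (simp add: algebra_simps)
      also have "\<dots> = (2 * x * r2 - r1) * j\<^sup>2" unfolding xc Eq by (simp add: algebra_simps)
      finally have main: "- f * c * (x\<^sup>2 * r2) = (2 * x * r2 - r1) * j\<^sup>2" .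
      have f': "poly (pderiv (- J) * C - 2 * (- J) * pderiv C) t = - f" by (simp add: f_def pderiv_minus)
      have "- f * c * poly S2 x = x ^ n * (- f * c * (x\<^sup>2 * r2))" unfolding S2x r2_def by (simp add: mult_ac)
      also have "\<dots> = poly S1 x * j\<^sup>2" unfolding main unfolding S1x r1_def r2_def by (simp add: mult_ac)
      finally have "- f * c * poly S2 x = poly S1 x * j\<^sup>2" .
      moreover have "poly S2 x \<noteq> 0" unfolding S2x using x0 elim by (simp add: w_def)
      ultimately show ?case using elim(2) unfolding J' f' x_def[symmetric]
        by (simp add: j_def c_def)
    qed
    have S20: "S2 \<noteq> 0"
    proof
      assume "S2 = 0"
      then have "\<forall>\<^sub>F t::real in at 0. False" using evS by simp
      then show False by simp
    qed
    obtain N c where N: "N > 0" and eq: "smult (real N) (S1 * [:- c, 1:]) = smult (real N - 1) S2"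
      using totally_ramified_solution[OF copC degC S20 evS] by blast
    define L where "L = linear_form 1 (- p)"
    have L0: "L \<noteq> 0" by (simp add: L_def linear_form_eq_0_iff)
    have "const2 (real N) * (2 * Y - \<sigma> * L) * (Y - const2 c * L) = const2 (real N - 1) * Y\<^sup>2"
    proof (rule rat2_eqI, rule generically_mono[OF generically_conj[OF generically_conj[OF R generically_ok[of \<sigma>]] generically_value_neq_0[OF L0]]], elim conjE)
      fix a b
      assume *: "b \<noteq> 0" "poly R2 (a / b) \<noteq> 0" "value_at \<sigma> a b = poly R1 (a / b) / poly R2 (a / b)" "ok_at \<sigma> a b" "value_at L a b \<noteq> 0"
      define s l x where "s = value_at \<sigma> a b" and "l = a - p * b" and "x = b / l"
      have l: "l \<noteq> 0" "value_at L a b = l" "ok_at L a b" using *(5) by (simp_all add: l_def L_def linear_form_at)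
      have x0: "x \<noteq> 0" using l *(1) by (simp add: x_def)
      have w: "1 / x + p = a / b" using *(1) by (simp add: x_def l_def field_simps)
      have "real N * (poly S1 x * (x - c)) = (real N - 1) * poly S2 x"
        using arg_cong[OF eq, of "\<lambda>p. poly p x"] by (simp add: algebra_simps)
      moreover have "poly S2 x = (x ^ n * poly R2 (a / b)) * x\<^sup>2"
        "poly S1 x = (x ^ n * poly R2 (a / b)) * (2 * x - s)"
        using T[OF x0 dR(1)] T[OF x0 dR(2)] *(2) unfolding w s_def *(3)
        by (simp_all add: S1_def S2_def power2_eq_square algebra_simps)
      ultimately have "(x ^ n * poly R2 (a / b)) * (real N * ((2 * x - s) * (x - c))) = (x ^ n * poly R2 (a / b)) * ((real N - 1) * x\<^sup>2)"
        by (simp only: mult_ac)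
      moreover have "x ^ n * poly R2 (a / b) \<noteq> 0" using x0 *(2) by simp
      ultimately have xx: "real N * ((2 * x - s) * (x - c)) = (real N - 1) * x\<^sup>2" using mult_left_cancel by blast
      have xl: "x * l = b" using l by (simp add: x_def)
      have "real N * (2 * b - s * l) * (b - c * l) = real N * ((2 * x - s) * (x - c)) * l\<^sup>2"
        unfolding xl[symmetric] by (simp add: power2_eq_square algebra_simps)
      also have "\<dots> = (real N - 1) * b\<^sup>2" unfolding xx xl[symmetric] by (simp add: power_mult_distrib)
      finally have "real N * (2 * b - s * l) * (b - c * l) = (real N - 1) * b\<^sup>2" .
      then show "value_at (const2 (real N) * (2 * Y - \<sigma> * L) * (Y - const2 c * L)) a b = value_at (const2 (real N - 1) * Y\<^sup>2) a b"
        unfolding const2_numeral[symmetric] using *(4) l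
        by (simp add: value_simps value_basic ok_intros ok_basic s_def)
    qed
    note rat = this
    define m k r where "m = const2 (real N)" and "k = const2 c" and "r = const2 p"
    have "(m * (2 * Y - \<sigma> * L) * (Y - k * L)) * G = (m - 1) * Y\<^sup>2 * G"
      using rat by (simp add: m_def k_def const2_diff const2_one)
    moreover have "(m * (2 * Y - \<sigma> * L) * (Y - k * L)) * G = m * (2 * Y * G - (\<sigma> * G) * L) * (Y - k * L)"
      by (simp add: algebra_simps)
    ultimately have "m * (2 * Y * G - Y * A * L) * (Y - k * L) = (m - 1) * Y\<^sup>2 * G" unfolding \<sigma>G by simp
    then have "Y * (m * (2 * G - A * L) * (Y - k * L)) = Y * ((m - 1) * Y * G)"
      by (simp add: power2_eq_square algebra_simps)
    then have key: "m * (2 * G - A * L) * (Y - k * L) = (m - 1) * Y * G" by simp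
    have L: "L = X - r * Y" by (simp add: L_def linear_form_def r_def const2_one const2_uminus)
    have YB: "Y * B = 2 * G - X * A" using Euler by (simp add: algebra_simps)
    have "2 * (m * (2 * G - A * L) * (Y - k * L)) = (m - 1) * Y * (2 * G)" using key by simp
    then have "2 * m * A * L * (Y - k * L) = 2 * G * ((m + 1) * Y - 2 * m * k * L)" by algebra
    moreover have "2 * G = Y * B + X * A" using YB by simp
    ultimately have "2 * m * A * L * (Y - k * L) = (Y * B + X * A) * ((m + 1) * Y - 2 * m * k * L)" by simp
    then have "Y * (((m + 1) * Y - 2 * m * k * L) * B) = A * (2 * m * L * (Y - k * L) - X * ((m + 1) * Y - 2 * m * k * L))"
      by (simp add: algebra_simps)
    also have "\<dots> = Y * (((m - 1 + 2 * m * k * r) * X - 2 * m * r * (1 + k * r) * Y) * A)"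
      unfolding L by (simp add: algebra_simps)
    finally have "((m + 1) * Y - 2 * m * k * L) * B = ((m - 1 + 2 * m * k * r) * X - 2 * m * r * (1 + k * r) * Y) * A" by simp
    moreover have "linear_form (- 2 * real N * c) (real N + 1 + 2 * real N * c * p) = (m + 1) * Y - 2 * m * k * L"
      unfolding L linear_form_def
      by (simp add: const2_add const2_mult const2_uminus const2_one const2_numeral m_def[symmetric] k_def[symmetric] r_def[symmetric] algebra_simps)
    moreover have "linear_form (real N - 1 + 2 * real N * c * p) (- 2 * real N * p * (1 + c * p)) = (m - 1 + 2 * m * k * r) * X - 2 * m * r * (1 + k * r) * Y"
      unfolding linear_form_def
      by (simp add: const2_add const2_diff const2_mult const2_uminus const2_one const2_numeral m_def[symmetric] k_def[symmetric] r_def[symmetric] algebra_simps)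
    ultimately have "projective_ratio \<omega> \<rho> N"
      unfolding projective_ratio_def A_def B_def
      by (intro exI[of _ "real N - 1 + 2 * real N * c * p"] exI[of _ "- 2 * real N * p * (1 + c * p)"]
          exI[of _ "- 2 * real N * c"] exI[of _ "real N + 1 + 2 * real N * c * p"])
        (simp, simp add: power2_eq_square algebra_simps)
    then show ?thesis using N by blast
  qed
qed

section \<open>Characterisation of vector fields of rational flows\<close>

lemma projective_ratio_of_ratio_condition:
  assumes "ratio_condition \<omega> \<rho> N"
  shows "projective_ratio \<omega> \<rho> N"
proof -
  obtain a b c d where *: "contact_x \<omega> \<rho> \<noteq> 0" "linear_form c d \<noteq> 0"
    "(contact_y \<omega> \<rho>) / (contact_x \<omega> \<rho>) = linear_form a b / linear_form c d"
    "a \<noteq> d" "((a + d)\<^sup>2 - 4 * b * c) / (a - d)\<^sup>2 = (real N)\<^sup>2"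
    using assms unfolding ratio_condition_def linear_form_def by blast
  have "(a + d)\<^sup>2 - 4 * b * c = (real N)\<^sup>2 * (a - d)\<^sup>2" using *(4,5) by (simp add: divide_eq_eq)
  moreover have "linear_form c d * (contact_y \<omega> \<rho>) = linear_form a b * (contact_x \<omega> \<rho>)"
    using *(1-3) by (simp add: frac_eq_eq mult.commute)
  ultimately show ?thesis using *(4) unfolding projective_ratio_def by blast
qed

lemma projective_ratio_of_level1_condition:
  assumes "level1_condition \<omega> \<rho>"
  shows "projective_ratio \<omega> \<rho> 1"
  using assms unfolding level1_condition_def
proof
  assume "contact_x \<omega> \<rho> = 0"
  then show ?thesis unfolding projective_ratio_def
    by (intro exI[of _ 1] exI[of _ 0]) (simp add: linear_form_eq_0_iff)
next
  assume "contact_y \<omega> \<rho> = 0"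
  then show ?thesis unfolding projective_ratio_def
    by (intro exI[of _ 0] exI[of _ 0] exI[of _ 0] exI[of _ 1]) (simp add: linear_form_eq_0_iff)
qed

text \<open>
  If \<open>contact_x\<close> vanishes, the condition for level one holds for the partial derivative in \<open>x\<close>;
  otherwise the quotients in the ratio condition are honest.
\<close>

lemma conditions_of_projective_ratio:
  assumes "projective_ratio \<omega> \<rho> N"
  shows "level1_condition \<omega> \<rho> \<or> ratio_condition \<omega> \<rho> N"
proof (cases "contact_x \<omega> \<rho> = 0")
  case False
  obtain a b c d where *: "a \<noteq> d" "(a + d)\<^sup>2 - 4 * b * c = (real N)\<^sup>2 * (a - d)\<^sup>2"
    "linear_form c d * (contact_y \<omega> \<rho>) = linear_form a b * (contact_x \<omega> \<rho>)"
    using assms unfolding projective_ratio_def by blast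
  have "linear_form c d \<noteq> 0"
  proof
    assume "linear_form c d = 0"
    then have "linear_form a b = 0" "d = 0" using *(3) False by (simp, simp add: linear_form_eq_0_iff)
    then show False using *(1) by (simp add: linear_form_eq_0_iff)
  qed
  moreover have "(contact_y \<omega> \<rho>) / (contact_x \<omega> \<rho>) = linear_form a b / linear_form c d"
    using *(3) False calculation by (simp add: frac_eq_eq mult.commute)
  moreover have "((a + d)\<^sup>2 - 4 * b * c) / (a - d)\<^sup>2 = (real N)\<^sup>2" using *(1,2) by simp
  ultimately have "ratio_condition \<omega> \<rho> N"
    unfolding ratio_condition_def using False *(1) unfolding linear_form_def by blast
  then show ?thesis ..
qed (simp add: level1_condition_def)

text \<open>
  Existence of a flow and its level follow from the same linearising transformation: the conjugate
  canonical flow has the given field, and every flow with this field is such a conjugate.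
\<close>

lemma linearised_vector_field:
  assumes hom: "homogeneous 2 \<omega>" "homogeneous 2 \<rho>" and nz: "\<not> (\<omega> = 0 \<and> \<rho> = 0)"
    and N: "level0_condition \<omega> \<rho> \<and> N = 0 \<or> N > 0 \<and> projective_ratio \<omega> \<rho> N"
  shows "\<exists>\<phi>. rational_flow \<phi> \<and> has_vector_field \<phi> (\<omega>, \<rho>)"
    and "rational_flow \<phi> \<Longrightarrow> has_vector_field \<phi> (\<omega>, \<rho>) \<Longrightarrow> has_level \<phi> N"
proof -
  obtain l1 l2 m1 m2 where "birational_pair l1 l2 m1 m2"
    and D: "along \<omega> \<rho> l1 = const2 (real_of_int (int N - 1)) * l1 * l2" "along \<omega> \<rho> l2 = - (l2\<^sup>2)"
    using N linearisation_level_0[OF hom(2) nz] linearisation_positive_level[OF hom nz]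
    unfolding level0_condition_def by blast
  then interpret birational_pair l1 l2 m1 m2 by blast
  show "\<exists>\<phi>. rational_flow \<phi> \<and> has_vector_field \<phi> (\<omega>, \<rho>)"
    using conjugate_is_flow[OF D[unfolded along_def] nz] .
  assume \<phi>: "rational_flow \<phi>" "has_vector_field \<phi> (\<omega>, \<rho>)"
  obtain u v where uv: "\<phi> = (u, v)" by (cases \<phi>)
  have "one_BIR (l1, l2)" using hom_l inv by (auto simp: one_BIR_def)
  from flow_is_conjugate[OF \<phi>[unfolded uv] D[unfolded along_def] this]
  show "has_level \<phi> N" unfolding uv by (rule level_unique)
qed

theorem proposition2:
  shows
    "(\<forall>\<phi>. rational_flow \<phi> \<longrightarrow>
        (\<exists>w. has_vector_field \<phi> w) \<and>
        (\<forall>\<omega> \<rho>. has_vector_field \<phi> (\<omega>, \<rho>) \<longrightarrow> homogeneous 2 \<omega> \<and> homogeneous 2 \<rho>))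
     \<and>
     (\<forall>\<omega> \<rho> :: rat2.
        homogeneous 2 \<omega> \<longrightarrow> homogeneous 2 \<rho> \<longrightarrow> \<not> (\<omega> = 0 \<and> \<rho> = 0) \<longrightarrow>
        ((\<exists>\<phi>. rational_flow \<phi> \<and> has_vector_field \<phi> (\<omega>, \<rho>)) \<longleftrightarrow>
           level0_condition \<omega> \<rho> \<or> level1_condition \<omega> \<rho> \<or>
           (\<exists>N>0. ratio_condition \<omega> \<rho> N)) \<and>
        (\<forall>\<phi>. rational_flow \<phi> \<and> has_vector_field \<phi> (\<omega>, \<rho>) \<longrightarrow>
           (level0_condition \<omega> \<rho> \<longrightarrow> has_level \<phi> 0) \<and>
           (level1_condition \<omega> \<rho> \<longrightarrow> has_level \<phi> 1) \<and>
           (\<forall>N>0. ratio_condition \<omega> \<rho> N \<longrightarrow> has_level \<phi> N)))"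
proof (intro conjI allI impI, goal_cases)
  case (1 \<phi>)
  then show ?case by (rule flow_vector_field)
next
  case (2 \<phi> \<omega> \<rho>)
  then show ?case by (intro flow_vector_field_homogeneous(1))
next
  case (3 \<phi> \<omega> \<rho>)
  then show ?case by (intro flow_vector_field_homogeneous(2))
next
  case (4 \<omega> \<rho>)
  note L = linearised_vector_field(1)[OF 4]
  show ?case
  proof
    assume "\<exists>\<phi>. rational_flow \<phi> \<and> has_vector_field \<phi> (\<omega>, \<rho>)"
    then obtain u v where "rational_flow (u, v)" "has_vector_field (u, v) (\<omega>, \<rho>)" by auto
    from projective_ratio_of_flow[OF this]
    show "level0_condition \<omega> \<rho> \<or> level1_condition \<omega> \<rho> \<or> (\<exists>N>0. ratio_condition \<omega> \<rho> N)"
      using conditions_of_projective_ratio unfolding level0_condition_def by blast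
  next
    assume "level0_condition \<omega> \<rho> \<or> level1_condition \<omega> \<rho> \<or> (\<exists>N>0. ratio_condition \<omega> \<rho> N)"
    then show "\<exists>\<phi>. rational_flow \<phi> \<and> has_vector_field \<phi> (\<omega>, \<rho>)"
      using L[of 0] L[of 1] L projective_ratio_of_level1_condition projective_ratio_of_ratio_condition by (metis zero_less_one)
  qed
next
  case (5 \<omega> \<rho> \<phi>)
  then show ?case using linearised_vector_field(2)[of \<omega> \<rho> 0 \<phi>] by blast
next
  case (6 \<omega> \<rho> \<phi>)
  then show ?case using linearised_vector_field(2)[of \<omega> \<rho> 1 \<phi>] projective_ratio_of_level1_condition by simp
next
  case (7 \<omega> \<rho> \<phi> N)
  then show ?case using linearised_vector_field(2)[of \<omega> \<rho> N \<phi>] projective_ratio_of_ratio_condition by blast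
qed

end
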